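(* Let $F\in\mathcal S^\sharp$ with degree $d\geq1$, $\alpha>0$ and $\ell=0,1,2,\dots$ Then $\overline{F}_\ell(s,\alpha)$ is an entire function, not identically vanishing. Moreover, uniformly for $\sigma$ in any bounded interval, as $|t|\to\infty$ we have \[ \overline{F}_\ell(s,\alpha) \ll e^{\frac{\pi}{2} d |t|} |t|^{c(\sigma)} \] with a certain $c(\sigma)\geq0$ independent of $\ell$ and $\alpha$, satisfying $c(\sigma)=0$ for $\sigma>1$.
   Context: Write $s=\sigma+it$. The extended Selberg class $\mathcal S^\sharp$ consists of non identically vanishing Dirichlet series $F(s)=\sum_{n\ge1}a(n)n^{-s}$, absolutely convergent for $\sigma>1$, such that $(s-1)^mF(s)$ is entire of finite order for some integer $m\geq0$, and satisfying $F(s)\gamma(s)=\omega\overline{\gamma}(1-s)\overline{F}(1-s)$, where $\overline f(s)=\overline{f(\overline s)}$, $\gamma(s)=Q^s\prod_{j=1}^r\Gamma(\lambda_js+\mu_j)$, $|\omega|=1$, $Q>0$, $r\ge0$, $\lambda_j>0$, $\Re\mu_j\ge0$. Degree $d=2\sum_j\lambda_j$, conductor $q=(2\pi)^dQ^2\prod_j\lambda_j^{2\lambda_j}$, $\xi_F=2\sum_j(\mu_j-\frac12)=\eta_F+id\theta_F$ with $\eta_F,\theta_F\in\mathbb R$. Write \[ S_F(s)=2^r\prod_{j=1}^r\sin(\pi(\lambda_js+\mu_j))=\sum_{j=-N}^N a_je^{i\pi d\omega_js}, \] with $N\ge1$, $a_j\in\mathbb C$, $-\frac12=\omega_{-N}<\dots<\omega_N=\frac12$,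 $\omega_{-j}=-\omega_j$. Let $n_\alpha=qd^{-d}\alpha^d$, with $a(n_\alpha)=0$ if $n_\alpha\notin\mathbb N$. Let $s_\ell=\frac{d+1}{2d}-\frac{\ell}{d}$ and $s_\ell^*=s_\ell-i\theta_F$. Define \[ \overline{F}_\ell(s,\alpha)=\sum_{j=-N}^N a_je^{i\pi d\omega_j(1-s)}\sum_{\substack{n\ge1\\ (j,n)\neq(-N,n_\alpha)}}\frac{\overline{a(n)}}{n^s}\Big(1+e^{i\pi(\frac12-\omega_j)}\big(\tfrac{n_\alpha}{n}\big)^{1/d}\Big)^{d(1-s-s_\ell^* )}, \] i.e. in the inner sum the term $n=n_\alpha$ is omitted when $j=-N$; the power is $e^{d(1-s-s_\ell^* )\mathrm{Log}(\cdot)}$ with the branch of Log on the closed upper half-plane minus $0$ having argument in $[0,\pi]$.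
   Formalization: Uniformity up to σ=1 from the right fails (F=ζ, ℓ=0, transcendental 0<α<1), so the bound with c(σ) is proved uniformly on bounded intervals minus (1,1+δ) for every δ>0, and on whole bounded intervals with exponent c(σ)+ε for every ε>0. *)

theory Defs
  imports "HOL-Complex_Analysis.Complex_Analysis"
begin

definition conj_fun :: "(complex \<Rightarrow> complex) \<Rightarrow> complex \<Rightarrow> complex" where
  "conj_fun f s = cnj (f (cnj s))"

definition finite_order :: "(complex \<Rightarrow> complex) \<Rightarrow> bool" where
  "finite_order f \<longleftrightarrow>
     (\<exists>(\<rho>::real) C R. \<forall>z. norm z \<ge> R \<longrightarrow> norm (f z) \<le> C * exp (norm z powr \<rho>))"

definition gamma_factor ::
  "real \<Rightarrow> nat \<Rightarrow> (nat \<Rightarrow> real) \<Rightarrow> (nat \<Rightarrow> complex) \<Rightarrow> complex \<Rightarrow> complex" where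
  "gamma_factor Q r lam mu s =
     of_real Q powr s * (\<Prod>j=1..r. Gamma (of_real (lam j) * s + mu j))"

definition gamma_factor_regular ::
  "nat \<Rightarrow> (nat \<Rightarrow> real) \<Rightarrow> (nat \<Rightarrow> complex) \<Rightarrow> complex \<Rightarrow> bool" where
  "gamma_factor_regular r lam mu s \<longleftrightarrow>
     (\<forall>j\<in>{1..r}. of_real (lam j) * s + mu j \<notin> \<int>\<^sub>\<le>\<^sub>0)"

text \<open>
  Membership of \<open>F\<close>, with Dirichlet coefficients \<open>a\<close>, in the extended Selberg class, together with
  the data of its functional equation. The functional equation is an identity of meromorphic
  functions; it is stated at the points where no factor can have a pole, because HOL functions take
  arbitrary values at poles. For the same reason the value of \<open>F\<close> at 1 is left unconstrained.
\<close>

definition extended_selberg ::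
  "(complex \<Rightarrow> complex) \<Rightarrow> (nat \<Rightarrow> complex) \<Rightarrow> complex \<Rightarrow> real \<Rightarrow> nat \<Rightarrow>
     (nat \<Rightarrow> real) \<Rightarrow> (nat \<Rightarrow> complex) \<Rightarrow> bool" where
  "extended_selberg F a \<omega> Q r lam mu \<longleftrightarrow>
     (\<forall>s. Re s > 1 \<longrightarrow>
        (\<lambda>n. norm (a n / of_nat n powr s)) summable_on {1..} \<and>
        ((\<lambda>n. a n / of_nat n powr s) has_sum F s) {1..}) \<and>
     (\<exists>s. Re s > 1 \<and> F s \<noteq> 0) \<and>
     (\<exists>(m::nat) E. E holomorphic_on UNIV \<and> finite_order E \<and>
        (\<forall>s. s \<noteq> 1 \<longrightarrow> E s = (s - 1) ^ m * F s)) \<and>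
     norm \<omega> = 1 \<and> Q > 0 \<and> (\<forall>j\<in>{1..r}. lam j > 0 \<and> Re (mu j) \<ge> 0) \<and>
     (\<forall>s. s \<noteq> 0 \<and> s \<noteq> 1 \<and> gamma_factor_regular r lam mu s \<and>
          gamma_factor_regular r lam mu (cnj (1 - s)) \<longrightarrow>
        F s * gamma_factor Q r lam mu s =
          \<omega> * conj_fun (gamma_factor Q r lam mu) (1 - s) * conj_fun F (1 - s))"

definition selberg_degree :: "nat \<Rightarrow> (nat \<Rightarrow> real) \<Rightarrow> real" where
  "selberg_degree r lam = 2 * (\<Sum>j=1..r. lam j)"

definition selberg_conductor :: "real \<Rightarrow> nat \<Rightarrow> (nat \<Rightarrow> real) \<Rightarrow> real" where
  "selberg_conductor Q r lam =
     (2 * pi) powr selberg_degree r lam * Q\<^sup>2 * (\<Prod>j=1..r. lam j powr (2 * lam j))"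

definition selberg_xi :: "nat \<Rightarrow> (nat \<Rightarrow> complex) \<Rightarrow> complex" where
  "selberg_xi r mu = 2 * (\<Sum>j=1..r. mu j - 1/2)"

text \<open>From \<open>\<xi>\<^sub>F = \<eta>\<^sub>F + i d \<theta>\<^sub>F\<close> with real \<open>\<eta>\<^sub>F\<close>, \<open>\<theta>\<^sub>F\<close>.\<close>

definition selberg_theta :: "nat \<Rightarrow> (nat \<Rightarrow> real) \<Rightarrow> (nat \<Rightarrow> complex) \<Rightarrow> real" where
  "selberg_theta r lam mu = Im (selberg_xi r mu) / selberg_degree r lam"

definition selberg_S :: "nat \<Rightarrow> (nat \<Rightarrow> real) \<Rightarrow> (nat \<Rightarrow> complex) \<Rightarrow> complex \<Rightarrow> complex" where
  "selberg_S r lam mu s =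
     2 ^ r * (\<Prod>j=1..r. sin (of_real pi * (of_real (lam j) * s + mu j)))"

text \<open>
  \<open>b\<close> and \<open>w\<close> are the coefficients \<open>a\<^sub>j\<close> and frequencies \<open>\<omega>\<^sub>j\<close> (\<open>-N \<le> j \<le> N\<close>). They are determined by
  \<open>selberg_S\<close> up to inserting terms with coefficient 0.
\<close>

definition selberg_S_expansion ::
  "nat \<Rightarrow> (nat \<Rightarrow> real) \<Rightarrow> (nat \<Rightarrow> complex) \<Rightarrow> int \<Rightarrow> (int \<Rightarrow> complex) \<Rightarrow> (int \<Rightarrow> real) \<Rightarrow> bool" where
  "selberg_S_expansion r lam mu N b w \<longleftrightarrow>
     N \<ge> 1 \<and> strict_mono_on {-N..N} w \<and> w (-N) = -1/2 \<and> w N = 1/2 \<and>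
     (\<forall>j\<in>{-N..N}. w (-j) = - w j) \<and>
     (\<forall>s. selberg_S r lam mu s =
        (\<Sum>j\<in>{-N..N}. b j * exp (\<i> * of_real (pi * selberg_degree r lam * w j) * s)))"

definition n_alpha :: "real \<Rightarrow> nat \<Rightarrow> (nat \<Rightarrow> real) \<Rightarrow> real \<Rightarrow> real" where
  "n_alpha Q r lam \<alpha> =
     (let d = selberg_degree r lam in selberg_conductor Q r lam * d powr (-d) * \<alpha> powr d)"

definition s_star :: "nat \<Rightarrow> (nat \<Rightarrow> real) \<Rightarrow> (nat \<Rightarrow> complex) \<Rightarrow> nat \<Rightarrow> complex" where
  "s_star r lam mu l =
     (let d = selberg_degree r lam
      in of_real ((d + 1) / (2 * d) - real l / d) - \<i> * of_real (selberg_theta r lam mu))"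

text \<open>
  The base of the power lies in the closed upper half-plane (as \<open>-1/2 \<le> w j \<le> 1/2\<close>), where \<open>Ln\<close>, the
  branch underlying \<open>powr\<close>, has imaginary part in \<open>[0, \<pi>]\<close>. The base vanishes only for the
  pair \<open>(-N, n_alpha)\<close>, which \<open>Fbar_index\<close> excludes.
\<close>

definition Fbar_term ::
  "(nat \<Rightarrow> complex) \<Rightarrow> real \<Rightarrow> nat \<Rightarrow> (nat \<Rightarrow> real) \<Rightarrow> (nat \<Rightarrow> complex) \<Rightarrow> (int \<Rightarrow> real) \<Rightarrow>
     real \<Rightarrow> nat \<Rightarrow> complex \<Rightarrow> int \<Rightarrow> nat \<Rightarrow> complex" where
  "Fbar_term a Q r lam mu w \<alpha> l s j n =
     (let d = selberg_degree r lam
      in cnj (a n) / of_nat n powr s *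
         (1 + cis (pi * (1/2 - w j)) * of_real ((n_alpha Q r lam \<alpha> / real n) powr (1 / d)))
           powr (of_real d * (1 - s - s_star r lam mu l)))"

definition Fbar_index :: "real \<Rightarrow> nat \<Rightarrow> (nat \<Rightarrow> real) \<Rightarrow> int \<Rightarrow> real \<Rightarrow> int \<Rightarrow> nat set" where
  "Fbar_index Q r lam N \<alpha> j = {n. n \<ge> 1 \<and> \<not> (j = -N \<and> real n = n_alpha Q r lam \<alpha>)}"

definition Fbar_series ::
  "(nat \<Rightarrow> complex) \<Rightarrow> real \<Rightarrow> nat \<Rightarrow> (nat \<Rightarrow> real) \<Rightarrow> (nat \<Rightarrow> complex) \<Rightarrow>
     int \<Rightarrow> (int \<Rightarrow> complex) \<Rightarrow> (int \<Rightarrow> real) \<Rightarrow> real \<Rightarrow> nat \<Rightarrow> complex \<Rightarrow> complex" where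
  "Fbar_series a Q r lam mu N b w \<alpha> l s =
     (\<Sum>j\<in>{-N..N}. b j * exp (\<i> * of_real (pi * selberg_degree r lam * w j) * (1 - s)) *
        (\<Sum>\<^sub>\<infinity>n\<in>Fbar_index Q r lam N \<alpha> j. Fbar_term a Q r lam mu w \<alpha> l s j n))"

text \<open>
  \<open>G(\<sigma> + it) \<lless> exp (\<pi> d |t| / 2) |t|\<^bsup>e(\<sigma>)\<^esup>\<close> as \<open>|t| \<rightarrow> \<infinity>\<close>, uniformly for \<open>\<sigma> \<in> S\<close>.
\<close>

definition vertical_bound :: "(complex \<Rightarrow> complex) \<Rightarrow> real \<Rightarrow> (real \<Rightarrow> real) \<Rightarrow> real set \<Rightarrow> bool" where
  "vertical_bound G d e S \<longleftrightarrow>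
     (\<exists>C T. \<forall>\<sigma>\<in>S. \<forall>t. \<bar>t\<bar> \<ge> T \<longrightarrow>
        norm (G (Complex \<sigma> t)) \<le> C * exp (pi / 2 * d * \<bar>t\<bar>) * \<bar>t\<bar> powr e \<sigma>)"

text \<open>
  Reading of ``uniformly for \<open>\<sigma>\<close> in any bounded interval, \<open>G(s) \<lless> exp (\<pi> d |t| / 2) |t|\<^bsup>c(\<sigma>)\<^esup>\<close>'' when
  \<open>c(\<sigma>) = 0\<close> for \<open>\<sigma> > 1\<close>. With an implied constant uniform up to 1 from the right the claim would, by
  continuity, also bound \<open>G(1 + it)\<close> by \<open>O(exp (\<pi> d |t| / 2))\<close>. That is false already
  for the Riemann zeta function, \<open>l = 0\<close> and transcendental \<open>0 < \<alpha> < 1\<close>, where the dominant part is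
  the Hurwitz zeta function, unbounded on \<open>Re s = 1\<close>. So the exact exponent is
  claimed uniformly on any bounded interval with an arbitrarily short
  \<open>(1, 1 + \<delta>)\<close> removed, and on the whole interval uniformity holds up to \<open>|t|\<^bsup>\<epsilon>\<^esup>\<close>.
\<close>

definition locally_uniform_vertical_bound ::
  "(complex \<Rightarrow> complex) \<Rightarrow> real \<Rightarrow> (real \<Rightarrow> real) \<Rightarrow> bool" where
  "locally_uniform_vertical_bound G d c \<longleftrightarrow>
     (\<forall>A B. \<forall>\<delta>>0. vertical_bound G d c ({A..B} - {1<..<1 + \<delta>})) \<and>
     (\<forall>A B. \<forall>\<epsilon>>0. vertical_bound G d (\<lambda>\<sigma>. c \<sigma> + \<epsilon>) {A..B})"

end

theory Submission
  imports Defs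
begin

text \<open>
  For large \<open>n\<close> expand the power by the binomial series. Since \<open>exp (i \<pi> k (1/2 - \<omega>\<^sub>j))\<close> is \<open>i\<^sup>k\<close> times the factor by
  which \<open>exp (i \<pi> d \<omega>\<^sub>j (1 - s))\<close> changes under \<open>s \<mapsto> s + k/d\<close>, summing over \<open>j\<close> turns the \<open>k\<close>-th term into
  a multiple of \<open>H (s + k/d)\<close>, where \<open>H s = S (1 - s) cnj (F (cnj s))\<close>. By the functional equation and
  the reflection formula \<open>H\<close> is entire, and the Taylor remainder of order \<open>K\<close> gives a series that
  converges for \<open>Re s > 1 - K/d\<close>.

  The angle \<open>\<pi> \<omega>\<^sub>j\<close> plus the argument of the base lies in \<open>[-\<pi>/2, \<pi>/2]\<close>, also along the segment used for
  the remainder, which yields the factor \<open>exp (\<pi> d |t| / 2)\<close>. Everything else is polynomial in \<open>t\<close>: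
  \<open>F\<close> is so on vertical strips by the functional equation, an elementary bound for Gamma ratios and
  Phragmen-Lindeloef. The exponent depends only on the order \<open>K\<close> and on the growth of \<open>H\<close>, hence neither on
  \<open>\<alpha>\<close> nor on \<open>l\<close>.

  For non-vanishing, the series is a generalised Dirichlet series whose complex frequencies are \<open>d\<close>
  times the logarithms of the distinct points \<open>n\<^bsup>1/d\<^esup> exp (i \<pi> \<omega>\<^sub>j) + i n\<^sub>\<alpha>\<^bsup>1/d\<^esup>\<close>.
\<close>

subsection \<open>Growth of holomorphic functions in vertical strips\<close>

text \<open>For a single \<open>j\<close> the \<open>k\<close>-th binomial term is a shift of
  \<open>cnj (F (cnj s))\<close>, possibly with a pole at \<open>s = 1 - k/d\<close>; only the sum
  over \<open>j\<close> supplies the zeros of \<open>S\<close> that remove it. But the expansion is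
  available only for large \<open>n\<close>, and the index sets differ in finitely many
  \<open>n\<close>. Hence the cutoff \<open>M\<close>: terms below it stay unexpanded and are
  entire, above it all \<open>j\<close> share one range of \<open>n\<close>, and the Dirichlet
  polynomial over \<open>n \<le> M\<close> is subtracted again from what \<open>H\<close> brings in.
  The exponential rate leaves no slack: bounded separately, \<open>e j s\<close> and the power would
  give a larger exponential. So \<open>e j s\<close> is carried along inside the sum and inside the
  Taylor remainder. For the exponent to be independent of \<alpha> and \<open>l\<close>,
  \<open>H\<close> and its growth are fixed first; afterwards \<alpha> and \<open>l\<close> enter
  only through \<nu>, \<kappa> and the index sets, which affect constants alone. On the right of 1
  the exponent 0 comes from absolute convergence, with a constant that depends on the distance to 1.
  Interpolation with the polynomial bound on the left gives uniformity up to an \<epsilon>.\<close>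

lemma strip_max_modulus:
  assumes hol: "f holomorphic_on {s. a \<le> Re s \<and> Re s \<le> b}"
    and bdry: "\<And>s. Re s = a \<or> Re s = b \<Longrightarrow> norm (f s) \<le> M"
    and far: "\<And>s. a \<le> Re s \<Longrightarrow> Re s \<le> b \<Longrightarrow> T \<le> \<bar>Im s\<bar> \<Longrightarrow> norm (f s) \<le> M"
    and s0: "a \<le> Re s0" "Re s0 \<le> b"
  shows "norm (f s0) \<le> M"
proof -
  define R where "R = max T \<bar>Im s0\<bar>"
  define S where "S = cbox (Complex a (-R)) (Complex b R)"
  have S_strip: "S \<subseteq> {s. a \<le> Re s \<and> Re s \<le> b}"
    by (auto simp: S_def in_cbox_complex_iff)
  show ?thesis
  proof (rule maximum_modulus_frontier[of f S])
    show "f holomorphic_on interior S"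
      using hol S_strip interior_subset by (meson holomorphic_on_subset order_trans)
    show "continuous_on (closure S) f"
      using holomorphic_on_imp_continuous_on[OF holomorphic_on_subset[OF hol S_strip]]
      by (simp add: S_def)
    show "bounded S" by (simp add: S_def)
    show "norm (f z) \<le> M" if "z \<in> frontier S" for z
    proof -
      have "z \<in> cbox (Complex a (-R)) (Complex b R) - box (Complex a (-R)) (Complex b R)"
        using that by (simp add: S_def frontier_cbox)
      then have "a \<le> Re z" "Re z \<le> b" and "Re z = a \<or> Re z = b \<or> T \<le> \<bar>Im z\<bar>"
        by (auto simp: in_cbox_complex_iff in_box_complex_iff R_def)
      then show ?thesis using bdry far by blast
    qed
    show "s0 \<in> S" using s0 by (auto simp: S_def in_cbox_complex_iff R_def)
  qed
qed

text \<open>Half of \<open>c * exp (\<beta> * t)\<close> absorbs the power, the other half the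
  constant \<open>K\<close>. The threshold \<open>e\<close> is set so that
  \<open>e * exp (\<beta> * (k + t))\<close> is \<open>\<beta> ^ n\<close> times the first
  half.\<close>

lemma exp_dominates_shifted_power:
  fixes k \<beta> c K :: real
  assumes "\<beta> > 0" "c > 0"
  shows "eventually (\<lambda>t. (k + t) ^ n - c * exp (\<beta> * t) \<le> K) at_top"
proof -
  have l0: "((\<lambda>u::real. u ^ n / exp u) \<longlongrightarrow> 0) at_top"
    by (rule tendsto_power_div_exp_0)
  have fl: "filterlim (\<lambda>t. \<beta> * (k + t)) at_top at_top"
    using assms(1)
    by (intro filterlim_tendsto_pos_mult_at_top[OF tendsto_const]
        filterlim_tendsto_add_at_top[OF tendsto_const] filterlim_ident)
  have l1: "((\<lambda>t. (\<beta> * (k + t)) ^ n / exp (\<beta> * (k + t))) \<longlongrightarrow> 0) at_top"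
    using filterlim_compose[OF l0 fl] .
  define e where "e = c * \<beta> ^ n / (2 * exp (\<beta> * k))"
  have e: "e > 0" using assms by (simp add: e_def)
  have fl2: "filterlim (\<lambda>t. \<beta> * t) at_top at_top"
    using assms(1) by (intro filterlim_tendsto_pos_mult_at_top[OF tendsto_const] filterlim_ident)
  have "eventually (\<lambda>t. exp (\<beta> * t) \<ge> 2 * \<bar>K\<bar> / c) at_top"
    using filterlim_compose[OF exp_at_top fl2] by (simp add: filterlim_at_top)
  moreover have "eventually (\<lambda>t. (\<beta> * (k + t)) ^ n / exp (\<beta> * (k + t)) < e) at_top"
    using order_tendstoD(2)[OF l1 e] .
  ultimately show ?thesis
  proof eventually_elim
    case (elim t)
    have "(\<beta> * (k + t)) ^ n < e * exp (\<beta> * (k + t))"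
      using elim(2) by (simp add: field_simps)
    also have "\<dots> = \<beta> ^ n * (c / 2 * exp (\<beta> * t))"
      by (simp add: e_def distrib_left exp_add)
    finally have "(k + t) ^ n < c / 2 * exp (\<beta> * t)"
      using assms(1) by (simp add: power_mult_distrib)
    moreover have "\<bar>K\<bar> \<le> c / 2 * exp (\<beta> * t)"
      using elim(1) assms(2) by (simp add: field_simps)
    ultimately show ?case by linarith
  qed
qed

text \<open>The factor \<open>exp (- \<epsilon> * q s)\<close> with a cosine \<open>q\<close> decays
  doubly exponentially along the strip and so beats \<open>exp (norm s ^ n)\<close> for every
  \<open>n\<close>; its cost at \<open>s0\<close> disappears as \<epsilon> tends to 0.\<close>

lemma phragmen_lindelof_strip:
  fixes f :: "complex \<Rightarrow> complex"
  assumes hol: "f holomorphic_on {s. a \<le> Re s \<and> Re s \<le> b}" and "a < b" and "M > 0"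
    and bdry: "\<And>s. Re s = a \<or> Re s = b \<Longrightarrow> norm (f s) \<le> M"
    and growth: "\<And>s. a \<le> Re s \<Longrightarrow> Re s \<le> b \<Longrightarrow> R \<le> norm s \<Longrightarrow> norm (f s) \<le> C * exp (norm s ^ n)"
    and s0: "a \<le> Re s0" "Re s0 \<le> b"
  shows "norm (f s0) \<le> M"
proof -
  define c where "c = (a + b) / 2"
  \<comment> \<open>The factor 3/2 keeps \<open>\<beta> * (Re s - c)\<close> within pi/3 of 0, where
    the cosine is at least 1/2.\<close>
  define \<beta> where "\<beta> = pi / (3 / 2 * (b - a))"
  have \<beta>: "\<beta> > 0" using \<open>a < b\<close> by (simp add: \<beta>_def)
  define q where "q = (\<lambda>s::complex. cos (of_real \<beta> * (s - of_real c)))"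
  have Re_q: "Re (q s) \<ge> exp (\<beta> * \<bar>Im s\<bar>) / 4" if "a \<le> Re s" "Re s \<le> b" for s
  proof -
    have "\<bar>Re s - c\<bar> \<le> (b - a) / 2" unfolding c_def using that by (auto simp: abs_if field_simps)
    then have "\<beta> * \<bar>Re s - c\<bar> \<le> \<beta> * ((b - a) / 2)" using \<beta> by (intro mult_left_mono) auto
    also have "\<dots> = pi / 3" using \<open>a < b\<close> by (simp add: \<beta>_def field_simps)
    finally have "cos (pi / 3) \<le> cos (\<beta> * \<bar>Re s - c\<bar>)"
      using \<beta> by (intro cos_monotone_0_pi_le) auto
    also have "cos (\<beta> * \<bar>Re s - c\<bar>) = cos (\<beta> * (Re s - c))"
      by (metis cos_abs_real abs_mult abs_of_pos[OF \<beta>])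
    finally have "1 / 2 \<le> cos (\<beta> * (Re s - c))" by (simp add: cos_60)
    moreover have "exp (\<beta> * \<bar>Im s\<bar>) \<le> exp (\<beta> * Im s) + exp (- (\<beta> * Im s))"
      by (cases "Im s \<ge> 0") (auto simp: add_increasing add_increasing2)
    ultimately have "1 / 2 * exp (\<beta> * \<bar>Im s\<bar>)
        \<le> cos (\<beta> * (Re s - c)) * (exp (\<beta> * Im s) + exp (- (\<beta> * Im s)))"
      by (intro mult_mono) auto
    then show ?thesis by (simp add: q_def Re_cos)
  qed
  have main: "norm (f s0) \<le> M * exp (\<epsilon> * Re (q s0))" if "\<epsilon> > 0" for \<epsilon>
  proof -
    define g where "g = (\<lambda>s. f s * exp (- of_real \<epsilon> * q s))"
    have norm_g: "norm (g s) = norm (f s) * exp (- (\<epsilon> * Re (q s)))" for s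
      by (simp add: g_def norm_mult)
    define k where "k = \<bar>a\<bar> + \<bar>b\<bar>"
    \<comment> \<open>The logarithm is the level at which the damped majorant equals
      \<open>M\<close>; \<open>C\<close> may be nonpositive, hence
      \<open>\<bar>C\<bar> + 1\<close>.\<close>
    have "eventually (\<lambda>t. (k + t) ^ n - \<epsilon> / 4 * exp (\<beta> * t) \<le> ln (M / (\<bar>C\<bar> + 1))) at_top"
      using exp_dominates_shifted_power[OF \<beta>, of "\<epsilon> / 4"] that by auto
    then obtain T0 where T0: "\<And>t. t \<ge> T0 \<Longrightarrow> (k + t) ^ n - \<epsilon> / 4 * exp (\<beta> * t) \<le> ln (M / (\<bar>C\<bar> + 1))"
      by (auto simp: eventually_at_top_linorder)
    have "norm (g s0) \<le> M"
    proof (rule strip_max_modulus[of g a b M "max T0 R"])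
      show "g holomorphic_on {s. a \<le> Re s \<and> Re s \<le> b}"
        unfolding g_def q_def by (intro holomorphic_intros hol)
      show "norm (g s) \<le> M" if "Re s = a \<or> Re s = b" for s
      proof -
        have "0 \<le> Re (q s)"
          using Re_q[of s] that \<open>a < b\<close> by (smt (verit) exp_gt_zero divide_pos_pos)
        then have "exp (- (\<epsilon> * Re (q s))) \<le> 1" using \<open>\<epsilon> > 0\<close> by simp
        then show ?thesis unfolding norm_g
          using bdry[OF that] by (smt (verit) mult_left_le norm_ge_zero)
      qed
      show "norm (g s) \<le> M" if s: "a \<le> Re s" "Re s \<le> b" "max T0 R \<le> \<bar>Im s\<bar>" for s
      proof -
        have "R \<le> norm s" using s(3) abs_Im_le_cmod[of s] by simp
        then have "norm (f s) \<le> C * exp (norm s ^ n)" using growth s by blast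
        also have "\<dots> \<le> (\<bar>C\<bar> + 1) * exp ((k + \<bar>Im s\<bar>) ^ n)"
        proof (intro mult_mono)
          have "\<bar>Re s\<bar> \<le> k" using s by (auto simp: k_def)
          then have "norm s \<le> k + \<bar>Im s\<bar>" using cmod_le[of s] by simp
          then show "exp (norm s ^ n) \<le> exp ((k + \<bar>Im s\<bar>) ^ n)" by (simp add: power_mono)
        qed auto
        finally have "norm (g s) \<le> (\<bar>C\<bar> + 1) * exp ((k + \<bar>Im s\<bar>) ^ n) * exp (- (\<epsilon> * (exp (\<beta> * \<bar>Im s\<bar>) / 4)))"
          unfolding norm_g using Re_q[OF s(1,2)] \<open>\<epsilon> > 0\<close>
          by (intro mult_mono) auto
        also have "\<dots> = (\<bar>C\<bar> + 1) * exp ((k + \<bar>Im s\<bar>) ^ n - \<epsilon> / 4 * exp (\<beta> * \<bar>Im s\<bar>))"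
          by (simp add: mult_exp_exp)
        also have "\<dots> \<le> (\<bar>C\<bar> + 1) * exp (ln (M / (\<bar>C\<bar> + 1)))"
          using T0[of "\<bar>Im s\<bar>"] s(3) by (intro mult_left_mono) auto
        also have "\<dots> = M" using \<open>M > 0\<close> by simp
        finally show ?thesis .
      qed
    qed (use s0 in auto)
    then show ?thesis unfolding norm_g by (simp add: exp_minus field_simps)
  qed
  have "((\<lambda>\<epsilon>. M * exp (\<epsilon> * Re (q s0))) \<longlongrightarrow> M * exp (0 * Re (q s0))) (at_right 0)"
    by (intro tendsto_intros)
  then show ?thesis
    by (intro tendsto_lowerbound[where F = "at_right (0::real)" and f = "\<lambda>\<epsilon>. M * exp (\<epsilon> * Re (q s0))"])
       (auto simp: eventually_at_right_less intro!: eventually_mono[OF eventually_at_right_less[of 0]] main)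
qed

text \<open>
  Multiplying by \<open>T\<^bsup>\<kappa> s\<^esup>\<close> with \<open>T = 1 + |t\<^sub>0|\<close> makes the two boundary bounds comparable at height \<open>t\<^sub>0\<close>, and
  the Gaussian factor localises to that height.
\<close>

lemma vertical_growth_interpolation:
  fixes G :: "complex \<Rightarrow> complex" and m :: nat
  assumes hol: "G holomorphic_on UNIV" and "D \<ge> 0" and "\<epsilon> > 0" and "B > 1"
    and poly: "\<And>s. 0 \<le> Re s \<Longrightarrow> Re s \<le> B \<Longrightarrow> norm (G s) \<le> C * exp (D * \<bar>Im s\<bar>) * (1 + \<bar>Im s\<bar>) ^ m"
    and line: "\<And>\<eta>. \<eta> > 0 \<Longrightarrow> \<exists>C. \<forall>s. Re s = 1 + \<eta> \<longrightarrow> norm (G s) \<le> C * exp (D * \<bar>Im s\<bar>)"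
  shows "\<exists>\<eta>>0. \<exists>C. \<forall>s. 1 \<le> Re s \<and> Re s \<le> 1 + \<eta> \<longrightarrow>
           norm (G s) \<le> C * exp (D * \<bar>Im s\<bar>) * (1 + \<bar>Im s\<bar>) powr \<epsilon>"
proof -
  \<comment> \<open>The power of \<open>T\<close> lost at \<open>Re s = 1\<close> is
    \<open>\<kappa> * \<eta>\<close>, at most \<open>m * \<eta>\<close>, hence at most
    \<epsilon>.\<close>
  define \<eta> where "\<eta> = min (B - 1) (\<epsilon> / (1 + real m))"
  have \<eta>: "\<eta> > 0" "1 + \<eta> \<le> B" using assms by (auto simp: \<eta>_def)
  \<comment> \<open>With this slope the twist
    \<open>T powr (\<kappa> * (Re s - (1 + \<eta>)))\<close> is \<open>T powr (- m)\<close> on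
    \<open>Re s = 0\<close>, cancelling the polynomial growth there, and 1 on
    \<open>Re s = 1 + \<eta>\<close>.\<close>
  define \<kappa> where "\<kappa> = real m / (1 + \<eta>)"
  have \<kappa>: "\<kappa> \<ge> 0" "\<kappa> * (1 + \<eta>) = real m" using \<eta> by (auto simp: \<kappa>_def)
  have "\<eta> \<le> \<epsilon> / (1 + real m)" by (simp add: \<eta>_def)
  then have "real m * \<eta> \<le> real m * (\<epsilon> / (1 + real m))" by (intro mult_left_mono) auto
  also have "\<dots> \<le> \<epsilon>" using \<open>\<epsilon> > 0\<close> by (simp add: field_simps)
  finally have "real m * \<eta> \<le> \<epsilon>" .
  moreover have "\<kappa> * \<eta> \<le> real m * \<eta>" using \<eta> by (simp add: \<kappa>_def field_simps)
  ultimately have \<kappa>\<eta>: "\<kappa> * \<eta> \<le> \<epsilon>" by linarith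
  obtain C1 where C1: "\<And>s. Re s = 1 + \<eta> \<Longrightarrow> norm (G s) \<le> C1 * exp (D * \<bar>Im s\<bar>)"
    using line[OF \<eta>(1)] by blast
  define C2 where "C2 = \<bar>C\<bar> + \<bar>C1\<bar> + 1"
  \<comment> \<open>What the growth amounts to at distance \<open>u\<close> from the height
    \<open>t0\<close> once the Gaussian is included; it is bounded and tends to 0.\<close>
  define L where "L = (\<lambda>u::real. exp (D * u) * (1 + u) ^ m * exp (- (u ^ 2)))"
  have "(L \<longlongrightarrow> 0) at_top"
  proof -
    have lim1: "((\<lambda>u::real. (1 + u) ^ m / exp (1 + u)) \<longlongrightarrow> 0) at_top"
      using filterlim_compose[OF tendsto_power_div_exp_0[of m]
          filterlim_tendsto_add_at_top[OF tendsto_const[of "1::real"] filterlim_ident]] .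
    have "\<bar>L u\<bar> \<le> (1 + u) ^ m / exp (1 + u)" if "u \<ge> D + 2" for u
    proof -
      have "(D + 2) * u \<le> u * u" using that \<open>D \<ge> 0\<close> by (intro mult_right_mono) auto
      then have "D * u - u ^ 2 \<le> - (1 + u)"
        using that \<open>D \<ge> 0\<close> by (simp add: power2_eq_square algebra_simps)
      then have "exp (D * u - u ^ 2) * (1 + u) ^ m \<le> exp (- (1 + u)) * (1 + u) ^ m"
        using that \<open>D \<ge> 0\<close> by (intro mult_right_mono) auto
      moreover have "L u = exp (D * u - u ^ 2) * (1 + u) ^ m" "L u \<ge> 0"
        using that \<open>D \<ge> 0\<close> by (simp_all add: L_def exp_diff exp_minus field_simps)
      moreover have "exp (- (1 + u)) * (1 + u) ^ m = (1 + u) ^ m / exp (1 + u)"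
        by (simp only: exp_minus divide_inverse mult.commute)
      ultimately show ?thesis by linarith
    qed
    then show ?thesis
      by (intro Lim_null_comparison[OF _ lim1] eventually_mono[OF eventually_ge_at_top[of "D + 2"]])
         (auto simp: real_norm_def)
  qed
  then have "eventually (\<lambda>u. L u \<le> 1) at_top"
    using order_tendstoD(2)[of L 0 at_top 1] by (auto elim: eventually_mono)
  then obtain U where U: "\<And>u. u \<ge> U \<Longrightarrow> L u \<le> 1" by (auto simp: eventually_at_top_linorder)
  have "compact (L ` {0..max U 0})"
    unfolding L_def by (intro compact_continuous_image continuous_intros) auto
  then have "bounded (L ` {0..max U 0})" by (rule compact_imp_bounded)
  then obtain K0 where "\<forall>v\<in>L ` {0..max U 0}. norm v \<le> K0" unfolding bounded_iff by blast
  then have K0: "\<And>u. 0 \<le> u \<Longrightarrow> u \<le> max U 0 \<Longrightarrow> L u \<le> K0" by (auto simp: abs_le_iff)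
  define K where "K = \<bar>K0\<bar> + 1"
  have K: "L u \<le> K" if "u \<ge> 0" for u
    using K0[of u] U[of u] that by (cases "u \<ge> U") (auto simp: K_def)
  have main: "norm (G s0) \<le> (C2 * K * exp (B ^ 2)) * exp (D * \<bar>Im s0\<bar>) * (1 + \<bar>Im s0\<bar>) powr \<epsilon>"
    if s0: "1 \<le> Re s0" "Re s0 \<le> 1 + \<eta>" for s0
  proof -
    define t0 where "t0 = Im s0"
    define T where "T = 1 + \<bar>t0\<bar>"
    have T: "T \<ge> 1" by (simp add: T_def)
    define f where "f = (\<lambda>s. G s * exp (of_real (\<kappa> * ln T) * (s - of_real (1 + \<eta>))) * exp ((s - \<i> * of_real t0) ^ 2))"
    have norm_f: "norm (f s) = norm (G s) * T powr (\<kappa> * (Re s - (1 + \<eta>))) * exp ((Re s) ^ 2 - (Im s - t0) ^ 2)" for s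
      using T by (simp add: f_def norm_mult powr_def Re_power2 algebra_simps)
    \<comment> \<open>Separates the height \<open>t0\<close>: \<open>1 + \<bar>t\<bar>\<close> is at
      most \<open>(1 + \<bar>t0\<bar>) * (1 + \<bar>t - t0\<bar>)\<close>, and the exponential
      splits likewise.\<close>
    have LK: "exp (D * \<bar>t\<bar>) * (1 + \<bar>t\<bar>) ^ m * exp (- ((t - t0) ^ 2)) \<le> exp (D * \<bar>t0\<bar>) * T ^ m * L \<bar>t - t0\<bar>" for t
    proof -
      have "D * \<bar>t\<bar> \<le> D * (\<bar>t0\<bar> + \<bar>t - t0\<bar>)" using \<open>D \<ge> 0\<close> by (intro mult_left_mono) auto
      then have "exp (D * \<bar>t\<bar>) \<le> exp (D * \<bar>t0\<bar>) * exp (D * \<bar>t - t0\<bar>)"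
        by (simp add: mult_exp_exp distrib_left)
      moreover have "1 + \<bar>t\<bar> \<le> T * (1 + \<bar>t - t0\<bar>)"
        by (simp add: T_def algebra_simps) (smt (verit) mult_nonneg_nonneg abs_ge_zero)
      then have "(1 + \<bar>t\<bar>) ^ m \<le> T ^ m * (1 + \<bar>t - t0\<bar>) ^ m"
        by (metis power_mono power_mult_distrib abs_ge_zero add_increasing zero_le_one)
      ultimately have "exp (D * \<bar>t\<bar>) * (1 + \<bar>t\<bar>) ^ m * exp (- ((t - t0) ^ 2)) \<le>
          (exp (D * \<bar>t0\<bar>) * exp (D * \<bar>t - t0\<bar>)) * (T ^ m * (1 + \<bar>t - t0\<bar>) ^ m) * exp (- ((t - t0) ^ 2))"
        using T by (intro mult_mono mult_nonneg_nonneg) auto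
      then show ?thesis by (simp add: L_def mult_ac)
    qed
    have expB: "exp ((Re s) ^ 2 - (Im s - t0) ^ 2) \<le> exp (B ^ 2) * exp (- ((Im s - t0) ^ 2))"
      if "0 \<le> Re s" "Re s \<le> 1 + \<eta>" for s
      using that \<eta> by (simp add: mult_exp_exp power_mono)
    define M where "M = C2 * K * exp (B ^ 2) * exp (D * \<bar>t0\<bar>)"
    have C2: "C2 > 0" "C \<le> C2" "C1 \<le> C2" by (auto simp: C2_def)
    have K1: "K > 0" by (simp add: K_def)
    have M: "M > 0" using C2 K1 by (simp add: M_def)
    have inner: "norm (f s) \<le> C2 * exp (B ^ 2) * (exp (D * \<bar>t0\<bar>) * T ^ m * L \<bar>Im s - t0\<bar>) * T powr (\<kappa> * (Re s - (1 + \<eta>)))"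
      if s: "0 \<le> Re s" "Re s \<le> 1 + \<eta>" for s
    proof -
      have "norm (G s) \<le> C * exp (D * \<bar>Im s\<bar>) * (1 + \<bar>Im s\<bar>) ^ m" using s \<eta> by (intro poly) auto
      also have "\<dots> \<le> C2 * exp (D * \<bar>Im s\<bar>) * (1 + \<bar>Im s\<bar>) ^ m"
        using C2 by (intro mult_right_mono) auto
      finally have "norm (f s) \<le> (C2 * exp (D * \<bar>Im s\<bar>) * (1 + \<bar>Im s\<bar>) ^ m) * T powr (\<kappa> * (Re s - (1 + \<eta>))) * (exp (B ^ 2) * exp (- ((Im s - t0) ^ 2)))"
        unfolding norm_f using expB[OF s] C2 by (intro mult_mono mult_nonneg_nonneg) auto
      also have "\<dots> = C2 * exp (B ^ 2) * (exp (D * \<bar>Im s\<bar>) * (1 + \<bar>Im s\<bar>) ^ m * exp (- ((Im s - t0) ^ 2))) * T powr (\<kappa> * (Re s - (1 + \<eta>)))"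
        by (simp add: mult_ac)
      also have "\<dots> \<le> C2 * exp (B ^ 2) * (exp (D * \<bar>t0\<bar>) * T ^ m * L \<bar>Im s - t0\<bar>) * T powr (\<kappa> * (Re s - (1 + \<eta>)))"
        using C2 by (intro mult_left_mono mult_right_mono LK) auto
      finally show ?thesis .
    qed
    have "eventually (\<lambda>u. T ^ m * L u < K) at_top"
      using order_tendstoD(2)[OF tendsto_mult_right_zero[OF \<open>(L \<longlongrightarrow> 0) at_top\<close>, of "T ^ m"] K1] .
    then obtain V where V: "\<And>u. u \<ge> V \<Longrightarrow> T ^ m * L u \<le> K"
      by (auto simp: eventually_at_top_linorder intro: less_imp_le)
    have Tp: "T powr (\<kappa> * (x - (1 + \<eta>))) \<le> 1" if "x \<le> 1 + \<eta>" for x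
      using that T \<kappa> powr_mono[of "\<kappa> * (x - (1 + \<eta>))" 0 T] by (simp add: mult_nonneg_nonpos)
    have "norm (f s0) \<le> M"
    proof (rule strip_max_modulus[of f 0 "1 + \<eta>" M "V + \<bar>t0\<bar>"])
      show "f holomorphic_on {s. 0 \<le> Re s \<and> Re s \<le> 1 + \<eta>}"
        unfolding f_def by (intro holomorphic_intros holomorphic_on_subset[OF hol]) auto
      show "norm (f s) \<le> M" if "0 \<le> Re s" "Re s \<le> 1 + \<eta>" "V + \<bar>t0\<bar> \<le> \<bar>Im s\<bar>" for s
      proof -
        have "norm (f s) \<le> C2 * exp (B ^ 2) * (exp (D * \<bar>t0\<bar>) * (T ^ m * L \<bar>Im s - t0\<bar>)) * T powr (\<kappa> * (Re s - (1 + \<eta>)))"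
          using inner[OF that(1,2)] by (simp add: mult_ac)
        also have "\<dots> \<le> C2 * exp (B ^ 2) * (exp (D * \<bar>t0\<bar>) * K) * 1"
          using C2 K1 V[of "\<bar>Im s - t0\<bar>"] Tp[OF that(2)] that(3)
          by (intro mult_mono mult_nonneg_nonneg mult_left_mono) auto
        finally show ?thesis by (simp add: M_def mult_ac)
      qed
      show "norm (f s) \<le> M" if "Re s = 0 \<or> Re s = 1 + \<eta>" for s
        using that
      proof
        assume s: "Re s = 0"
        have "\<kappa> * (Re s - (1 + \<eta>)) = - real m" using \<kappa>(2) s by (simp add: algebra_simps)
        then have "T powr (\<kappa> * (Re s - (1 + \<eta>))) * T ^ m = T powr (- real m) * T powr real m"
          using T by (simp only: powr_realpow)
        also have "\<dots> = 1" using T by (simp flip: powr_add)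
        finally have Teq: "T powr (\<kappa> * (Re s - (1 + \<eta>))) * T ^ m = 1" .
        have "norm (f s) \<le> C2 * exp (B ^ 2) * (exp (D * \<bar>t0\<bar>) * T ^ m * L \<bar>Im s - t0\<bar>) * T powr (\<kappa> * (Re s - (1 + \<eta>)))"
          using inner[of s] s \<eta> by simp
        also have "\<dots> = C2 * exp (B ^ 2) * (exp (D * \<bar>t0\<bar>) * L \<bar>Im s - t0\<bar>) * (T powr (\<kappa> * (Re s - (1 + \<eta>))) * T ^ m)"
          by (simp add: mult_ac)
        also have "\<dots> \<le> C2 * exp (B ^ 2) * (exp (D * \<bar>t0\<bar>) * K)"
          unfolding Teq using C2 K[of "\<bar>Im s - t0\<bar>"] by simp
        finally show ?thesis by (simp add: M_def mult_ac)
      next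
        assume s: "Re s = 1 + \<eta>"
        have "D * \<bar>Im s\<bar> \<le> D * (\<bar>t0\<bar> + \<bar>Im s - t0\<bar>)" using \<open>D \<ge> 0\<close> by (intro mult_left_mono) auto
        then have e1: "exp (D * \<bar>Im s\<bar>) \<le> exp (D * \<bar>t0\<bar>) * exp (D * \<bar>Im s - t0\<bar>)"
          by (simp add: mult_exp_exp distrib_left)
        have "norm (G s) \<le> C1 * exp (D * \<bar>Im s\<bar>)" using C1[OF s] .
        also have "\<dots> \<le> C2 * (exp (D * \<bar>t0\<bar>) * exp (D * \<bar>Im s - t0\<bar>))"
          using C2 e1 by (intro mult_mono) auto
        finally have "norm (f s) \<le> (C2 * (exp (D * \<bar>t0\<bar>) * exp (D * \<bar>Im s - t0\<bar>))) * 1 * (exp (B ^ 2) * exp (- ((Im s - t0) ^ 2)))"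
          unfolding norm_f using expB[of s] s Tp[of "Re s"] \<eta> C2
          by (intro mult_mono mult_nonneg_nonneg) auto
        also have "\<dots> = C2 * exp (B ^ 2) * exp (D * \<bar>t0\<bar>) * (exp (D * \<bar>Im s - t0\<bar>) * 1 * exp (- ((Im s - t0) ^ 2)))"
          by (simp add: mult_ac)
        also have "\<dots> \<le> C2 * exp (B ^ 2) * exp (D * \<bar>t0\<bar>) * L \<bar>Im s - t0\<bar>"
          using C2 unfolding L_def by (intro mult_left_mono mult_mono) auto
        also have "\<dots> \<le> C2 * exp (B ^ 2) * exp (D * \<bar>t0\<bar>) * K"
          using C2 K by (intro mult_left_mono) auto
        finally show ?thesis by (simp add: M_def mult_ac)
      qed
    qed (use s0 in auto)
    moreover have "norm (f s0) \<ge> norm (G s0) * T powr (\<kappa> * (Re s0 - (1 + \<eta>))) * 1"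
      unfolding norm_f by (intro mult_left_mono) (auto simp: t0_def)
    ultimately have "norm (G s0) * T powr (\<kappa> * (Re s0 - (1 + \<eta>))) \<le> M" by linarith
    then have "norm (G s0) * (T powr (\<kappa> * (Re s0 - (1 + \<eta>))) * T powr (\<kappa> * (1 + \<eta> - Re s0))) \<le> M * T powr (\<kappa> * (1 + \<eta> - Re s0))"
      by (simp only: mult.assoc[symmetric]) (intro mult_right_mono, auto)
    moreover have "T powr (\<kappa> * (Re s0 - (1 + \<eta>))) * T powr (\<kappa> * (1 + \<eta> - Re s0)) = 1"
      using T by (simp flip: powr_add) (simp add: algebra_simps)
    ultimately have "norm (G s0) \<le> M * T powr (\<kappa> * (1 + \<eta> - Re s0))" by simp
    also have "\<dots> \<le> M * T powr \<epsilon>"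
    proof (intro mult_left_mono powr_mono)
      have "\<kappa> * (1 + \<eta> - Re s0) \<le> \<kappa> * \<eta>" using s0 \<kappa> by (intro mult_left_mono) auto
      then show "\<kappa> * (1 + \<eta> - Re s0) \<le> \<epsilon>" using \<kappa>\<eta> by linarith
    qed (use T M in auto)
    finally show ?thesis by (simp add: M_def T_def t0_def)
  qed
  then show ?thesis using \<eta>(1) by blast
qed

subsection \<open>Ratios of Gamma values on vertical lines\<close>

text \<open>By Gauss's product, \<open>norm (Gamma (x + i y)) / Gamma x\<close> is a limit of
  products of \<open>(x + k) / norm (x + i y + k)\<close>, and each such factor increases with
  \<open>x\<close>.\<close>

lemma norm_Gamma_mono_on_vertical:
  assumes "0 < x" "x \<le> x'"
  shows "norm (Gamma (Complex x y)) * Gamma x' \<le> norm (Gamma (Complex x' y)) * Gamma x"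
proof -
  have fac: "(x + k) * norm (Complex x' y + of_nat k) \<le> (x' + k) * norm (Complex x y + of_nat k)" for k :: nat
  proof -
    have "(x + k) ^ 2 * y ^ 2 \<le> (x' + k) ^ 2 * y ^ 2"
      using assms by (intro mult_right_mono power_mono) auto
    then have "((x + k) * sqrt ((x' + k) ^ 2 + y ^ 2)) ^ 2 \<le> ((x' + k) * sqrt ((x + k) ^ 2 + y ^ 2)) ^ 2"
      by (simp add: power_mult_distrib distrib_left mult.commute)
    then have "(x + k) * sqrt ((x' + k) ^ 2 + y ^ 2) \<le> (x' + k) * sqrt ((x + k) ^ 2 + y ^ 2)"
      by (rule power2_le_imp_le) (use assms in auto)
    then show ?thesis by (simp add: cmod_def)
  qed
  have ser: "norm (Gamma_series (Complex x y) n) * Gamma_series x' n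
      \<le> norm (Gamma_series (Complex x' y) n) * Gamma_series x n" for n
  proof -
    have nz: "norm (Complex u y + of_nat k) > 0" if "u > 0" for u k
      using that by (auto simp: complex_eq_iff)
    define P where "P = (\<lambda>u::real. \<Prod>k<Suc n. norm (Complex u y + of_nat k))"
    define R where "R = (\<lambda>u::real. \<Prod>k<Suc n. u + of_nat k)"
    have pos: "P x > 0" "P x' > 0" "R x > 0" "R x' > 0"
      unfolding P_def R_def using assms by (auto intro!: prod_pos nz add_pos_nonneg simp del: prod.lessThan_Suc)
    have "R x * P x' \<le> R x' * P x"
      unfolding P_def R_def prod.distrib[symmetric] using fac assms by (intro prod_mono) auto
    then have "1 / (P x * R x') \<le> 1 / (P x' * R x)"
      using pos by (simp add: field_simps)
    moreover have "norm (Gamma_series (Complex u y) n) = fact n * exp (u * ln n) / P u" for u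
      by (simp add: Gamma_series_def P_def pochhammer_prod norm_divide norm_mult prod_norm
          atLeast0LessThan lessThan_Suc_atMost atLeast0AtMost)
    moreover have "Gamma_series u n = fact n * exp (u * ln n) / R u" for u
      by (simp add: Gamma_series_def R_def pochhammer_prod atLeast0LessThan
          lessThan_Suc_atMost atLeast0AtMost)
    ultimately show ?thesis
      using mult_left_mono[of "1 / (P x * R x')" "1 / (P x' * R x)" "fact n * exp (x * ln n) * (fact n * exp (x' * ln n))"]
      by (simp add: mult_ac)
  qed
  have lim: "(\<lambda>n. norm (Gamma_series (Complex u y) n) * Gamma_series v n) \<longlonglongrightarrow> norm (Gamma (Complex u y)) * Gamma v" for u v
    by (intro tendsto_intros)
  show ?thesis
    using LIMSEQ_le[OF lim[of x x'] lim[of x' x]] ser by blast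
qed

text \<open>An elementary substitute for Stirling's formula: the recurrence moves both arguments to
  the right until \<open>0 < x + m \<le> x' + n\<close>, where monotonicity applies. For
  \<open>\<bar>y\<bar> \<ge> 1\<close> the Pochhammer factor of \<open>x\<close> has norm at least 1
  and that of \<open>x'\<close> is polynomial in \<open>y\<close>.\<close>

lemma norm_Gamma_ratio_poly:
  fixes x x' :: real
  shows "\<exists>C n. \<forall>y. \<bar>y\<bar> \<ge> 1 \<longrightarrow>
    norm (Gamma (Complex x y)) \<le> C * (1 + \<bar>y\<bar>) ^ n * norm (Gamma (Complex x' y))"
proof -
  define m where "m = nat \<lceil>\<bar>x\<bar>\<rceil> + 1"
  have m: "x + m > 0" unfolding m_def by linarith
  define n where "n = nat \<lceil>\<bar>x + m - x'\<bar>\<rceil>"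
  have n: "x + m \<le> x' + n" unfolding n_def by linarith
  define c where "c = Gamma (x + m) / Gamma (x' + n)"
  have c: "c > 0" using m n by (simp add: c_def Gamma_real_pos)
  have nonpole: "Complex u y \<notin> \<int>\<^sub>\<le>\<^sub>0" if "\<bar>y\<bar> \<ge> 1" for u y
    using that by (auto elim!: nonpos_Ints_cases simp: complex_eq_iff)
  have shift: "Gamma (Complex (u + k) y) = pochhammer (Complex u y) k * Gamma (Complex u y)"
    if "\<bar>y\<bar> \<ge> 1" for u y :: real and k :: nat
  proof -
    have "Complex (u + k) y = Complex u y + of_nat k" by (simp add: complex_eq_iff)
    then show ?thesis
      using pochhammer_Gamma[OF nonpole[OF that, of u], of k] Gamma_eq_zero_iff[of "Complex u y"] nonpole[OF that]
      by (simp add: field_simps)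
  qed
  have "norm (Gamma (Complex x y)) \<le> (c * (1 + \<bar>x'\<bar> + n) ^ n) * (1 + \<bar>y\<bar>) ^ n * norm (Gamma (Complex x' y))"
    if y: "\<bar>y\<bar> \<ge> 1" for y
  proof -
    have "1 \<le> norm (pochhammer (Complex x y) m)"
    proof -
      have "1 \<le> norm (Complex x y + of_nat k)" for k
        using y abs_Im_le_cmod[of "Complex x y + of_nat k"] by simp
      then show ?thesis by (simp add: pochhammer_prod prod_norm[symmetric] prod_ge_1)
    qed
    then have "norm (Gamma (Complex x y)) * 1 \<le> norm (Gamma (Complex x y)) * norm (pochhammer (Complex x y) m)"
      by (intro mult_left_mono) auto
    also have "\<dots> = norm (Gamma (Complex (x + m) y))"
      by (simp add: shift[OF y] norm_mult)
    also have "\<dots> \<le> c * norm (Gamma (Complex (x' + n) y))"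
      using norm_Gamma_mono_on_vertical[OF m n, of y] m n
      by (simp add: c_def field_simps Gamma_real_pos)
    also have "\<dots> = c * norm (pochhammer (Complex x' y) n) * norm (Gamma (Complex x' y))"
      by (simp add: shift[OF y] norm_mult)
    also have "norm (pochhammer (Complex x' y) n) \<le> ((1 + \<bar>x'\<bar> + n) * (1 + \<bar>y\<bar>)) ^ n"
    proof -
      have "norm (Complex x' y + of_nat k) \<le> (1 + \<bar>x'\<bar> + n) * (1 + \<bar>y\<bar>)" if "k < n" for k
      proof -
        have "norm (Complex x' y + of_nat k) \<le> \<bar>x'\<bar> + real k + \<bar>y\<bar>"
          using cmod_le[of "Complex x' y + of_nat k"] by simp
        also have "\<dots> \<le> (1 + \<bar>x'\<bar> + n) * (1 + \<bar>y\<bar>)"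
        proof -
          have "(1 + \<bar>x'\<bar> + n) * (1 + \<bar>y\<bar>) = 1 + \<bar>x'\<bar> + n + \<bar>y\<bar> + (\<bar>x'\<bar> + n) * \<bar>y\<bar>"
            by (simp add: algebra_simps)
          moreover have "0 \<le> (\<bar>x'\<bar> + n) * \<bar>y\<bar>" by simp
          ultimately show ?thesis using that by linarith
        qed
        finally show ?thesis .
      qed
      then have "(\<Prod>k<n. norm (Complex x' y + of_nat k)) \<le> (\<Prod>k<n. (1 + \<bar>x'\<bar> + n) * (1 + \<bar>y\<bar>))"
        by (intro prod_mono) auto
      then show ?thesis by (simp add: pochhammer_prod prod_norm[symmetric] atLeast0LessThan)
    qed
    finally show ?thesis using c by (simp add: power_mult_distrib mult_ac mult_left_mono mult_right_mono)
  qed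
  then show ?thesis by blast
qed

subsection \<open>Polynomially bounded functions\<close>

definition poly_bounded_on :: "complex set \<Rightarrow> (complex \<Rightarrow> complex) \<Rightarrow> bool" where
  "poly_bounded_on X f \<longleftrightarrow> (\<exists>C n. \<forall>s\<in>X. norm (f s) \<le> C * (1 + norm s) ^ n)"

lemma poly_bounded_onD:
  assumes "poly_bounded_on X f"
  shows "\<exists>C>0. \<exists>n. \<forall>s\<in>X. norm (f s) \<le> C * (1 + norm s) ^ n"
proof -
  obtain C n where *: "\<forall>s\<in>X. norm (f s) \<le> C * (1 + norm s) ^ n"
    using assms by (auto simp: poly_bounded_on_def)
  have "norm (f s) \<le> (\<bar>C\<bar> + 1) * (1 + norm s) ^ n" if "s \<in> X" for s
  proof -
    have "norm (f s) \<le> C * (1 + norm s) ^ n" using * that by blast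
    also have "\<dots> \<le> (\<bar>C\<bar> + 1) * (1 + norm s) ^ n" by (intro mult_right_mono) auto
    finally show ?thesis .
  qed
  then show ?thesis by (intro exI[of _ "\<bar>C\<bar> + 1"]) auto
qed

lemma poly_bounded_on_subset: "poly_bounded_on X f \<Longrightarrow> Y \<subseteq> X \<Longrightarrow> poly_bounded_on Y f"
  unfolding poly_bounded_on_def by blast

lemma poly_bounded_on_bounded: "(\<And>s. s \<in> X \<Longrightarrow> norm (f s) \<le> C) \<Longrightarrow> poly_bounded_on X f"
  unfolding poly_bounded_on_def by (rule exI[of _ C], rule exI[of _ 0]) simp

lemma poly_bounded_on_mult:
  assumes "poly_bounded_on X f" "poly_bounded_on X g"
  shows "poly_bounded_on X (\<lambda>s. f s * g s)"
proof -
  obtain C n where f: "C > 0" "\<And>s. s \<in> X \<Longrightarrow> norm (f s) \<le> C * (1 + norm s) ^ n"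
    using poly_bounded_onD[OF assms(1)] by blast
  obtain D m where g: "D > 0" "\<And>s. s \<in> X \<Longrightarrow> norm (g s) \<le> D * (1 + norm s) ^ m"
    using poly_bounded_onD[OF assms(2)] by blast
  have "norm (f s * g s) \<le> (C * D) * (1 + norm s) ^ (n + m)" if "s \<in> X" for s
  proof -
    have "norm (f s) * norm (g s) \<le> (C * (1 + norm s) ^ n) * (D * (1 + norm s) ^ m)"
      using f g that by (intro mult_mono mult_nonneg_nonneg) auto
    then show ?thesis by (simp add: norm_mult power_add mult_ac)
  qed
  then show ?thesis unfolding poly_bounded_on_def by blast
qed

lemma poly_bounded_on_power: "poly_bounded_on X f \<Longrightarrow> poly_bounded_on X (\<lambda>s. f s ^ k)"
  by (induction k) (auto intro: poly_bounded_on_mult poly_bounded_on_bounded[of _ _ 1])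

lemma poly_bounded_on_prod:
  "(\<And>j. j \<in> J \<Longrightarrow> poly_bounded_on X (f j)) \<Longrightarrow> poly_bounded_on X (\<lambda>s. \<Prod>j\<in>J. f j s)"
  by (induction J rule: infinite_finite_induct)
     (auto intro: poly_bounded_on_mult poly_bounded_on_bounded[of _ _ 1])

lemma poly_bounded_on_linear: "poly_bounded_on X (\<lambda>s. a * s + b)"
  unfolding poly_bounded_on_def
proof (intro exI ballI)
  fix s assume "s \<in> X"
  have "norm (a * s + b) \<le> norm a * norm s + norm b" by (metis norm_mult norm_triangle_ineq)
  also have "\<dots> \<le> (norm a + norm b) * (1 + norm s)" by (simp add: algebra_simps)
  finally show "norm (a * s + b) \<le> (norm a + norm b) * (1 + norm s) ^ 1" by simp
qed

lemma poly_bounded_on_Un: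
  assumes "poly_bounded_on X f" "poly_bounded_on Y f"
  shows "poly_bounded_on (X \<union> Y) f"
proof -
  obtain C n where f: "C > 0" "\<And>s. s \<in> X \<Longrightarrow> norm (f s) \<le> C * (1 + norm s) ^ n"
    using poly_bounded_onD[OF assms(1)] by blast
  obtain D m where g: "D > 0" "\<And>s. s \<in> Y \<Longrightarrow> norm (f s) \<le> D * (1 + norm s) ^ m"
    using poly_bounded_onD[OF assms(2)] by blast
  have "C * (1 + norm s) ^ n \<le> (C + D) * (1 + norm s) ^ (n + m)"
       "D * (1 + norm s) ^ m \<le> (C + D) * (1 + norm s) ^ (n + m)" for s :: complex
    using f g by (auto intro!: mult_mono power_increasing)
  then have "norm (f s) \<le> (C + D) * (1 + norm s) ^ (n + m)" if "s \<in> X \<union> Y" for s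
    using f(2) g(2) that by (metis Un_iff order_trans)
  then show ?thesis unfolding poly_bounded_on_def by blast
qed

lemma poly_bounded_on_le:
  assumes "poly_bounded_on X g" "\<And>s. s \<in> X \<Longrightarrow> norm (f s) \<le> norm (g s)"
  shows "poly_bounded_on X f"
  using assms unfolding poly_bounded_on_def by (meson order_trans)

lemma norm_of_nat_powr: "n \<ge> 1 \<Longrightarrow> norm (of_nat n powr s :: complex) = real n powr Re s"
  by (subst norm_powr_real_powr) auto

text \<open>Dividing by \<open>u s ^ n\<close>, which has no zeros in the strip and is comparable to
  \<open>(1 + norm s) ^ n\<close>, makes the edge bounds constant, so that Phragmen-Lindeloef
  applies.\<close>

lemma finite_order_poly_bounded_on_strip:
  assumes hol: "E holomorphic_on UNIV" and fin: "finite_order E" and "A \<ge> (1::real)"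
    and bd: "poly_bounded_on {s. Re s = -A \<or> Re s = 1 + A} E"
  shows "poly_bounded_on {s. -A \<le> Re s \<and> Re s \<le> 1 + A} E"
proof -
  obtain C n where C: "C > 0" "\<And>s. Re s = -A \<or> Re s = 1 + A \<Longrightarrow> norm (E s) \<le> C * (1 + norm s) ^ n"
    using poly_bounded_onD[OF bd] by blast
  obtain \<rho> D R where fo: "\<And>z. norm z \<ge> R \<Longrightarrow> norm (E z) \<le> D * exp (norm z powr \<rho>)"
    using fin unfolding finite_order_def by blast
  define k where "k = nat \<lceil>\<bar>\<rho>\<bar>\<rceil>"
  \<comment> \<open>The shift by \<open>A + 1\<close> puts the strip into
    \<open>Re (u s) \<ge> 1\<close>, so dividing by a power of \<open>u s\<close> never enlarges a
    norm.\<close>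
  define u where "u = (\<lambda>s::complex. s + of_real (A + 1))"
  have u1: "norm (u s) \<ge> 1" if "-A \<le> Re s" for s
    using that complex_Re_le_cmod[of "u s"] by (simp add: u_def)
  have unz: "u s \<noteq> 0" if "-A \<le> Re s" for s using u1[OF that] by auto
  have holu: "u holomorphic_on X" for X unfolding u_def by (intro holomorphic_intros)
  have us: "1 + norm s \<le> (A + 3) * norm (u s)" if "-A \<le> Re s" for s
  proof -
    have "norm s \<le> norm (u s) + (A + 1)"
      using norm_triangle_ineq4[of "u s" "of_real (A + 1)"] \<open>A \<ge> 1\<close> by (simp add: u_def del: of_real_add)
    moreover have "(A + 2) * 1 \<le> (A + 2) * norm (u s)"
      using u1[OF that] \<open>A \<ge> 1\<close> by (intro mult_left_mono) auto
    ultimately show ?thesis by (simp add: algebra_simps)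
  qed
  have su: "norm (u s) \<le> (A + 2) * (1 + norm s)" for s
  proof -
    have "norm (u s) \<le> norm s + (A + 1)"
      using norm_triangle_ineq[of s "of_real (A + 1)"] \<open>A \<ge> 1\<close> by (simp add: u_def del: of_real_add)
    moreover have "0 \<le> A * norm s" using \<open>A \<ge> 1\<close> by simp
    moreover have "(A + 2) * (1 + norm s) = A + 2 + A * norm s + 2 * norm s" by (simp add: algebra_simps)
    ultimately show ?thesis using norm_ge_zero[of s] by linarith
  qed
  define f where "f = (\<lambda>s. E s / u s ^ n)"
  define M where "M = C * (A + 3) ^ n"
  have M: "M > 0" using C \<open>A \<ge> 1\<close> by (simp add: M_def)
  have fM: "norm (f s) \<le> M" if s: "-A \<le> Re s" "Re s \<le> 1 + A" for s
  proof (rule phragmen_lindelof_strip[of f "-A" "1 + A" M "max R 1" "\<bar>D\<bar>" k])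
    show "f holomorphic_on {s. -A \<le> Re s \<and> Re s \<le> 1 + A}"
      unfolding f_def
      by (intro holomorphic_intros holu holomorphic_on_subset[OF hol]) (auto simp: unz)
    show "norm (f s) \<le> M" if "Re s = -A \<or> Re s = 1 + A" for s
    proof -
      have r: "-A \<le> Re s" using that \<open>A \<ge> 1\<close> by auto
      have "norm (E s) \<le> C * (1 + norm s) ^ n" using C that by blast
      also have "\<dots> \<le> C * ((A + 3) * norm (u s)) ^ n"
        using us[OF r] C by (intro mult_left_mono power_mono) auto
      also have "\<dots> = M * norm (u s) ^ n" by (simp add: M_def power_mult_distrib)
      finally show ?thesis
        using unz[OF r] by (simp add: f_def norm_divide norm_power pos_divide_le_eq)
    qed
    show "norm (f s) \<le> \<bar>D\<bar> * exp (norm s ^ k)" if "-A \<le> Re s" "Re s \<le> 1 + A" "max R 1 \<le> norm s" for s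
    proof -
      have "norm (f s) \<le> norm (E s)"
        using divide_left_mono[OF one_le_power[OF u1[OF that(1)], of n], of "norm (E s)"] unz[OF that(1)]
        by (simp add: f_def norm_divide norm_power)
      also have "\<dots> \<le> D * exp (norm s powr \<rho>)" using fo that by simp
      also have "\<dots> \<le> \<bar>D\<bar> * exp (norm s ^ k)"
      proof -
        have "norm s powr \<rho> \<le> norm s powr (real k)"
          using that(3) by (intro powr_mono) (auto simp: k_def, linarith)
        also have "\<dots> = norm s ^ k" using that(3) by (intro powr_realpow) auto
        finally show ?thesis by (intro mult_mono) auto
      qed
      finally show ?thesis .
    qed
  qed (use s M \<open>A \<ge> 1\<close> in auto)
  have "norm (E s) \<le> (M * (A + 2) ^ n) * (1 + norm s) ^ n" if s: "-A \<le> Re s" "Re s \<le> 1 + A" for s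
  proof -
    have "norm (E s) \<le> M * norm (u s) ^ n"
      using fM[OF s] unz[OF s(1)] by (simp add: f_def norm_divide norm_power pos_divide_le_eq)
    also have "\<dots> \<le> M * ((A + 2) * (1 + norm s)) ^ n"
      using M su by (intro mult_left_mono power_mono) auto
    finally show ?thesis by (simp add: power_mult_distrib mult_ac)
  qed
  then show ?thesis unfolding poly_bounded_on_def by blast
qed

subsection \<open>Growth of functions in the extended Selberg class\<close>

lemma extended_selbergD:
  assumes "extended_selberg F a \<omega> Q r lam mu"
  shows "\<And>s. Re s > 1 \<Longrightarrow> (\<lambda>n. norm (a n / of_nat n powr s)) summable_on {1..}"
    and "\<And>s. Re s > 1 \<Longrightarrow> ((\<lambda>n. a n / of_nat n powr s) has_sum F s) {1..}"
    and "\<exists>s. Re s > 1 \<and> F s \<noteq> 0"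
    and "\<exists>(m::nat) E. E holomorphic_on UNIV \<and> finite_order E \<and> (\<forall>s. s \<noteq> 1 \<longrightarrow> E s = (s - 1) ^ m * F s)"
    and "norm \<omega> = 1" "Q > 0"
    and "\<And>j. j \<in> {1..r} \<Longrightarrow> lam j > 0" "\<And>j. j \<in> {1..r} \<Longrightarrow> Re (mu j) \<ge> 0"
    and "\<And>s. s \<noteq> 0 \<Longrightarrow> s \<noteq> 1 \<Longrightarrow> gamma_factor_regular r lam mu s \<Longrightarrow>
          gamma_factor_regular r lam mu (cnj (1 - s)) \<Longrightarrow>
        F s * gamma_factor Q r lam mu s =
          \<omega> * cnj (gamma_factor Q r lam mu (cnj (1 - s))) * cnj (F (cnj (1 - s)))"
  using assms unfolding extended_selberg_def conj_fun_def by auto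

lemma extended_selberg_bounded_half_plane:
  assumes "extended_selberg F a \<omega> Q r lam mu"
  shows "\<exists>K. \<forall>s. Re s \<ge> 2 \<longrightarrow> norm (F s) \<le> K"
proof -
  note sel = extended_selbergD[OF assms]
  have "norm (F s) \<le> (\<Sum>\<^sub>\<infinity>n\<in>{1..}. norm (a n / of_nat n powr 2))" if s: "Re s \<ge> 2" for s
  proof -
    have "norm (F s) = norm (\<Sum>\<^sub>\<infinity>n\<in>{1..}. a n / of_nat n powr s)"
      using sel(2)[of s] s by (simp add: infsumI)
    also have "\<dots> \<le> (\<Sum>\<^sub>\<infinity>n\<in>{1..}. norm (a n / of_nat n powr s))"
      using sel(1)[of s] s by (intro norm_infsum_bound) auto
    also have "\<dots> \<le> (\<Sum>\<^sub>\<infinity>n\<in>{1..}. norm (a n / of_nat n powr 2))"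
    proof (rule infsum_mono)
      show "norm (a n / of_nat n powr s) \<le> norm (a n / of_nat n powr 2)" if "n \<in> {1..}" for n
      proof -
        have "norm (a n) / real n powr Re s \<le> norm (a n) / real n powr Re 2"
          using that s by (intro divide_left_mono powr_mono) auto
        then show ?thesis using that unfolding norm_divide by (subst (1 2) norm_of_nat_powr) auto
      qed
    qed (use sel(1)[of s] sel(1)[of 2] s in auto)
    finally show ?thesis .
  qed
  then show ?thesis by blast
qed

text \<open>Since \<open>s \<mapsto> cnj (1 - s)\<close> preserves the imaginary part, the
  functional equation compares Gamma values at equal heights, whose ratios are polynomial. On the
  reflected line \<open>F\<close> is bounded because \<open>1 + A \<ge> 2\<close>.\<close>

lemma extended_selberg_poly_bounded_left_line:
  assumes ext: "extended_selberg F a \<omega> Q r lam mu" and "A \<ge> (1::real)"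
  shows "\<exists>T. poly_bounded_on {s. Re s = -A \<and> \<bar>Im s\<bar> \<ge> T} F"
proof -
  note sel = extended_selbergD[OF ext]
  obtain K0 where K0: "\<And>s. Re s \<ge> 2 \<Longrightarrow> norm (F s) \<le> K0"
    using extended_selberg_bounded_half_plane[OF ext] by blast
  define x where "x = (\<lambda>j. lam j * (1 + A) + Re (mu j))"
  define x' where "x' = (\<lambda>j. lam j * (- A) + Re (mu j))"
  obtain C n where Cn: "\<And>j y. \<bar>y\<bar> \<ge> 1 \<Longrightarrow>
      norm (Gamma (Complex (x j) y)) \<le> C j * (1 + \<bar>y\<bar>) ^ n j * norm (Gamma (Complex (x' j) y))"
    using norm_Gamma_ratio_poly[of "x j" "x' j" for j] by metis
  \<comment> \<open>Large enough for every Gamma argument at height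
    \<open>\<bar>t\<bar> \<ge> T\<close> to have imaginary part of modulus at least 1, hence away
    from the poles and in the range of \<open>norm_Gamma_ratio_poly\<close>.\<close>
  define T where "T = (\<Sum>j=1..r. (1 + \<bar>Im (mu j)\<bar>) / lam j) + 1"
  have Tpos: "T \<ge> 1" using sel(7) by (auto simp: T_def intro!: sum_nonneg divide_nonneg_pos)
  have yj: "\<bar>lam j * t + Im (mu j)\<bar> \<ge> 1" if "j \<in> {1..r}" "\<bar>t\<bar> \<ge> T" for j t
  proof -
    have "(1 + \<bar>Im (mu j)\<bar>) / lam j \<le> (\<Sum>j=1..r. (1 + \<bar>Im (mu j)\<bar>) / lam j)"
      using that(1) sel(7) by (intro member_le_sum) (auto intro!: divide_nonneg_pos)
    then have "(1 + \<bar>Im (mu j)\<bar>) / lam j \<le> \<bar>t\<bar>" using that(2) by (simp add: T_def)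
    then have "1 + \<bar>Im (mu j)\<bar> \<le> lam j * \<bar>t\<bar>" using sel(7)[OF that(1)] by (simp add: field_simps)
    also have "\<dots> = \<bar>lam j * t\<bar>" using sel(7)[OF that(1)] by (simp add: abs_mult)
    finally show ?thesis by linarith
  qed
  define G where "G = (\<lambda>s. of_real (Q powr (1 + 2 * A) * K0) *
     (\<Prod>j=1..r. of_real (C j * (1 + \<bar>lam j * Im s + Im (mu j)\<bar>) ^ n j)) :: complex)"
  define X where "X = {s. Re s = -A \<and> \<bar>Im s\<bar> \<ge> T}"
  have "poly_bounded_on X G"
    unfolding G_def
  proof (intro poly_bounded_on_mult poly_bounded_on_prod)
    show "poly_bounded_on X (\<lambda>s. of_real (Q powr (1 + 2 * A) * K0))"
      by (rule poly_bounded_on_bounded) (rule order_refl)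
    fix j assume j: "j \<in> {1..r}"
    have "poly_bounded_on X (\<lambda>s. of_real (1 + \<bar>lam j * Im s + Im (mu j)\<bar>))"
      unfolding poly_bounded_on_def
    proof (intro exI ballI)
      fix s
      have "\<bar>lam j * Im s + Im (mu j)\<bar> \<le> lam j * \<bar>Im s\<bar> + \<bar>Im (mu j)\<bar>"
        using sel(7)[OF j] by (metis abs_mult abs_of_pos abs_triangle_ineq)
      also have "\<dots> \<le> lam j * norm s + \<bar>Im (mu j)\<bar>"
        using sel(7)[OF j] abs_Im_le_cmod[of s] by simp
      finally have "1 + \<bar>lam j * Im s + Im (mu j)\<bar> \<le> (1 + lam j + \<bar>Im (mu j)\<bar>) * (1 + norm s) ^ 1"
        using sel(7)[OF j] by (simp add: algebra_simps) (smt (verit) mult_nonneg_nonneg norm_ge_zero abs_ge_zero)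
      then show "norm (of_real (1 + \<bar>lam j * Im s + Im (mu j)\<bar>) :: complex) \<le> (1 + lam j + \<bar>Im (mu j)\<bar>) * (1 + norm s) ^ 1"
        by (metis abs_ge_zero abs_of_nonneg add_increasing norm_of_real zero_le_one)
    qed
    then have "poly_bounded_on X (\<lambda>s. of_real (C j) * of_real (1 + \<bar>lam j * Im s + Im (mu j)\<bar>) ^ n j)"
      by (intro poly_bounded_on_mult[OF poly_bounded_on_bounded[of _ _ "\<bar>C j\<bar>"]] poly_bounded_on_power) auto
    then show "poly_bounded_on X (\<lambda>s. of_real (C j * (1 + \<bar>lam j * Im s + Im (mu j)\<bar>) ^ n j))"
      by simp
  qed
  moreover have "norm (F s) \<le> norm (G s)" if "s \<in> X" for s
  proof -
    have s: "Re s = -A" "\<bar>Im s\<bar> \<ge> T" using that by (auto simp: X_def)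
    define s' where "s' = cnj (1 - s)"
    have s': "Re s' = 1 + A" "Im s' = Im s" using s by (simp_all add: s'_def)
    define y where "y = (\<lambda>j. lam j * Im s + Im (mu j))"
    have arg: "of_real (lam j) * s + mu j = Complex (x' j) (y j)"
              "of_real (lam j) * s' + mu j = Complex (x j) (y j)" for j
      using s s' by (simp_all add: complex_eq_iff x_def x'_def y_def)
    have y1: "\<bar>y j\<bar> \<ge> 1" if "j \<in> {1..r}" for j using yj[OF that s(2)] by (simp add: y_def)
    have nonpole: "Complex u (y j) \<notin> \<int>\<^sub>\<le>\<^sub>0" if "j \<in> {1..r}" for u j
      using y1[OF that] by (auto elim!: nonpos_Ints_cases simp: complex_eq_iff)
    have reg: "gamma_factor_regular r lam mu s" "gamma_factor_regular r lam mu s'"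
      using nonpole by (auto simp: gamma_factor_regular_def arg)
    have "s \<noteq> 0" "s \<noteq> 1" using s Tpos by auto
    then have "F s * gamma_factor Q r lam mu s = \<omega> * cnj (gamma_factor Q r lam mu s') * cnj (F s')"
      using sel(9)[of s] reg by (simp add: s'_def)
    then have eq: "norm (F s) * norm (gamma_factor Q r lam mu s) = norm (gamma_factor Q r lam mu s') * norm (F s')"
      using sel(5) by (metis norm_mult complex_mod_cnj mult_1)
    define P where "P = (\<Prod>j=1..r. norm (Gamma (Complex (x' j) (y j))))"
    have P: "P > 0" unfolding P_def using nonpole
      by (intro prod_pos) (auto simp: Gamma_eq_zero_iff)
    have Qn: "norm (of_real Q powr s :: complex) = Q powr (Re s)" for s
      using sel(6) by (subst norm_powr_real_powr) auto
    have g1: "norm (gamma_factor Q r lam mu s) = Q powr (-A) * P"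
      using s by (simp add: gamma_factor_def norm_mult Qn arg P_def prod_norm)
    have "norm (gamma_factor Q r lam mu s') = Q powr (1 + A) * (\<Prod>j=1..r. norm (Gamma (Complex (x j) (y j))))"
      using s' by (simp add: gamma_factor_def norm_mult Qn arg prod_norm)
    also have "(\<Prod>j=1..r. norm (Gamma (Complex (x j) (y j)))) \<le> (\<Prod>j=1..r. C j * (1 + \<bar>y j\<bar>) ^ n j * norm (Gamma (Complex (x' j) (y j))))"
      using Cn y1 by (intro prod_mono) auto
    also have "\<dots> = (\<Prod>j=1..r. C j * (1 + \<bar>y j\<bar>) ^ n j) * P"
      by (simp add: P_def prod.distrib)
    finally have g2: "norm (gamma_factor Q r lam mu s') \<le> Q powr (1 + A) * ((\<Prod>j=1..r. C j * (1 + \<bar>y j\<bar>) ^ n j) * P)"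
      by (simp add: mult_left_mono)
    have K0': "norm (F s') \<le> K0" using s' \<open>A \<ge> 1\<close> by (intro K0) auto
    have "norm (F s) * (Q powr (-A) * P) \<le> Q powr (1 + A) * ((\<Prod>j=1..r. C j * (1 + \<bar>y j\<bar>) ^ n j) * P) * K0"
      using eq g1 mult_mono[OF g2 K0'] g2 by (smt (verit) norm_ge_zero)
    then have "norm (F s) * Q powr (-A) \<le> Q powr (1 + A) * (\<Prod>j=1..r. C j * (1 + \<bar>y j\<bar>) ^ n j) * K0"
      using P by (simp add: mult.assoc[symmetric])
    then have "(norm (F s) * Q powr (-A)) * Q powr A \<le> (Q powr (1 + A) * (\<Prod>j=1..r. C j * (1 + \<bar>y j\<bar>) ^ n j) * K0) * Q powr A"
      by (intro mult_right_mono) auto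
    moreover have "Q powr (-A) * Q powr A = 1" using sel(6) by (simp flip: powr_add)
    moreover have "Q powr (1 + A) * Q powr A = Q powr (1 + 2 * A)"
      using powr_add[of Q "1 + A" A] by (simp add: algebra_simps)
    moreover have "norm (F s) * (Q powr (-A) * Q powr A) \<le>
        Q powr (1 + A) * Q powr A * K0 * (\<Prod>j=1..r. C j * (1 + \<bar>y j\<bar>) ^ n j)"
      using calculation(1) by (simp only: mult_ac)
    ultimately have "norm (F s) \<le> Q powr (1 + 2 * A) * K0 * (\<Prod>j=1..r. C j * (1 + \<bar>y j\<bar>) ^ n j)"
      by (simp only: mult_1_right)
    also have "\<dots> \<le> norm (G s)"
      unfolding G_def y_def of_real_prod[symmetric] of_real_mult[symmetric] norm_of_real
      by (rule abs_ge_self)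
    finally show ?thesis .
  qed
  ultimately have "poly_bounded_on X F" by (rule poly_bounded_on_le)
  then show ?thesis unfolding X_def by blast
qed

text \<open>The power of \<open>s - 1\<close> removes the pole. On the left edge the bound comes
  from the functional equation high up and from compactness low down, on the right edge from
  absolute convergence.\<close>

lemma extended_selberg_poly_bounded_strip:
  assumes ext: "extended_selberg F a \<omega> Q r lam mu"
    and hol: "E holomorphic_on UNIV" and fin: "finite_order E"
    and E: "\<And>s. s \<noteq> 1 \<Longrightarrow> E s = (s - 1) ^ m * F s" and A: "A \<ge> (1::real)"
  shows "poly_bounded_on {s. -A \<le> Re s \<and> Re s \<le> 1 + A} E"
proof (rule finite_order_poly_bounded_on_strip[OF hol fin A])
  have pw: "poly_bounded_on X (\<lambda>s. (s - 1) ^ m)" for X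
    using poly_bounded_on_power[OF poly_bounded_on_linear[of X 1 "-1"]] by simp
  obtain T where T: "poly_bounded_on {s. Re s = -A \<and> \<bar>Im s\<bar> \<ge> T} F"
    using extended_selberg_poly_bounded_left_line[OF ext A] by blast
  have p1: "poly_bounded_on {s. Re s = -A \<and> \<bar>Im s\<bar> \<ge> T} E"
    by (rule poly_bounded_on_le[OF poly_bounded_on_mult[OF pw T]]) (use A in \<open>subst E, auto\<close>)
  have "compact (E ` cbox (Complex (-A) (-T)) (Complex (-A) T))"
    by (intro compact_continuous_image compact_cbox holomorphic_on_imp_continuous_on
        holomorphic_on_subset[OF hol]) auto
  then obtain B where B: "\<forall>v\<in>E ` cbox (Complex (-A) (-T)) (Complex (-A) T). norm v \<le> B"
    using compact_imp_bounded bounded_iff by metis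
  have p2: "poly_bounded_on {s. Re s = -A \<and> \<bar>Im s\<bar> \<le> T} E"
    by (rule poly_bounded_on_bounded[of _ _ B]) (use B in \<open>auto simp: in_cbox_complex_iff abs_le_iff\<close>)
  obtain K0 where K0: "\<And>s. Re s \<ge> 2 \<Longrightarrow> norm (F s) \<le> K0"
    using extended_selberg_bounded_half_plane[OF ext] by blast
  have "poly_bounded_on {s. Re s = 1 + A} F"
    using A by (intro poly_bounded_on_bounded[of _ _ K0] K0) auto
  then have p3: "poly_bounded_on {s. Re s = 1 + A} E"
    by (rule poly_bounded_on_le[OF poly_bounded_on_mult[OF pw]]) (use A in \<open>subst E, auto\<close>)
  show "poly_bounded_on {s. Re s = -A \<or> Re s = 1 + A} E"
    by (rule poly_bounded_on_subset[OF poly_bounded_on_Un[OF poly_bounded_on_Un[OF p1 p2] p3]]) auto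
qed

text \<open>
  The functional equation turns \<open>S(1 - s) cnj (F (cnj s))\<close> into \<open>F (1 - s)\<close> times reciprocal Gamma
  factors, so the zeros of \<open>S\<close> cancel the pole at 1.
\<close>

lemma selberg_S_conj_F_entire:
  assumes ext: "extended_selberg F a \<omega> Q r lam mu"
  shows "\<exists>H. H holomorphic_on UNIV \<and>
    (\<forall>s. s \<noteq> 1 \<longrightarrow> H s = selberg_S r lam mu (1 - s) * cnj (F (cnj s)))"
proof -
  note sel = extended_selbergD[OF ext]
  obtain m E where E: "E holomorphic_on UNIV" "\<And>s. s \<noteq> 1 \<Longrightarrow> E s = (s - 1) ^ m * F s"
    using sel(4) by blast
  have F_E: "F s = E s / (s - 1) ^ m" if "s \<noteq> 1" for s
    using E(2)[OF that] that by simp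
  define f where "f = (\<lambda>s. selberg_S r lam mu (1 - s) * cnj (F (cnj s)))"
  define z where "z = (\<lambda>j s. of_real (lam j) * (1 - s) + mu j)"
  define v where "v = (\<lambda>j s. of_real (lam j) * s + cnj (mu j))"
  \<comment> \<open>The other side of the functional equation in terms of the entire reciprocal
    Gamma function. As \<open>E (1 - s) / (- s) ^ m\<close> stands for \<open>F (1 - s)\<close>,
    \<open>g\<close> can be singular only at 0, and it supplies the missing value at 1.\<close>
  define g where "g = (\<lambda>s. inverse \<omega> * (2 * of_real pi) ^ r * (of_real Q powr (1 - s) * of_real Q powr (-s)) *
      (E (1 - s) / (- s) ^ m) * (\<Prod>j=1..r. rGamma (1 - z j s) * rGamma (v j s)))"
  have holf: "f holomorphic_on UNIV - {1}"
  proof -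
    define cE where "cE = cnj \<circ> E \<circ> cnj"
    have "cE holomorphic_on UNIV" unfolding cE_def
      using E(1) by (intro holomorphic_on_compose_cnj_cnj) (auto intro: holomorphic_on_subset)
    then have "(\<lambda>s. selberg_S r lam mu (1 - s) * (cE s / (s - 1) ^ m)) holomorphic_on UNIV - {1}"
      unfolding selberg_S_def by (intro holomorphic_intros) (auto intro: holomorphic_on_subset)
    then show ?thesis
    proof (rule holomorphic_transform)
      fix s :: complex assume "s \<in> UNIV - {1}"
      then have "cnj s \<noteq> 1" by (metis Diff_iff complex_cnj_cnj complex_cnj_one insertI1)
      then show "selberg_S r lam mu (1 - s) * (cE s / (s - 1) ^ m) = f s"
        by (simp add: f_def F_E cE_def)
    qed
  qed
  have "isCont g 1"
  proof -
    have "g holomorphic_on (- {0})"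
      unfolding g_def z_def v_def using sel(6)
      by (intro holomorphic_intros holomorphic_on_compose_gen[OF _ E(1), unfolded o_def]) auto
    then show ?thesis
      using continuous_on_eq_continuous_at[OF open_Compl[OF closed_singleton[of 0]], of g]
        holomorphic_on_imp_continuous_on by auto
  qed
  then have "g \<midarrow>1\<rightarrow> g 1" by (simp add: isCont_def)
  moreover have "eventually (\<lambda>s. f s = g s) (at 1)"
  proof -
    \<comment> \<open>As \<open>Re (mu j) \<ge> 0\<close>, near 1 the only nonpositive integer that
      \<open>z j s\<close> can meet is 0, and at one point only. So the functional equation is
      available in a punctured neighbourhood of 1, even if \<open>mu j = 0\<close>.\<close>
    have e1: "eventually (\<lambda>s. z j s \<notin> \<int>\<^sub>\<le>\<^sub>0) (at 1)" if j: "j \<in> {1..r}" for j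
    proof -
      have "((\<lambda>s. Re (of_real (lam j) * (1 - s))) \<longlongrightarrow> Re (of_real (lam j) * (1 - 1))) (at 1)"
        by (intro tendsto_intros)
      then have "eventually (\<lambda>s. Re (of_real (lam j) * (1 - s)) > -1) (at 1)"
        by (rule order_tendstoD(1)) simp
      moreover have "eventually (\<lambda>s. s \<noteq> 1 + mu j / of_real (lam j)) (at 1)"
        by (rule eventually_neq_at_within)
      ultimately show ?thesis
      proof eventually_elim
        case (elim s)
        show ?case
        proof
          assume "z j s \<in> \<int>\<^sub>\<le>\<^sub>0"
          then obtain k :: nat where k: "z j s = - of_nat k" by (auto elim: nonpos_Ints_cases')
          then have "Re (of_real (lam j) * (1 - s)) + Re (mu j) = - real k"
            unfolding z_def by (metis of_real_of_nat_eq Re_complex_of_real plus_complex.sel(1) uminus_complex.sel(1))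
          then have "k = 0" using elim(1) sel(8)[OF j] by simp
          then have "z j s = 0" using k by simp
          then show False using elim(2) sel(7)[OF j] by (simp add: z_def field_simps)
        qed
      qed
    qed
    have e2: "eventually (\<lambda>s. Re s > 0) (at (1::complex))"
      by (rule order_tendstoD(1)[OF tendsto_Re[OF tendsto_ident_at]]) simp
    have e3: "eventually (\<lambda>s. \<forall>j\<in>{1..r}. z j s \<notin> \<int>\<^sub>\<le>\<^sub>0) (at 1)"
      using e1 by (intro eventually_ball_finite) auto
    have e4: "eventually (\<lambda>s. s \<noteq> (1::complex)) (at 1)" by (rule eventually_neq_at_within)
    show ?thesis using e2 e3 e4
    proof eventually_elim
      case (elim s)
      have s: "s \<noteq> 0" "s \<noteq> 1" using elim by auto
      have npI: "u \<notin> \<int>\<^sub>\<le>\<^sub>0" if "Re u > 0" for u :: complex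
        using that by (auto elim!: nonpos_Ints_cases)
      have Rev: "Re (v j s) > 0" if j: "j \<in> {1..r}" for j
        using sel(7,8)[OF j] elim(1) by (simp add: v_def add_pos_nonneg)
      have vpos: "v j s \<notin> \<int>\<^sub>\<le>\<^sub>0" "cnj (v j s) \<notin> \<int>\<^sub>\<le>\<^sub>0" if "j \<in> {1..r}" for j
        using Rev[OF that] by (auto intro!: npI)
      have cv: "of_real (lam j) * cnj s + mu j = cnj (v j s)" for j by (simp add: v_def)
      have reg: "gamma_factor_regular r lam mu (1 - s)" "gamma_factor_regular r lam mu (cnj (1 - (1 - s)))"
        using elim(2) vpos unfolding gamma_factor_regular_def
        by (auto simp: cv z_def)
      have cg: "cnj (gamma_factor Q r lam mu (cnj s)) = of_real Q powr s * (\<Prod>j=1..r. Gamma (v j s))"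
        using sel(6) by (simp add: gamma_factor_def cnj_powr cnj_Gamma cv)
      have "F (1 - s) * gamma_factor Q r lam mu (1 - s) =
          \<omega> * (of_real Q powr s * (\<Prod>j=1..r. Gamma (v j s))) * cnj (F (cnj s))"
        using sel(9)[of "1 - s"] reg s cg by simp
      then have FE: "F (1 - s) * (of_real Q powr (1 - s) * (\<Prod>j=1..r. Gamma (z j s))) =
          \<omega> * (of_real Q powr s * (\<Prod>j=1..r. Gamma (v j s))) * cnj (F (cnj s))"
        by (simp add: gamma_factor_def z_def)
      have GrG: "Gamma u * rGamma u = 1" if "u \<notin> \<int>\<^sub>\<le>\<^sub>0" for u :: complex
        using that by (simp add: Gamma_def rGamma_eq_zero_iff)
      have hG: "(\<Prod>j=1..r. Gamma (v j s)) * (\<Prod>j=1..r. rGamma (v j s)) = 1"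
        "(\<Prod>j=1..r. Gamma (z j s)) * (\<Prod>j=1..r. rGamma (z j s)) = 1"
        unfolding prod.distrib[symmetric] using GrG vpos elim(2) by (auto intro!: prod.neutral)
      have hQ: "of_real Q powr s * of_real Q powr (-s) = (1::complex)"
        using sel(6) by (simp flip: powr_add)
      have h\<omega>: "inverse \<omega> * \<omega> = 1" using sel(5) by (metis left_inverse norm_zero zero_neq_one)
      \<comment> \<open>By reflection each sine is
        \<open>pi * rGamma (z j s) * rGamma (1 - z j s)\<close>, and the first reciprocal Gamma
        cancels against \<open>Gamma (z j s)\<close> in the functional equation.\<close>
      have hS: "selberg_S r lam mu (1 - s) = (2 * of_real pi) ^ r * ((\<Prod>j=1..r. rGamma (z j s)) * (\<Prod>j=1..r. rGamma (1 - z j s)))"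
        unfolding selberg_S_def prod.distrib[symmetric] rGamma_reflection_complex
        by (simp add: z_def prod_dividef power_mult_distrib)
      have hE: "E (1 - s) / (- s) ^ m = F (1 - s)" using F_E[of "1 - s"] s by simp
      have alg: "S * X = iw * P * (Q1 * Qm) * Ff * (R1 * Rv)"
        if "Gv * Rv = 1" "Gz * Rz = 1" "Qs * Qm = 1" "iw * w = 1" "S = P * (Rz * R1)"
          "Ff * (Q1 * Gz) = w * (Qs * Gv) * X"
        for S X iw w P Q1 Qm Qs Ff R1 Rv Rz Gv Gz :: complex
      proof -
        have "iw * P * (Q1 * Qm) * Ff * (R1 * Rv) = iw * P * (Q1 * Qm) * Ff * (R1 * Rv) * (Gz * Rz)"
          using that(2) by simp
        also have "\<dots> = iw * P * Qm * R1 * Rv * Rz * (Ff * (Q1 * Gz))" by (simp only: mult_ac)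
        also have "\<dots> = (iw * w) * (Qs * Qm) * (Gv * Rv) * (P * (Rz * R1)) * X"
          unfolding that(6) by (simp only: mult_ac)
        also have "\<dots> = S * X" using that(1,3,4,5) by simp
        finally show ?thesis by (rule sym)
      qed
      show "f s = g s"
        unfolding f_def g_def prod.distrib hE by (rule alg[OF hG hQ h\<omega> hS FE])
    qed
  qed
  ultimately have lim: "f \<midarrow>1\<rightarrow> g 1" using tendsto_cong by blast
  define H where "H = (\<lambda>s. if s = 1 then g 1 else f s)"
  have "H holomorphic_on UNIV"
    unfolding H_def by (rule removable_singularity[OF holf _ lim]) auto
  moreover have "\<forall>s. s \<noteq> 1 \<longrightarrow> H s = selberg_S r lam mu (1 - s) * cnj (F (cnj s))"
    by (simp add: H_def f_def)
  ultimately show ?thesis by blast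
qed

subsection \<open>Exponential growth along vertical lines\<close>

text \<open>The rate \<open>D\<close> and the exponent \<open>n\<close> are arguments whereas the
  constant is existential: in the end the exponent must be the same for all \<alpha> and
  \<open>l\<close>, the constant need not be.\<close>

definition vertical_growth :: "complex set \<Rightarrow> real \<Rightarrow> nat \<Rightarrow> (complex \<Rightarrow> complex) \<Rightarrow> bool" where
  "vertical_growth X D n f \<longleftrightarrow>
     (\<exists>C. \<forall>s\<in>X. norm (f s) \<le> C * exp (D * \<bar>Im s\<bar>) * (1 + \<bar>Im s\<bar>) ^ n)"

lemma vertical_growthD:
  assumes "vertical_growth X D n f"
  shows "\<exists>C>0. \<forall>s\<in>X. norm (f s) \<le> C * exp (D * \<bar>Im s\<bar>) * (1 + \<bar>Im s\<bar>) ^ n"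
proof -
  obtain C where C: "\<And>s. s \<in> X \<Longrightarrow> norm (f s) \<le> C * exp (D * \<bar>Im s\<bar>) * (1 + \<bar>Im s\<bar>) ^ n"
    using assms by (auto simp: vertical_growth_def)
  have "norm (f s) \<le> (\<bar>C\<bar> + 1) * exp (D * \<bar>Im s\<bar>) * (1 + \<bar>Im s\<bar>) ^ n" if "s \<in> X" for s
  proof -
    have "norm (f s) \<le> C * exp (D * \<bar>Im s\<bar>) * (1 + \<bar>Im s\<bar>) ^ n" using C that .
    also have "\<dots> \<le> (\<bar>C\<bar> + 1) * exp (D * \<bar>Im s\<bar>) * (1 + \<bar>Im s\<bar>) ^ n"
      by (intro mult_right_mono) auto
    finally show ?thesis .
  qed
  then show ?thesis by (intro exI[of _ "\<bar>C\<bar> + 1"]) auto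
qed

lemma vertical_growth_cong:
  "vertical_growth X D n f \<Longrightarrow> (\<And>s. s \<in> X \<Longrightarrow> f s = g s) \<Longrightarrow> vertical_growth X D n g"
  unfolding vertical_growth_def by (metis (no_types, lifting))

lemma vertical_growth_const: "vertical_growth X 0 0 (\<lambda>_. c)"
  unfolding vertical_growth_def by auto

lemma vertical_growth_mono:
  assumes "vertical_growth X D n f" "n \<le> m"
  shows "vertical_growth X D m f"
proof -
  obtain C where C: "C > 0" "\<And>s. s \<in> X \<Longrightarrow> norm (f s) \<le> C * exp (D * \<bar>Im s\<bar>) * (1 + \<bar>Im s\<bar>) ^ n"
    using vertical_growthD[OF assms(1)] by blast
  have "norm (f s) \<le> C * exp (D * \<bar>Im s\<bar>) * (1 + \<bar>Im s\<bar>) ^ m" if "s \<in> X" for s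
    by (rule order_trans[OF C(2)[OF that]])
       (use C(1) assms(2) in \<open>auto intro!: mult_left_mono power_increasing\<close>)
  then show ?thesis unfolding vertical_growth_def by blast
qed

lemma vertical_growth_add:
  assumes "vertical_growth X D n f" "vertical_growth X D n g"
  shows "vertical_growth X D n (\<lambda>s. f s + g s)"
proof -
  obtain C where C: "\<And>s. s \<in> X \<Longrightarrow> norm (f s) \<le> C * exp (D * \<bar>Im s\<bar>) * (1 + \<bar>Im s\<bar>) ^ n"
    using vertical_growthD[OF assms(1)] by blast
  obtain C' where C': "\<And>s. s \<in> X \<Longrightarrow> norm (g s) \<le> C' * exp (D * \<bar>Im s\<bar>) * (1 + \<bar>Im s\<bar>) ^ n"
    using vertical_growthD[OF assms(2)] by blast
  have "norm (f s + g s) \<le> (C + C') * exp (D * \<bar>Im s\<bar>) * (1 + \<bar>Im s\<bar>) ^ n" if "s \<in> X" for s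
    using norm_triangle_ineq[of "f s" "g s"] C[OF that] C'[OF that] by (simp only: distrib_right)
  then show ?thesis unfolding vertical_growth_def by blast
qed

lemma vertical_growth_sum:
  "(\<And>j. j \<in> J \<Longrightarrow> vertical_growth X D n (f j)) \<Longrightarrow> vertical_growth X D n (\<lambda>s. \<Sum>j\<in>J. f j s)"
proof (induction J rule: infinite_finite_induct)
  case (insert j J)
  then show ?case by (auto intro: vertical_growth_add)
qed (auto simp: vertical_growth_def intro!: exI[of _ 0])

lemma vertical_growth_mult:
  assumes "vertical_growth X D n f" "vertical_growth X D' m g"
  shows "vertical_growth X (D + D') (n + m) (\<lambda>s. f s * g s)"
proof -
  obtain C where C: "C > 0" "\<And>s. s \<in> X \<Longrightarrow> norm (f s) \<le> C * exp (D * \<bar>Im s\<bar>) * (1 + \<bar>Im s\<bar>) ^ n"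
    using vertical_growthD[OF assms(1)] by blast
  obtain C' where C': "C' > 0" "\<And>s. s \<in> X \<Longrightarrow> norm (g s) \<le> C' * exp (D' * \<bar>Im s\<bar>) * (1 + \<bar>Im s\<bar>) ^ m"
    using vertical_growthD[OF assms(2)] by blast
  have "norm (f s * g s) \<le> (C * C') * exp ((D + D') * \<bar>Im s\<bar>) * (1 + \<bar>Im s\<bar>) ^ (n + m)" if "s \<in> X" for s
  proof -
    have "norm (f s) * norm (g s) \<le> (C * exp (D * \<bar>Im s\<bar>) * (1 + \<bar>Im s\<bar>) ^ n) * (C' * exp (D' * \<bar>Im s\<bar>) * (1 + \<bar>Im s\<bar>) ^ m)"
      using C C' that by (intro mult_mono) auto
    moreover have "exp ((D + D') * \<bar>Im s\<bar>) = exp (D * \<bar>Im s\<bar>) * exp (D' * \<bar>Im s\<bar>)"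
      by (simp add: distrib_right exp_add)
    ultimately show ?thesis by (simp only: norm_mult power_add mult_ac)
  qed
  then show ?thesis unfolding vertical_growth_def by blast
qed

lemma vertical_growth_cmult: "vertical_growth X D n f \<Longrightarrow> vertical_growth X D n (\<lambda>s. c * f s)"
  using vertical_growth_mult[OF vertical_growth_const, of X D n f c] by simp

lemma vertical_growth_shift:
  assumes "vertical_growth Y D n f" "\<And>s. s \<in> X \<Longrightarrow> s + of_real c \<in> Y"
  shows "vertical_growth X D n (\<lambda>s. f (s + of_real c))"
proof -
  obtain C where C: "\<And>s. s \<in> Y \<Longrightarrow> norm (f s) \<le> C * exp (D * \<bar>Im s\<bar>) * (1 + \<bar>Im s\<bar>) ^ n"
    using vertical_growthD[OF assms(1)] by blast
  have "norm (f (s + of_real c)) \<le> C * exp (D * \<bar>Im s\<bar>) * (1 + \<bar>Im s\<bar>) ^ n" if "s \<in> X" for s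
    using C[OF assms(2)[OF that]] by simp
  then show ?thesis unfolding vertical_growth_def by blast
qed

lemma exponential_sum_growth:
  assumes "d \<ge> 0" and w: "\<And>j. j \<in> J \<Longrightarrow> \<bar>w j\<bar> \<le> 1 / 2"
  shows "vertical_growth X (pi / 2 * d) 0
    (\<lambda>s. \<Sum>j\<in>J. b j * exp (\<i> * of_real (pi * d * w j) * (1 - (s + of_real c))))"
proof (intro vertical_growth_sum vertical_growth_cmult)
  fix j assume j: "j \<in> J"
  have "norm (exp (\<i> * of_real (pi * d * w j) * (1 - (s + of_real c)))) \<le> exp (pi / 2 * d * \<bar>Im s\<bar>)" for s
  proof -
    have "w j * Im s \<le> \<bar>w j\<bar> * \<bar>Im s\<bar>" by (metis abs_ge_self abs_mult)
    also have "\<dots> \<le> 1/2 * \<bar>Im s\<bar>" using w[OF j] by (intro mult_right_mono) auto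
    finally have "pi * d * (w j * Im s) \<le> pi * d * (1/2 * \<bar>Im s\<bar>)"
      using \<open>d \<ge> 0\<close> by (intro mult_left_mono) auto
    then show ?thesis by (simp add: mult_ac)
  qed
  then show "vertical_growth X (pi / 2 * d) 0 (\<lambda>s. exp (\<i> * of_real (pi * d * w j) * (1 - (s + of_real c))))"
    unfolding vertical_growth_def by (intro exI[of _ 1]) simp
qed

section \<open>Binomial coefficients with complex upper argument\<close>

lemma norm_gbinomial_le: "fact k * norm ((p::complex) gchoose k) \<le> (norm p + real k) ^ k"
proof -
  have "fact k * norm (p gchoose k) = norm (\<Prod>i=0..<k. p - of_nat i)"
    by (simp add: gbinomial_prod_rev norm_divide)
  also have "\<dots> = (\<Prod>i=0..<k. norm (p - of_nat i))" by (rule prod_norm[symmetric])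
  also have "\<dots> \<le> (\<Prod>i=0..<k. norm p + real k)"
  proof (intro prod_mono conjI)
    fix i assume "i \<in> {0..<k}"
    then show "norm (p - of_nat i) \<le> norm p + real k"
      using norm_triangle_ineq4[of p "of_nat i"] by simp
  qed auto
  finally show ?thesis by simp
qed

lemma vertical_growth_gbinomial:
  assumes "\<And>s. s \<in> X \<Longrightarrow> norm (p s) \<le> c * (1 + \<bar>Im s\<bar>)"
  shows "vertical_growth X 0 k (\<lambda>s. p s gchoose k)"
  unfolding vertical_growth_def
proof (intro exI ballI)
  fix s assume "s \<in> X"
  have "norm (p s gchoose k) \<le> fact k * norm (p s gchoose k)"
    by (simp add: mult_le_cancel_right1 fact_ge_1)
  also have "\<dots> \<le> (norm (p s) + real k) ^ k" by (rule norm_gbinomial_le)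
  also have "\<dots> \<le> ((c + real k) * (1 + \<bar>Im s\<bar>)) ^ k"
  proof (intro power_mono)
    have "real k * 1 \<le> real k * (1 + \<bar>Im s\<bar>)" by (intro mult_left_mono) auto
    then show "norm (p s) + real k \<le> (c + real k) * (1 + \<bar>Im s\<bar>)"
      using assms[OF \<open>s \<in> X\<close>] unfolding distrib_right[of c] by linarith
  qed auto
  finally show "norm (p s gchoose k) \<le> (c + real k) ^ k * exp (0 * \<bar>Im s\<bar>) * (1 + \<bar>Im s\<bar>) ^ k"
    by (simp add: power_mult_distrib)
qed

section \<open>Infinite sums of holomorphic functions and gluing of continuations\<close>

lemma holomorphic_on_infsum:
  fixes f :: "'i \<Rightarrow> complex \<Rightarrow> complex"
  assumes "open U" and hol: "\<And>i. i \<in> X \<Longrightarrow> f i holomorphic_on U"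
    and bd: "\<And>K. compact K \<Longrightarrow> K \<subseteq> U \<Longrightarrow>
        \<exists>M. M summable_on X \<and> (\<forall>i\<in>X. \<forall>s\<in>K. norm (f i s) \<le> M i)"
  shows "(\<lambda>s. \<Sum>\<^sub>\<infinity>i\<in>X. f i s) holomorphic_on U"
proof -
  have "(\<lambda>s. \<Sum>\<^sub>\<infinity>i\<in>X. f i s) analytic_on {z}" if zU: "z \<in> U" for z
  proof -
    obtain r where r: "r > 0" "cball z r \<subseteq> U"
      using open_contains_cball[of U] \<open>open U\<close> zU by meson
    obtain M where M: "M summable_on X" "\<And>i s. i \<in> X \<Longrightarrow> s \<in> cball z r \<Longrightarrow> norm (f i s) \<le> M i"
      using bd[OF compact_cball r(2)] by blast
    have ul: "uniform_limit (cball z r) (\<lambda>X s. \<Sum>i\<in>X. f i s) (\<lambda>s. \<Sum>\<^sub>\<infinity>i\<in>X. f i s) (finite_subsets_at_top X)"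
      using M(2,1) by (rule Weierstrass_m_test_general)
    have "eventually (\<lambda>Y. continuous_on (cball z r) (\<lambda>s. \<Sum>i\<in>Y. f i s) \<and> (\<lambda>s. \<Sum>i\<in>Y. f i s) holomorphic_on ball z r)
        (finite_subsets_at_top X)"
    proof (rule eventually_finite_subsets_at_top_weakI)
      fix Y assume "finite Y" "Y \<subseteq> X"
      then have "(\<lambda>s. \<Sum>i\<in>Y. f i s) holomorphic_on U" using hol by (intro holomorphic_on_sum) auto
      then show "continuous_on (cball z r) (\<lambda>s. \<Sum>i\<in>Y. f i s) \<and> (\<lambda>s. \<Sum>i\<in>Y. f i s) holomorphic_on ball z r"
        using r(2) by (meson ball_subset_cball holomorphic_on_imp_continuous_on holomorphic_on_subset order_trans)
    qed
    then have "(\<lambda>s. \<Sum>\<^sub>\<infinity>i\<in>X. f i s) holomorphic_on ball z r"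
      using holomorphic_uniform_limit[OF _ ul] by auto
    then show ?thesis using r(1) analytic_at_ball by blast
  qed
  then show ?thesis
    using analytic_imp_holomorphic analytic_on_analytic_at by blast
qed

text \<open>Any two candidates agree for \<open>Re s > 1\<close>, hence on their common half-plane
  by connectedness; the value at \<open>s\<close> can be read off from any half-plane that contains
  \<open>s\<close>.\<close>

lemma entire_from_half_planes:
  assumes hol: "\<And>A::nat. f A holomorphic_on {s. Re s > - real A}"
    and eq: "\<And>A s. Re s > 1 \<Longrightarrow> f A s = g s"
  shows "\<exists>G. G holomorphic_on UNIV \<and> (\<forall>A s. Re s > - real A \<longrightarrow> G s = f A s)"
proof -
  have same: "f A s = f B s" if "A \<le> B" "Re s > - real A" for A B s
  proof (rule analytic_continuation_open[of "{s. Re s > 1}" "{s. Re s > - real A}" "f A" "f B"])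
    show "f B holomorphic_on {s. Re s > - real A}"
      using hol[of B] that(1) by (rule_tac holomorphic_on_subset) auto
    show "{s. 1 < Re s} \<noteq> {}" by (auto intro!: exI[of _ 2])
    show "connected {s. Re s > - real A}"
      by (intro convex_connected convex_halfspace_Re_gt)
    show "f A z = f B z" if "z \<in> {s. Re s > 1}" for z using that by (simp add: eq)
    show "{s. 1 < Re s} \<subseteq> {s. Re s > - real A}" by auto
    show "f A holomorphic_on {s. Re s > - real A}" by (rule hol)
    show "s \<in> {s. Re s > - real A}" using that(2) by simp
  qed (rule open_halfspace_Re_gt)+
  define G where "G = (\<lambda>s. f (nat \<lceil>\<bar>Re s\<bar>\<rceil> + 1) s)"
  have G: "G s = f A s" if "Re s > - real A" for A s
  proof -
    define B where "B = nat \<lceil>\<bar>Re s\<bar>\<rceil> + 1"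
    have "Re s > - real B" unfolding B_def by linarith
    then have "f B s = f A s"
      using same[OF _ that, of B] same[of B A s] by (cases "A \<le> B") (simp_all only: not_le less_imp_le)
    then show ?thesis unfolding G_def B_def .
  qed
  have "G analytic_on {z}" for z
  proof -
    define A where "A = nat \<lceil>\<bar>Re z\<bar>\<rceil> + 1"
    have z: "Re z > - real A" unfolding A_def by linarith
    have "G holomorphic_on {s. Re s > - real A}"
      by (rule holomorphic_transform[OF hol[of A]]) (use G in auto)
    then show ?thesis
      using z open_halfspace_Re_gt[of "- real A"] by (auto simp: analytic_at)
  qed
  then have "G holomorphic_on UNIV"
    using analytic_imp_holomorphic analytic_on_analytic_at by blast
  then show ?thesis using G by blast
qed

section \<open>The base of the power and its Taylor expansion\<close>

lemma powr_le_powr_abs: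
  fixes u y c :: real
  assumes "c \<ge> 1" "1 / c \<le> u" "u \<le> c"
  shows "u powr y \<le> c powr \<bar>y\<bar>"
proof -
  have "1 / c > 0" using assms(1) by simp
  then have "u > 0" using assms(2) by linarith
  show ?thesis
  proof (cases "y \<ge> 0")
    case True
    then show ?thesis using assms \<open>u > 0\<close> by (simp add: powr_mono2)
  next
    case False
    then have "u powr y \<le> (1 / c) powr y" using assms \<open>1 / c > 0\<close> by (intro powr_mono2') auto
    also have "\<dots> = c powr \<bar>y\<bar>"
      using assms(1) False by (simp add: powr_divide powr_minus_divide[symmetric])
    finally show ?thesis .
  qed
qed

text \<open>A sum of vectors in the directions 0 and \<phi> points into the sector between them.
  Multiplication by \<open>cis (- \<phi>)\<close> turns the upper bound into a statement about the
  sign of \<open>sin (\<theta> - \<phi>)\<close>.\<close>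

lemma Im_Ln_one_plus_cis:
  assumes \<phi>: "0 \<le> \<phi>" "\<phi> \<le> pi" and "\<rho> \<ge> 0" and nz: "1 + of_real \<rho> * cis \<phi> \<noteq> 0"
  shows "0 \<le> Im (Ln (1 + of_real \<rho> * cis \<phi>))" "Im (Ln (1 + of_real \<rho> * cis \<phi>)) \<le> \<phi>"
proof -
  define B where "B = 1 + of_real \<rho> * cis \<phi>"
  define \<theta> where "\<theta> = Im (Ln B)"
  have "Im B \<ge> 0" using assms by (simp add: B_def sin_ge_zero)
  then have "0 \<le> \<theta> \<and> \<theta> \<le> pi"
    using Im_Ln_pos_le[of B] nz by (simp add: B_def \<theta>_def)
  then have \<theta>: "0 \<le> \<theta>" "\<theta> \<le> pi" by auto
  show "0 \<le> Im (Ln (1 + of_real \<rho> * cis \<phi>))" using \<theta> by (simp add: \<theta>_def B_def)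
  have "\<theta> \<le> \<phi>"
  proof (rule ccontr)
    assume "\<not> \<theta> \<le> \<phi>"
    then have less: "0 < \<theta> - \<phi>" by simp
    have "B = exp (Ln B)" using nz by (simp add: B_def)
    also have "\<dots> = of_real (exp (Re (Ln B))) * cis \<theta>" by (simp add: \<theta>_def exp_eq_polar)
    finally have "B * cis (-\<phi>) = of_real (exp (Re (Ln B))) * cis \<theta> * cis (-\<phi>)"
      by (rule arg_cong[where f = "\<lambda>x. x * cis (-\<phi>)"])
    then have "B * cis (-\<phi>) = of_real (exp (Re (Ln B))) * cis (\<theta> - \<phi>)"
      by (simp only: mult.assoc cis_mult diff_conv_add_uminus)
    moreover have "B * cis (-\<phi>) = cis (-\<phi>) + of_real \<rho>"
      by (simp add: B_def distrib_right mult.assoc cis_mult)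
    ultimately have "of_real (exp (Re (Ln B))) * cis (\<theta> - \<phi>) = cis (-\<phi>) + of_real \<rho>" by simp
    then have "Im (of_real (exp (Re (Ln B))) * cis (\<theta> - \<phi>)) = Im (cis (-\<phi>) + of_real \<rho>)"
      by (rule arg_cong)
    then have eq: "exp (Re (Ln B)) * sin (\<theta> - \<phi>) = - sin \<phi>" by simp
    have "sin \<phi> \<ge> 0" using \<phi> by (intro sin_ge_zero) auto
    then have "sin (\<theta> - \<phi>) \<le> 0" using eq
      by (metis exp_gt_zero mult_pos_pos neg_le_0_iff_le not_le)
    moreover have "sin (\<theta> - \<phi>) > 0" if "\<theta> - \<phi> < pi" using that less by (intro sin_gt_zero) auto
    ultimately have "\<theta> - \<phi> \<ge> pi" by linarith
    \<comment> \<open>An excess of \<pi> leaves only this degenerate case, in which \<open>B\<close>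
      is a positive real and has argument 0.\<close>
    then have "\<phi> = 0" "\<theta> = pi" using \<theta> \<phi> by auto
    then have "B = of_real (1 + \<rho>)" by (simp add: B_def)
    then have "\<theta> = 0" using \<open>\<rho> \<ge> 0\<close> by (simp add: \<theta>_def Ln_of_real del: of_real_add)
    then show False using \<open>\<theta> = pi\<close> by simp
  qed
  then show "Im (Ln (1 + of_real \<rho> * cis \<phi>)) \<le> \<phi>" by (simp add: \<theta>_def B_def)
qed

text \<open>The factor \<open>q\<close>, later \<open>e j s\<close>, stays inside the norm because
  the sharp exponential bound holds only for its product with the power.\<close>

lemma binomial_Taylor_remainder:
  fixes p v q :: complex
  assumes v: "norm v < 1"
    and B: "\<And>u. u \<in> closed_segment 0 v \<Longrightarrow> norm (q * (1 + u) powr (p - of_nat (Suc n))) \<le> B"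
  shows "norm (q * ((1 + v) powr p - (\<Sum>k\<le>n. (p gchoose k) * v ^ k))) \<le>
           (norm p + real (Suc n)) ^ Suc n * B * norm v ^ Suc n"
proof -
  \<comment> \<open>\<open>f i\<close> is the \<open>i\<close>-th derivative of
    \<open>q * (1 + u) powr p\<close>.\<close>
  define f where "f = (\<lambda>i u. q * (fact i * (p gchoose i) * (1 + u) powr (p - of_nat i)))"
  have B0: "B \<ge> 0" using B[of 0] norm_ge_zero by (meson ends_in_segment(1) order_trans)
  define B' where "B' = (norm p + real (Suc n)) ^ Suc n * B"
  have seg: "1 + u \<notin> \<real>\<^sub>\<le>\<^sub>0" if "u \<in> closed_segment 0 v" for u
  proof -
    have "norm u \<le> norm v" using segment_bound[OF that] by simp
    then have "Re (1 + u) > 0" using v abs_Re_le_cmod[of u] by simp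
    then show ?thesis by (auto simp: complex_nonpos_Reals_iff)
  qed
  have t1: "norm (f 0 v - (\<Sum>i\<le>n. f i 0 * (v - 0) ^ i / fact i)) \<le> B' * norm (v - 0) ^ Suc n / fact n"
  proof (rule complex_Taylor[of "closed_segment 0 v"])
    fix i u assume u: "u \<in> closed_segment 0 v"
    have sh: "p - of_nat (Suc i) = p - of_nat i - 1" by simp
    have gb: "fact (Suc i) * (p gchoose Suc i) = fact i * (p gchoose i) * (p - of_nat i)"
      by (simp only: gbinomial_mult_fact prod.atLeast0_lessThan_Suc)
    have "f (Suc i) u = q * (fact i * (p gchoose i) * ((p - of_nat i) * (1 + u) powr (p - of_nat i - 1)))"
      unfolding f_def sh gb by (simp only: mult.assoc)
    moreover have "(f i has_field_derivative q * (fact i * (p gchoose i) * ((p - of_nat i) * (1 + u) powr (p - of_nat i - 1)))) (at u within closed_segment 0 v)"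
      unfolding f_def using seg[OF u]
      by (auto intro!: derivative_eq_intros)
    ultimately show "(f i has_field_derivative f (Suc i) u) (at u within closed_segment 0 v)" by simp
  next
    fix u assume u: "u \<in> closed_segment 0 v"
    have "norm (f (Suc n) u) = (fact (Suc n) * norm (p gchoose Suc n)) * norm (q * (1 + u) powr (p - of_nat (Suc n)))"
      unfolding f_def norm_mult norm_fact by (simp only: mult_ac)
    also have "\<dots> \<le> (norm p + real (Suc n)) ^ Suc n * B"
      by (intro mult_mono norm_gbinomial_le B u) auto
    finally show "norm (f (Suc n) u) \<le> B'" by (simp add: B'_def)
  qed auto
  have t2: "f 0 v - (\<Sum>i\<le>n. f i 0 * (v - 0) ^ i / fact i) = q * ((1 + v) powr p - (\<Sum>k\<le>n. (p gchoose k) * v ^ k))"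
    by (simp add: f_def algebra_simps sum_distrib_left)
  have t3: "B' * norm (v - 0) ^ Suc n / fact n \<le> B' * norm v ^ Suc n"
  proof -
    have "0 \<le> B' * norm v ^ Suc n" unfolding B'_def using B0 by (intro mult_nonneg_nonneg) auto
    then show ?thesis using divide_left_mono[of 1 "fact n" "B' * norm v ^ Suc n"] by (simp add: fact_ge_1)
  qed
  show ?thesis using order_trans[OF t1 t3] unfolding t2 B'_def .
qed

subsection \<open>The shifted Dirichlet series\<close>

text \<open>In the application \<nu> is \<open>n_alpha\<close>, \<kappa> is \<open>s_star\<close>
  and \<open>a\<close> the conjugated coefficients, so \<alpha> and \<open>l\<close> enter only
  through \<nu>, \<kappa> and \<open>I\<close>. The omitted term survives as the cofiniteness of
  \<open>I j\<close> and the nonvanishing of the base.\<close>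

locale shifted_dirichlet_series =
  fixes a :: "nat \<Rightarrow> complex" and d \<nu> :: real and J :: "'j set" and w :: "'j \<Rightarrow> real"
    and b :: "'j \<Rightarrow> complex" and \<kappa> :: complex and I :: "'j \<Rightarrow> nat set"
  assumes d: "d \<ge> 1" and \<nu>: "\<nu> > 0" and fin_J: "finite J"
    and w: "\<And>j. j \<in> J \<Longrightarrow> \<bar>w j\<bar> \<le> 1 / 2"
    and summ: "\<And>s. Re s > 1 \<Longrightarrow> (\<lambda>n. norm (a n / of_nat n powr s)) summable_on {1..}"
    and I: "\<And>j. j \<in> J \<Longrightarrow> I j \<subseteq> {1..}" "\<And>j. j \<in> J \<Longrightarrow> finite ({1..} - I j)"
    and base_nz: "\<And>j n. j \<in> J \<Longrightarrow> n \<in> I j \<Longrightarrow>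
        1 + cis (pi * (1/2 - w j)) * of_real ((\<nu> / real n) powr (1 / d)) \<noteq> 0"
begin

definition x :: "nat \<Rightarrow> real" where "x n = (\<nu> / real n) powr (1 / d)"

definition base :: "'j \<Rightarrow> nat \<Rightarrow> complex" where
  "base j n = 1 + cis (pi * (1/2 - w j)) * of_real (x n)"

definition p :: "complex \<Rightarrow> complex" where "p s = of_real d * (1 - s - \<kappa>)"

definition e :: "'j \<Rightarrow> complex \<Rightarrow> complex" where
  "e j s = exp (\<i> * of_real (pi * d * w j) * (1 - s))"

definition summand :: "complex \<Rightarrow> 'j \<Rightarrow> nat \<Rightarrow> complex" where
  "summand s j n = a n / of_nat n powr s * base j n powr p s"

definition S :: "complex \<Rightarrow> complex" where
  "S s = (\<Sum>j\<in>J. b j * exp (\<i> * of_real (pi * d * w j) * s))"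

definition series :: "complex \<Rightarrow> complex" where
  "series s = (\<Sum>j\<in>J. b j * e j s * (\<Sum>\<^sub>\<infinity>n\<in>I j. summand s j n))"

definition D :: real where "D = pi / 2 * d"

text \<open>The price of a non-real \<kappa>: the argument of the base is at most \<pi>, so
  \<open>Im \<kappa>\<close> changes the norm of the power by at most this factor.\<close>

definition kap :: real where "kap = exp (pi * d * \<bar>Im \<kappa>\<bar>)"

lemma x_nonneg [simp]: "x n \<ge> 0" by (simp add: x_def)

text \<open>
  The frequency \<open>w j\<close> and the argument of the base add up to an angle in \<open>[-\<pi>/2, \<pi>/2]\<close>; this is where
  the factor \<open>exp (\<pi> d |t| / 2)\<close> comes from.
\<close>

lemma norm_e_powr_le:
  assumes j: "j \<in> J" and "\<rho> \<ge> 0" and nz: "1 + of_real \<rho> * cis (pi * (1/2 - w j)) \<noteq> 0"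
  shows "norm (e j s * (1 + of_real \<rho> * cis (pi * (1/2 - w j))) powr (p s - of_nat k)) \<le>
    norm (1 + of_real \<rho> * cis (pi * (1/2 - w j))) powr (d * (1 - Re s - Re \<kappa>) - real k) * kap * exp (D * \<bar>Im s\<bar>)"
proof -
  define \<phi> where "\<phi> = pi * (1/2 - w j)"
  define B where "B = 1 + of_real \<rho> * cis \<phi>"
  define \<theta> where "\<theta> = Im (Ln B)"
  have wj: "- (1/2) \<le> w j" "w j \<le> 1/2" using w[OF j] by auto
  have \<phi>: "0 \<le> \<phi>" "\<phi> \<le> pi" using wj by (auto simp: \<phi>_def mult_le_cancel_left1)
  have B: "B \<noteq> 0" using nz by (simp add: B_def \<phi>_def)
  have \<theta>: "0 \<le> \<theta>" "\<theta> \<le> \<phi>"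
    using Im_Ln_one_plus_cis[OF \<phi> \<open>\<rho> \<ge> 0\<close>] B by (auto simp: \<theta>_def B_def)
  have "pi * (- (1/2)) \<le> pi * w j" using wj by (intro mult_left_mono) auto
  moreover have "\<theta> + pi * w j \<le> pi / 2" using \<theta> by (simp add: \<phi>_def algebra_simps)
  \<comment> \<open>The lower end uses \<open>\<theta> \<ge> 0\<close> and
    \<open>w j \<ge> -1/2\<close>, the upper end \<open>\<theta> \<le> \<phi>\<close> and
    \<open>\<phi> + pi * w j = pi / 2\<close>.\<close>
  ultimately have ang: "\<bar>\<theta> + pi * w j\<bar> \<le> pi / 2" using \<theta> by linarith
  have ne: "norm (e j s) = exp (pi * d * w j * Im s)"
    by (simp add: e_def)
  have "norm (B powr (p s - of_nat k)) = exp (Re ((p s - of_nat k) * Ln B))"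
    using B by (simp add: powr_def)
  also have "Re ((p s - of_nat k) * Ln B) = (d * (1 - Re s - Re \<kappa>) - real k) * ln (norm B) + d * (Im s + Im \<kappa>) * \<theta>"
    using B by (simp add: p_def \<theta>_def algebra_simps)
  finally have nb: "norm (B powr (p s - of_nat k)) =
      exp ((d * (1 - Re s - Re \<kappa>) - real k) * ln (norm B) + d * (Im s + Im \<kappa>) * \<theta>)" .
  have "norm (e j s * B powr (p s - of_nat k)) =
      exp (pi * d * w j * Im s + ((d * (1 - Re s - Re \<kappa>) - real k) * ln (norm B) + d * (Im s + Im \<kappa>) * \<theta>))"
    by (simp only: norm_mult ne nb exp_add)
  also have "pi * d * w j * Im s + ((d * (1 - Re s - Re \<kappa>) - real k) * ln (norm B) + d * (Im s + Im \<kappa>) * \<theta>)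
     = (d * (1 - Re s - Re \<kappa>) - real k) * ln (norm B) + d * (Im \<kappa> * \<theta>) + d * (Im s * (\<theta> + pi * w j))"
    by (simp add: algebra_simps)
  also have "exp \<dots> \<le> exp ((d * (1 - Re s - Re \<kappa>) - real k) * ln (norm B) + pi * d * \<bar>Im \<kappa>\<bar> + D * \<bar>Im s\<bar>)"
  proof -
    have "Im \<kappa> * \<theta> \<le> \<bar>Im \<kappa>\<bar> * pi"
      using \<theta> \<phi> by (intro mult_mono) auto
    then have "d * (Im \<kappa> * \<theta>) \<le> d * (\<bar>Im \<kappa>\<bar> * pi)" using d by (intro mult_left_mono) auto
    moreover have "\<bar>Im s\<bar> * \<bar>\<theta> + pi * w j\<bar> \<le> \<bar>Im s\<bar> * (pi / 2)" using ang by (intro mult_left_mono) auto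
    then have "Im s * (\<theta> + pi * w j) \<le> \<bar>Im s\<bar> * (pi / 2)"
      by (metis abs_ge_self abs_mult order_trans)
    then have "d * (Im s * (\<theta> + pi * w j)) \<le> d * (\<bar>Im s\<bar> * (pi / 2))" using d by (intro mult_left_mono) auto
    ultimately show ?thesis by (simp add: D_def algebra_simps)
  qed
  also have "\<dots> = norm B powr (d * (1 - Re s - Re \<kappa>) - real k) * kap * exp (D * \<bar>Im s\<bar>)"
    using B by (simp add: powr_def kap_def exp_add)
  finally show ?thesis by (simp only: B_def \<phi>_def)
qed

lemma base_alt: "base j n = 1 + of_real (x n) * cis (pi * (1/2 - w j))"
  by (simp add: base_def mult.commute)

lemma x_tendsto: "x \<longlonglongrightarrow> 0"
proof -
  have "(\<lambda>n. \<nu> / real n) \<longlonglongrightarrow> 0" by (rule lim_const_over_n)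
  then have "(\<lambda>n. (\<nu> / real n) powr (1 / d)) \<longlonglongrightarrow> 0 powr (1 / d)"
    using d \<nu> by (intro tendsto_powr' tendsto_const) (auto intro!: always_eventually)
  then show ?thesis by (simp add: x_def[abs_def])
qed

text \<open>Past such an \<open>M\<close> the power is expanded well inside the unit disc and no
  index is missing, so that the sum over \<open>j\<close> can be taken first.\<close>

lemma ex_cutoff: "\<exists>M. \<forall>n>M. x n \<le> 1/2 \<and> (\<forall>j\<in>J. n \<in> I j)"
proof -
  have "eventually (\<lambda>n. x n < 1/2) sequentially"
    using order_tendstoD(2)[OF x_tendsto, of "1/2"] by simp
  then obtain M1 where M1: "\<And>n. n \<ge> M1 \<Longrightarrow> x n < 1/2" by (auto simp: eventually_sequentially)
  have "finite (\<Union>j\<in>J. {1..} - I j)" using fin_J I(2) by blast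
  then obtain M2 where M2: "\<And>n. n \<in> (\<Union>j\<in>J. {1..} - I j) \<Longrightarrow> n \<le> M2"
    unfolding finite_nat_set_iff_bounded_le by auto
  have "x n \<le> 1/2 \<and> (\<forall>j\<in>J. n \<in> I j)" if "n > max M1 M2" for n
  proof
    show "x n \<le> 1/2" using M1[of n] that by simp
    show "\<forall>j\<in>J. n \<in> I j" using M2[of n] that by force
  qed
  then show ?thesis by blast
qed

definition M :: nat where "M = (SOME M. \<forall>n>M. x n \<le> 1/2 \<and> (\<forall>j\<in>J. n \<in> I j))"

lemma M: "n > M \<Longrightarrow> x n \<le> 1/2" "n > M \<Longrightarrow> j \<in> J \<Longrightarrow> n \<in> I j"
proof -
  have "\<forall>n>M. x n \<le> 1/2 \<and> (\<forall>j\<in>J. n \<in> I j)" unfolding M_def by (rule someI_ex[OF ex_cutoff])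
  then show "n > M \<Longrightarrow> x n \<le> 1/2" "n > M \<Longrightarrow> j \<in> J \<Longrightarrow> n \<in> I j" by blast+
qed

text \<open>Beyond \<open>M\<close> the base has norm at least 1/2; below it there are finitely many
  bases, none of them zero, whose reciprocal norms are simply added to the bound.\<close>

lemma base_bounds: "\<exists>\<Theta>\<ge>1. \<forall>j\<in>J. \<forall>n\<in>I j. 1 / \<Theta> \<le> norm (base j n) \<and> norm (base j n) \<le> \<Theta>"
proof -
  define P where "P = (SIGMA j:J. I j \<inter> {..M})"
  have finP: "finite P" using fin_J by (auto simp: P_def)
  define \<Theta> where "\<Theta> = 2 + \<nu> powr (1 / d) + (\<Sum>(j, n)\<in>P. 1 / norm (base j n))"
  have sum0: "0 \<le> (\<Sum>(j, n)\<in>P. 1 / norm (base j n))" by (intro sum_nonneg) auto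
  have \<Theta>: "\<Theta> \<ge> 2" using sum0 by (simp add: \<Theta>_def add_nonneg_nonneg)
  have "1 / \<Theta> \<le> norm (base j n) \<and> norm (base j n) \<le> \<Theta>" if j: "j \<in> J" and n: "n \<in> I j" for j n
  proof
    have n1: "n \<ge> 1" using I(1)[OF j] n by auto
    have "x n \<le> \<nu> powr (1 / d)"
      unfolding x_def using \<nu> d n1 by (intro powr_mono2) (auto simp: field_simps)
    moreover have "norm (base j n) \<le> 1 + x n"
      unfolding base_def by (rule order_trans[OF norm_triangle_ineq]) (simp add: norm_mult)
    ultimately show "norm (base j n) \<le> \<Theta>" using sum0 by (simp add: \<Theta>_def)
    show "1 / \<Theta> \<le> norm (base j n)"
    proof (cases "n \<le> M")
      case True
      then have "(j, n) \<in> P" using j n by (auto simp: P_def)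
      then have "1 / norm (base j n) \<le> (\<Sum>(j, n)\<in>P. 1 / norm (base j n))"
        using member_le_sum[of "(j, n)" P "\<lambda>(j, n). 1 / norm (base j n)"] finP by auto
      then have "1 / norm (base j n) \<le> \<Theta>" using powr_ge_zero[of \<nu> "1 / d"] unfolding \<Theta>_def by linarith
      moreover have "norm (base j n) > 0" using base_nz[OF j n] by (simp add: base_def x_def)
      ultimately show ?thesis using \<Theta> by (simp add: field_simps)
    next
      case False
      then have "x n \<le> 1/2" using M(1) by auto
      moreover have "1 \<le> norm (base j n) + x n"
        using norm_triangle_ineq4[of "base j n" "cis (pi * (1/2 - w j)) * of_real (x n)"]
        by (simp add: base_def norm_mult)
      moreover have "1 / \<Theta> \<le> 1/2" using \<Theta> by (simp add: field_simps)
      ultimately show ?thesis by linarith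
    qed
  qed
  then show ?thesis using \<Theta> by (intro exI[of _ \<Theta>]) auto
qed

definition \<Theta> :: real where
  "\<Theta> = (SOME \<Theta>. \<Theta> \<ge> 1 \<and> (\<forall>j\<in>J. \<forall>n\<in>I j. 1 / \<Theta> \<le> norm (base j n) \<and> norm (base j n) \<le> \<Theta>))"

lemma \<Theta>: "\<Theta> \<ge> 1" "j \<in> J \<Longrightarrow> n \<in> I j \<Longrightarrow> 1 / \<Theta> \<le> norm (base j n)"
    "j \<in> J \<Longrightarrow> n \<in> I j \<Longrightarrow> norm (base j n) \<le> \<Theta>"
proof -
  have "\<Theta> \<ge> 1 \<and> (\<forall>j\<in>J. \<forall>n\<in>I j. 1 / \<Theta> \<le> norm (base j n) \<and> norm (base j n) \<le> \<Theta>)"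
    unfolding \<Theta>_def by (rule someI_ex[OF base_bounds])
  then show "\<Theta> \<ge> 1" "j \<in> J \<Longrightarrow> n \<in> I j \<Longrightarrow> 1 / \<Theta> \<le> norm (base j n)"
    "j \<in> J \<Longrightarrow> n \<in> I j \<Longrightarrow> norm (base j n) \<le> \<Theta>" by blast+
qed

definition W :: "complex \<Rightarrow> real" where
  "W s = \<Theta> powr \<bar>d * (1 - Re s - Re \<kappa>)\<bar> * kap * exp (D * \<bar>Im s\<bar>)"

lemma norm_summand_le:
  assumes j: "j \<in> J" and n: "n \<in> I j"
  shows "norm (e j s * summand s j n) \<le> norm (a n / of_nat n powr s) * W s"
proof -
  have nz: "1 + of_real (x n) * cis (pi * (1/2 - w j)) \<noteq> 0"
    using base_nz[OF j n] by (simp add: x_def mult.commute)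
  have "norm (e j s * base j n powr p s) \<le> norm (base j n) powr (d * (1 - Re s - Re \<kappa>)) * kap * exp (D * \<bar>Im s\<bar>)"
    using norm_e_powr_le[OF j x_nonneg nz, of s 0] by (simp add: base_alt)
  also have "\<dots> \<le> W s"
    unfolding W_def using powr_le_powr_abs[OF \<Theta>(1) \<Theta>(2)[OF j n] \<Theta>(3)[OF j n]]
    by (intro mult_right_mono) (auto simp: kap_def)
  finally have "norm (a n / of_nat n powr s) * norm (e j s * base j n powr p s) \<le> norm (a n / of_nat n powr s) * W s"
    by (intro mult_left_mono) auto
  moreover have "e j s * summand s j n = (a n / of_nat n powr s) * (e j s * base j n powr p s)"
    by (simp add: summand_def)
  ultimately show ?thesis by (simp only: norm_mult)
qed

lemma e_nz [simp]: "e j s \<noteq> 0" by (simp add: e_def)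

lemma abs_summable_e_summand:
  assumes j: "j \<in> J" and s: "Re s > 1"
  shows "(\<lambda>n. norm (e j s * summand s j n)) summable_on I j"
proof (rule Infinite_Sum.abs_summable_on_comparison_test')
  have "(\<lambda>n. norm (a n / of_nat n powr s)) summable_on I j"
    using summ[OF s] I(1)[OF j] by (rule summable_on_subset_banach)
  then show "(\<lambda>n. norm (a n / of_nat n powr s) * W s) summable_on I j"
    by (rule summable_on_cmult_left)
qed (rule norm_summand_le[OF j])

lemma abs_summable_summand:
  assumes j: "j \<in> J" and s: "Re s > 1"
  shows "(\<lambda>n. norm (summand s j n)) summable_on I j"
proof -
  have "(\<lambda>n. inverse (norm (e j s)) * norm (e j s * summand s j n)) summable_on I j"
    using abs_summable_e_summand[OF assms] by (rule summable_on_cmult_right)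
  moreover have "inverse (norm (e j s)) * norm (e j s * summand s j n) = norm (summand s j n)" for n
    by (simp add: norm_mult mult.assoc[symmetric])
  ultimately show ?thesis by (simp only:)
qed

text \<open>Moves \<open>e j s\<close> under the sum over \<open>n\<close>, since only together with
  the power does it obey the bound with rate \<open>D\<close>.\<close>

lemma series_eq: "series s = (\<Sum>j\<in>J. b j * (\<Sum>\<^sub>\<infinity>n\<in>I j. e j s * summand s j n))"
  unfolding series_def infsum_cmult_right' by (simp only: mult.assoc)

lemma norm_dirichlet_le:
  assumes "n \<ge> 1" "\<sigma> \<le> Re s"
  shows "norm (a n / of_nat n powr s) \<le> norm (a n / of_nat n powr of_real \<sigma>)"
proof -
  have "real n powr \<sigma> \<le> real n powr Re s" using assms by (intro powr_mono) auto
  then have "norm (a n) / real n powr Re s \<le> norm (a n) / real n powr \<sigma>"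
    using assms(1) by (intro divide_left_mono) auto
  then show ?thesis by (simp add: norm_divide norm_of_nat_powr[OF assms(1)])
qed

text \<open>Absolute convergence at \<open>1 + \<delta>\<close> gives exponent 0, but with a
  constant depending on \<delta>, so nothing uniform up to \<open>Re s = 1\<close> follows from
  it.\<close>

lemma series_growth:
  assumes "\<delta> > 0"
  shows "vertical_growth {s. 1 + \<delta> \<le> Re s \<and> Re s \<le> B} D 0 series"
proof -
  define X where "X = {s. 1 + \<delta> \<le> Re s \<and> Re s \<le> B}"
  define A where "A = (\<Sum>\<^sub>\<infinity>n\<in>{1..}. norm (a n / of_nat n powr of_real (1 + \<delta>)))"
  have sA: "(\<lambda>n. norm (a n / of_nat n powr of_real (1 + \<delta>))) summable_on {1..}"
    using assms by (intro summ) auto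
  define Y where "Y = d * (1 + \<bar>B\<bar> + \<bar>Re \<kappa>\<bar>)"
  have A0: "A \<ge> 0" unfolding A_def by (intro infsum_nonneg) auto
  have "vertical_growth X D 0 (\<lambda>s. \<Sum>\<^sub>\<infinity>n\<in>I j. e j s * summand s j n)" if j: "j \<in> J" for j
    unfolding vertical_growth_def
  proof (intro exI ballI)
    fix s assume "s \<in> X"
    then have s: "1 + \<delta> \<le> Re s" "Re s \<le> B" by (auto simp: X_def)
    have s1: "Re s > 1" using s assms by auto
    have "norm (\<Sum>\<^sub>\<infinity>n\<in>I j. e j s * summand s j n) \<le> (\<Sum>\<^sub>\<infinity>n\<in>I j. norm (e j s * summand s j n))"
      by (rule norm_infsum_bound[OF abs_summable_e_summand[OF j s1]])
    also have "\<dots> \<le> (\<Sum>\<^sub>\<infinity>n\<in>{1..}. norm (a n / of_nat n powr of_real (1 + \<delta>)) * W s)"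
    proof (rule infsum_mono_neutral)
      show "(\<lambda>n. norm (a n / of_nat n powr of_real (1 + \<delta>)) * W s) summable_on {1..}"
        using sA by (rule summable_on_cmult_left)
      show "norm (e j s * summand s j n) \<le> norm (a n / of_nat n powr of_real (1 + \<delta>)) * W s" if "n \<in> I j \<inter> {1..}" for n
      proof -
        have "norm (e j s * summand s j n) \<le> norm (a n / of_nat n powr s) * W s"
          using norm_summand_le[OF j] that by blast
        also have "\<dots> \<le> norm (a n / of_nat n powr of_real (1 + \<delta>)) * W s"
          using that s by (intro mult_right_mono norm_dirichlet_le) (auto simp: W_def kap_def)
        finally show ?thesis .
      qed
    qed (use abs_summable_e_summand[OF j s1] I(1)[OF j] in \<open>auto simp: W_def kap_def\<close>)
    also have "\<dots> = A * W s" unfolding A_def by (rule infsum_cmult_left')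
    also have "\<dots> \<le> A * (\<Theta> powr Y * kap * exp (D * \<bar>Im s\<bar>))"
    proof -
      have "\<bar>1 - Re s - Re \<kappa>\<bar> \<le> 1 + \<bar>B\<bar> + \<bar>Re \<kappa>\<bar>" using s s1 by linarith
      then have "\<bar>d * (1 - Re s - Re \<kappa>)\<bar> \<le> Y" using d by (simp add: Y_def abs_mult)
      then have "\<Theta> powr \<bar>d * (1 - Re s - Re \<kappa>)\<bar> \<le> \<Theta> powr Y" using \<Theta>(1) by (intro powr_mono) auto
      then show ?thesis unfolding W_def using A0 by (intro mult_left_mono mult_right_mono) (auto simp: kap_def)
    qed
    finally show "norm (\<Sum>\<^sub>\<infinity>n\<in>I j. e j s * summand s j n) \<le> (A * \<Theta> powr Y * kap) * exp (D * \<bar>Im s\<bar>) * (1 + \<bar>Im s\<bar>) ^ 0"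
      by (simp add: mult_ac)
  qed
  then have "vertical_growth X D 0 (\<lambda>s. \<Sum>j\<in>J. b j * (\<Sum>\<^sub>\<infinity>n\<in>I j. e j s * summand s j n))"
    by (intro vertical_growth_sum vertical_growth_cmult)
  then show ?thesis unfolding X_def series_eq[symmetric] .
qed

end

subsection \<open>Analytic continuation\<close>

lemma has_sum_finite_sum:
  fixes f :: "'i \<Rightarrow> 'b \<Rightarrow> 'c :: topological_comm_monoid_add"
  assumes "\<And>k. k \<in> F \<Longrightarrow> (f k has_sum T k) X"
  shows "((\<lambda>n. \<Sum>k\<in>F. f k n) has_sum (\<Sum>k\<in>F. T k)) X"
  using assms by (induction F rule: infinite_finite_induct) (auto intro!: has_sum_add has_sum_0)

text \<open>Large enough for \<open>- A + (K + 1) / d \<ge> 2\<close>, so that the remainder series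
  converges absolutely wherever \<open>Re s \<ge> - A\<close>.\<close>

definition taylor_order :: "real \<Rightarrow> nat \<Rightarrow> nat" where
  "taylor_order d A = nat \<lceil>d * (real A + 2)\<rceil>"

text \<open>\<open>Suc A\<close> leaves room for the closed strip \<open>Re s \<ge> - A\<close>
  inside an open half-plane. \<open>Suc K\<close> is the degree in the height of the Taylor
  remainder, and \<open>A + 2 + K\<close> bounds the real parts of all shifts \<open>s + k/d\<close>
  with \<open>k \<le> K\<close>. Neither \<alpha> nor \<open>l\<close> occurs.\<close>

definition growth_exponent :: "real \<Rightarrow> (nat \<Rightarrow> nat) \<Rightarrow> nat \<Rightarrow> nat" where
  "growth_exponent d m A = (let K = taylor_order d (Suc A) in Suc K + m (A + 2 + K))"

text \<open>\<open>H\<close> and \<open>m\<close> are parameters rather than constructed here, since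
  they belong to \<open>F\<close> and must be chosen before \<alpha> and \<open>l\<close>.\<close>

locale shifted_dirichlet_continuation = shifted_dirichlet_series +
  fixes H :: "complex \<Rightarrow> complex" and m :: "nat \<Rightarrow> nat"
  assumes hol_H: "H holomorphic_on UNIV"
    and H_eq: "\<And>s. Re s > 1 \<Longrightarrow> H s = S (1 - s) * (\<Sum>\<^sub>\<infinity>n\<in>{1..}. a n / of_nat n powr s)"
    and H_growth: "\<And>A. vertical_growth {s. \<bar>Re s\<bar> \<le> real A \<and> 1 \<le> \<bar>Im s\<bar>} D (m A) H"
begin

definition DM :: "complex \<Rightarrow> complex" where
  "DM u = (\<Sum>n\<in>{1..M}. a n / of_nat n powr u)"

definition rem :: "nat \<Rightarrow> complex \<Rightarrow> 'a \<Rightarrow> nat \<Rightarrow> complex" where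
  "rem K s j n = a n / of_nat n powr s *
     (e j s * (base j n powr p s - (\<Sum>k\<le>K. (p s gchoose k) * (of_real (x n) * cis (pi * (1/2 - w j))) ^ k)))"

definition head :: "complex \<Rightarrow> complex" where
  "head s = (\<Sum>j\<in>J. b j * (\<Sum>n\<in>I j \<inter> {..M}. e j s * summand s j n))"

text \<open>For \<open>Re s > 1\<close> the bracket is \<open>S (1 - q)\<close> times the Dirichlet
  series over \<open>n > M\<close> at \<open>q = s + k/d\<close>; written with \<open>H\<close> and
  \<open>DM\<close> it is entire.\<close>

definition middle :: "nat \<Rightarrow> complex \<Rightarrow> complex" where
  "middle K s = (\<Sum>k\<le>K. (p s gchoose k) * (\<i> ^ k * of_real (\<nu> powr (k / d)) *
     (H (s + of_real (k / d)) - S (1 - (s + of_real (k / d))) * DM (s + of_real (k / d)))))"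

definition tail :: "nat \<Rightarrow> complex \<Rightarrow> complex" where
  "tail K s = (\<Sum>j\<in>J. b j * (\<Sum>\<^sub>\<infinity>n\<in>{M<..}. rem K s j n))"

definition V :: "nat \<Rightarrow> complex \<Rightarrow> real" where
  "V K s = (norm (p s) + real (Suc K)) ^ Suc K *
     (2 powr \<bar>d * (1 - Re s - Re \<kappa>) - real (Suc K)\<bar> * kap * exp (D * \<bar>Im s\<bar>)) * \<nu> powr (Suc K / d)"

lemma kap_pos: "kap > 0" by (simp add: kap_def)

lemma V_nonneg: "V K s \<ge> 0"
  unfolding V_def using kap_pos by (intro mult_nonneg_nonneg zero_le_power) auto

lemma x_power:
  assumes "n \<ge> 1"
  shows "x n ^ k = \<nu> powr (k / d) / real n powr (k / d)"
proof -
  have "x n ^ k = (\<nu> / real n) powr (real k * (1 / d))"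
    unfolding x_def using \<nu> assms by (intro powr_power) auto
  also have "\<dots> = \<nu> powr (k / d) / real n powr (k / d)"
    using \<nu> by (simp add: powr_divide)
  finally show ?thesis .
qed

text \<open>The remainder gains \<open>x n ^ Suc K\<close>, a constant times
  \<open>n powr (- Suc K / d)\<close>, which amounts to shifting \<open>s\<close> by
  \<open>Suc K / d\<close>. All points of the segment from 0 to \<open>v\<close> have the direction
  \<open>c\<close>, so \<open>norm_e_powr_le\<close> covers them.\<close>

lemma rem_le:
  assumes j: "j \<in> J" and n: "n > M"
  shows "norm (rem K s j n) \<le> V K s * norm (a n / of_nat n powr (s + of_real (Suc K / d)))"
proof -
  define c where "c = cis (pi * (1/2 - w j))"
  define v where "v = of_real (x n) * c"
  have nv: "norm v = x n" by (simp add: v_def c_def norm_mult)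
  have xn: "x n \<le> 1/2" using M(1)[OF n] .
  have n1: "n \<ge> 1" using n by simp
  define B where "B = 2 powr \<bar>d * (1 - Re s - Re \<kappa>) - real (Suc K)\<bar> * kap * exp (D * \<bar>Im s\<bar>)"
  have "norm (e j s * ((1 + v) powr p s - (\<Sum>k\<le>K. (p s gchoose k) * v ^ k)))
      \<le> (norm (p s) + real (Suc K)) ^ Suc K * B * norm v ^ Suc K"
  proof (rule binomial_Taylor_remainder)
    show "norm v < 1" using nv xn by simp
    fix u assume "u \<in> closed_segment 0 v"
    then obtain t where t: "0 \<le> t" "t \<le> 1" "u = of_real t * v"
      by (auto simp: in_segment scaleR_conv_of_real)
    define \<rho> where "\<rho> = t * x n"
    have \<rho>: "0 \<le> \<rho>" using t by (simp add: \<rho>_def)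
    have "\<rho> \<le> 1 * x n" unfolding \<rho>_def using t by (intro mult_right_mono) auto
    then have \<rho>2: "\<rho> \<le> 1/2" using xn by simp
    have u: "u = of_real \<rho> * c" by (simp add: t v_def \<rho>_def)
    have nu: "norm u = \<rho>" using \<rho> by (simp add: u c_def norm_mult)
    have lo: "1/2 \<le> norm (1 + u)" using norm_triangle_ineq4[of "1 + u" u] nu \<rho>2 by simp
    have hi: "norm (1 + u) \<le> 2" using norm_triangle_ineq[of 1 u] nu \<rho>2 by simp
    have "1 + of_real \<rho> * cis (pi * (1/2 - w j)) \<noteq> 0" using lo by (auto simp: u c_def)
    from norm_e_powr_le[OF j \<rho> this, of s "Suc K"]
    have "norm (e j s * (1 + u) powr (p s - of_nat (Suc K))) \<le>
        norm (1 + u) powr (d * (1 - Re s - Re \<kappa>) - real (Suc K)) * kap * exp (D * \<bar>Im s\<bar>)"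
      unfolding u c_def .
    also have "\<dots> \<le> B"
      unfolding B_def using lo hi kap_pos
      by (intro mult_right_mono powr_le_powr_abs) auto
    finally show "norm (e j s * (1 + u) powr (p s - of_nat (Suc K))) \<le> B" .
  qed
  also have "\<dots> = V K s * (1 / real n powr (Suc K / d))"
    unfolding nv x_power[OF n1] V_def B_def by simp
  finally have "norm (rem K s j n) \<le> norm (a n / of_nat n powr s) * (V K s * (1 / real n powr (Suc K / d)))"
    unfolding rem_def base_alt v_def c_def norm_mult by (intro mult_left_mono) auto
  also have "\<dots> = V K s * norm (a n / of_nat n powr (s + of_real (Suc K / d)))"
  proof -
    have "norm (of_nat n powr (s + of_real (Suc K / d)) :: complex) = real n powr Re s * real n powr (Suc K / d)"
      by (simp only: norm_of_nat_powr[OF n1] plus_complex.sel Re_complex_of_real powr_add[of "real n"])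
    then show ?thesis unfolding norm_divide norm_of_nat_powr[OF n1] by (simp only:) simp
  qed
  finally show ?thesis .
qed

lemma summable_2: "(\<lambda>n. norm (a n / of_nat n powr of_real 2)) summable_on {1..}"
  by (rule summ) simp

lemma rem_le_2:
  assumes j: "j \<in> J" and n: "n > M" and "Re s + Suc K / d \<ge> 2"
  shows "norm (rem K s j n) \<le> V K s * norm (a n / of_nat n powr of_real 2)"
proof -
  have "norm (rem K s j n) \<le> V K s * norm (a n / of_nat n powr (s + of_real (Suc K / d)))"
    by (rule rem_le[OF j n])
  also have "\<dots> \<le> V K s * norm (a n / of_nat n powr of_real 2)"
    using n assms(3) by (intro mult_left_mono norm_dirichlet_le V_nonneg) auto
  finally show ?thesis .
qed

lemma hol_gbinomial_p: "(\<lambda>s. p s gchoose k) holomorphic_on X"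
  unfolding gbinomial_prod_rev p_def by (intro holomorphic_intros) auto

lemma hol_tail:
  assumes "c + Suc K / d \<ge> 2"
  shows "tail K holomorphic_on {s. Re s > c}"
proof -
  have "(\<lambda>s. \<Sum>\<^sub>\<infinity>n\<in>{M<..}. rem K s j n) holomorphic_on {s. Re s > c}" if j: "j \<in> J" for j
  proof (rule holomorphic_on_infsum)
    show "open {s. Re s > c}" by (rule open_halfspace_Re_gt)
    show "(\<lambda>s. rem K s j n) holomorphic_on {s. Re s > c}" if "n \<in> {M<..}" for n
    proof -
      have "n > 0" using that by auto
      then show ?thesis
        unfolding rem_def e_def by (intro holomorphic_intros hol_gbinomial_p) (auto simp: p_def intro!: holomorphic_intros)
    qed
    fix Y assume Y: "compact Y" "Y \<subseteq> {s. Re s > c}"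
    have "continuous_on Y (V K)"
      unfolding V_def p_def by (intro continuous_intros) auto
    then have "bounded (V K ` Y)" using Y(1) by (intro compact_imp_bounded compact_continuous_image)
    then obtain V0 where V0: "\<And>s. s \<in> Y \<Longrightarrow> V K s \<le> V0"
      unfolding bounded_iff by (metis abs_le_D1 imageI real_norm_def)
    have "norm (rem K s j n) \<le> V0 * norm (a n / of_nat n powr of_real 2)" if "n \<in> {M<..}" "s \<in> Y" for n s
    proof -
      have "norm (rem K s j n) \<le> V K s * norm (a n / of_nat n powr of_real 2)"
        using that Y(2) assms by (intro rem_le_2[OF j]) auto
      also have "\<dots> \<le> V0 * norm (a n / of_nat n powr of_real 2)"
        using V0[OF that(2)] by (intro mult_right_mono) auto
      finally show ?thesis .
    qed
    moreover have "(\<lambda>n. V0 * norm (a n / of_nat n powr of_real 2)) summable_on {M<..}"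
      using summable_on_cmult_right[OF summable_2] by (rule summable_on_subset_banach) auto
    ultimately show "\<exists>B. B summable_on {M<..} \<and> (\<forall>n\<in>{M<..}. \<forall>s\<in>Y. norm (rem K s j n) \<le> B n)"
      by (intro exI[of _ "\<lambda>n. V0 * norm (a n / of_nat n powr of_real 2)"]) auto
  qed
  then show ?thesis unfolding tail_def[abs_def] by (intro holomorphic_intros)
qed

lemma hol_head: "head holomorphic_on X"
  unfolding head_def[abs_def] summand_def e_def p_def by (intro holomorphic_intros) (use I(1) in fastforce)+

lemma hol_S: "f holomorphic_on X \<Longrightarrow> (\<lambda>s. S (f s)) holomorphic_on X"
  unfolding S_def by (intro holomorphic_intros)

lemma hol_middle: "middle K holomorphic_on X"
proof -
  have DM: "(\<lambda>s. DM (s + of_real c)) holomorphic_on X" for c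
    unfolding DM_def by (intro holomorphic_intros) auto
  have H: "(\<lambda>s. H (s + of_real c)) holomorphic_on X" for c
  proof -
    have "(\<lambda>s. s + of_real c) holomorphic_on X" by (intro holomorphic_intros)
    from holomorphic_on_compose_gen[OF this hol_H] show ?thesis by (simp add: o_def)
  qed
  show ?thesis
    unfolding middle_def[abs_def] by (intro holomorphic_intros hol_gbinomial_p hol_S DM H)
qed

lemma e_cis_power:
  "e j s * cis (pi * (1/2 - w j)) ^ k = \<i> ^ k * exp (\<i> * of_real (pi * d * w j) * (1 - (s + of_real (k / d))))"
proof -
  have "cis (pi * (1/2 - w j)) ^ k = cis (pi / 2) ^ k * exp (\<i> * of_real (- (k * pi * w j)))"
    unfolding Complex.DeMoivre cis_conv_exp[symmetric] cis_mult
    by (rule arg_cong[where f = cis]) (simp add: algebra_simps)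
  then have c: "cis (pi * (1/2 - w j)) ^ k = \<i> ^ k * exp (\<i> * of_real (- (k * pi * w j)))"
    by (simp only: cis_pi_half)
  have "e j s * cis (pi * (1/2 - w j)) ^ k =
      \<i> ^ k * exp (\<i> * of_real (pi * d * w j) * (1 - s) + \<i> * of_real (- (k * pi * w j)))"
    unfolding c e_def exp_add by (simp only: mult_ac)
  also have "\<i> * of_real (pi * d * w j) * (1 - s) + \<i> * of_real (- (k * pi * w j)) =
      \<i> * of_real (pi * d * w j) * (1 - (s + of_real (k / d)))"
    using d by (simp add: algebra_simps)
  finally show ?thesis .
qed

text \<open>Everything converges absolutely for \<open>Re s > 1\<close>, so the sum over
  \<open>n > M\<close> splits into \<open>K + 1\<close> Dirichlet tails and the remainder before the
  finite sums over \<open>j\<close> and \<open>k\<close> are exchanged.\<close>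

lemma series_decomposition:
  assumes s: "Re s > 1"
  shows "series s = head s + middle K s + tail K s"
proof -
  define q where "q = (\<lambda>k::nat. s + of_real (k / d))"
  have Re_q: "Re (q k) > 1" for k
  proof -
    have "real k / d \<ge> 0" using d by simp
    then show ?thesis using s by (simp add: q_def)
  qed
  define T where "T = (\<lambda>u. \<Sum>\<^sub>\<infinity>n\<in>{M<..}. a n / of_nat n powr u)"
  have sumT: "(\<lambda>n. a n / of_nat n powr u) summable_on {M<..}" if "Re u > 1" for u
    using abs_summable_summable[OF summ[OF that]] by (rule summable_on_subset_banach) auto
  have T_eq: "T u = (\<Sum>\<^sub>\<infinity>n\<in>{1..}. a n / of_nat n powr u) - DM u" if "Re u > 1" for u
  proof -
    have "{1..} = {1..M} \<union> {M<..}" by auto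
    then have "(\<Sum>\<^sub>\<infinity>n\<in>{1..}. a n / of_nat n powr u) =
        (\<Sum>\<^sub>\<infinity>n\<in>{1..M}. a n / of_nat n powr u) + (\<Sum>\<^sub>\<infinity>n\<in>{M<..}. a n / of_nat n powr u)"
      using sumT[OF that] by (simp only:) (intro infsum_Un_disjoint, auto)
    then show ?thesis by (simp add: T_def DM_def)
  qed
  have main: "(\<Sum>\<^sub>\<infinity>n\<in>I j. e j s * summand s j n) = (\<Sum>n\<in>I j \<inter> {..M}. e j s * summand s j n) +
     (\<Sum>k\<le>K. (p s gchoose k) * of_real (\<nu> powr (k / d)) * T (q k) * (e j s * cis (pi * (1/2 - w j)) ^ k)) +
     (\<Sum>\<^sub>\<infinity>n\<in>{M<..}. rem K s j n)" if j: "j \<in> J" for j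
  proof -
    define c where "c = cis (pi * (1/2 - w j))"
    have sI: "(\<lambda>n. e j s * summand s j n) summable_on I j"
      using abs_summable_e_summand[OF j s] by (rule abs_summable_summable)
    have I_eq: "I j = (I j \<inter> {..M}) \<union> {M<..}" using M(2)[OF _ j] by auto
    have sM: "(\<lambda>n. e j s * summand s j n) summable_on {M<..}"
      using sI by (rule summable_on_subset_banach) (use M(2)[OF _ j] in auto)
    have "(\<Sum>\<^sub>\<infinity>n\<in>(I j \<inter> {..M}) \<union> {M<..}. e j s * summand s j n) =
        (\<Sum>\<^sub>\<infinity>n\<in>I j \<inter> {..M}. e j s * summand s j n) + (\<Sum>\<^sub>\<infinity>n\<in>{M<..}. e j s * summand s j n)"
      by (rule infsum_Un_disjoint) (auto intro: sM)
    then have 1: "(\<Sum>\<^sub>\<infinity>n\<in>I j. e j s * summand s j n) =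
        (\<Sum>n\<in>I j \<inter> {..M}. e j s * summand s j n) + (\<Sum>\<^sub>\<infinity>n\<in>{M<..}. e j s * summand s j n)"
      unfolding I_eq[symmetric] by simp
    \<comment> \<open>The \<open>k\<close>-th Taylor term, with \<open>x n ^ k\<close> absorbed into
      the exponent of \<open>n\<close>.\<close>
    define h where "h = (\<lambda>k n. (p s gchoose k) * of_real (\<nu> powr (k / d)) * (e j s * c ^ k) * (a n / of_nat n powr q k))"
    have split: "e j s * summand s j n = (\<Sum>k\<le>K. h k n) + rem K s j n" if n: "n \<in> {M<..}" for n
    proof -
      have n1: "n \<ge> 1" using n by auto
      have "h k n = a n / of_nat n powr s * (e j s * ((p s gchoose k) * (of_real (x n) * c) ^ k))" for k
      proof -
        have "(of_real (x n) :: complex) ^ k = of_real (\<nu> powr (k / d)) / of_nat n powr of_real (k / d)"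
          unfolding of_real_power[symmetric] x_power[OF n1] of_real_divide
          by (simp add: powr_of_real[symmetric])
        moreover have "of_nat n powr q k = (of_nat n powr s * of_nat n powr of_real (k / d) :: complex)"
          by (simp add: q_def powr_add)
        ultimately show ?thesis by (simp add: h_def power_mult_distrib)
      qed
      then have "(\<Sum>k\<le>K. h k n) = a n / of_nat n powr s * (e j s * (\<Sum>k\<le>K. (p s gchoose k) * (of_real (x n) * c) ^ k))"
        by (simp only: sum_distrib_left)
      then show ?thesis
        by (simp add: rem_def summand_def c_def algebra_simps)
    qed
    have sh: "(\<lambda>n. h k n) summable_on {M<..}" for k
      unfolding h_def using sumT[OF Re_q] by (rule summable_on_cmult_right)
    have hs: "((\<lambda>n. \<Sum>k\<le>K. h k n) has_sum (\<Sum>k\<le>K. \<Sum>\<^sub>\<infinity>n\<in>{M<..}. h k n)) {M<..}"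
      by (intro has_sum_finite_sum has_sum_infsum sh)
    then have shs: "(\<lambda>n. \<Sum>k\<le>K. h k n) summable_on {M<..}" by (auto simp: summable_on_def)
    have sr: "(\<lambda>n. rem K s j n) summable_on {M<..}"
    proof -
      have "(\<lambda>n. e j s * summand s j n + (-1) * (\<Sum>k\<le>K. h k n)) summable_on {M<..}"
        by (intro summable_on_add summable_on_cmult_right sM shs)
      also have "?this \<longleftrightarrow> ?thesis"
        by (rule summable_on_cong) (use split in simp)
      finally show ?thesis .
    qed
    have "(\<Sum>\<^sub>\<infinity>n\<in>{M<..}. e j s * summand s j n) = (\<Sum>\<^sub>\<infinity>n\<in>{M<..}. (\<Sum>k\<le>K. h k n) + rem K s j n)"
      using split by (rule infsum_cong)
    also have "\<dots> = (\<Sum>\<^sub>\<infinity>n\<in>{M<..}. \<Sum>k\<le>K. h k n) + (\<Sum>\<^sub>\<infinity>n\<in>{M<..}. rem K s j n)"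
      by (rule infsum_add[OF shs sr])
    also have "(\<Sum>\<^sub>\<infinity>n\<in>{M<..}. \<Sum>k\<le>K. h k n) = (\<Sum>k\<le>K. \<Sum>\<^sub>\<infinity>n\<in>{M<..}. h k n)"
      using hs by (rule infsumI)
    also have "\<dots> = (\<Sum>k\<le>K. (p s gchoose k) * of_real (\<nu> powr (k / d)) * T (q k) * (e j s * c ^ k))"
      unfolding h_def infsum_cmult_right' T_def by (simp only: mult_ac)
    finally show ?thesis unfolding 1 c_def by simp
  qed
  \<comment> \<open>For fixed \<open>k\<close> the sum over \<open>j\<close> of \<open>b j\<close>
    times the shifted exponential is \<open>S (1 - q k)\<close>, and \<open>T\<close> is the full
    Dirichlet series minus \<open>DM\<close>.\<close>
  have mid: "(\<Sum>j\<in>J. b j * (\<Sum>k\<le>K. (p s gchoose k) * of_real (\<nu> powr (k / d)) * T (q k) * (e j s * cis (pi * (1/2 - w j)) ^ k)))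
      = middle K s"
  proof -
    have "(\<Sum>j\<in>J. b j * (\<Sum>k\<le>K. (p s gchoose k) * of_real (\<nu> powr (k / d)) * T (q k) * (e j s * cis (pi * (1/2 - w j)) ^ k)))
      = (\<Sum>k\<le>K. \<Sum>j\<in>J. b j * ((p s gchoose k) * of_real (\<nu> powr (k / d)) * T (q k) * (e j s * cis (pi * (1/2 - w j)) ^ k)))"
      unfolding sum_distrib_left by (rule sum.swap)
    also have "\<dots> = (\<Sum>k\<le>K. (p s gchoose k) * (\<i> ^ k * of_real (\<nu> powr (k / d)) * (S (1 - q k) * T (q k))))"
    proof (rule sum.cong[OF refl])
      fix k
      show "(\<Sum>j\<in>J. b j * ((p s gchoose k) * of_real (\<nu> powr (k / d)) * T (q k) * (e j s * cis (pi * (1/2 - w j)) ^ k)))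
        = (p s gchoose k) * (\<i> ^ k * of_real (\<nu> powr (k / d)) * (S (1 - q k) * T (q k)))"
        unfolding e_cis_power S_def q_def sum_distrib_left sum_distrib_right
        by (rule sum.cong[OF refl]) (simp only: mult_ac)
    qed
    also have "\<dots> = middle K s"
      unfolding middle_def q_def
      by (rule sum.cong[OF refl])
         (simp only: T_eq[OF Re_q, unfolded q_def] H_eq[OF Re_q, unfolded q_def] right_diff_distrib)
    finally show ?thesis .
  qed
  have "series s = (\<Sum>j\<in>J. b j * (\<Sum>n\<in>I j \<inter> {..M}. e j s * summand s j n) +
     b j * (\<Sum>k\<le>K. (p s gchoose k) * of_real (\<nu> powr (k / d)) * T (q k) * (e j s * cis (pi * (1/2 - w j)) ^ k)) +
     b j * (\<Sum>\<^sub>\<infinity>n\<in>{M<..}. rem K s j n))"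
    unfolding series_eq by (rule sum.cong[OF refl]) (simp only: main distrib_left)
  also have "\<dots> = head s + middle K s + tail K s"
    unfolding sum.distrib mid by (simp only: head_def tail_def)
  finally show ?thesis .
qed

lemma W_le:
  assumes "\<bar>Re s\<bar> \<le> Y"
  shows "W s \<le> \<Theta> powr (d * (1 + Y + \<bar>Re \<kappa>\<bar>)) * kap * exp (D * \<bar>Im s\<bar>)"
proof -
  have "\<bar>1 - Re s - Re \<kappa>\<bar> \<le> 1 + Y + \<bar>Re \<kappa>\<bar>" using assms by linarith
  then have "\<bar>d * (1 - Re s - Re \<kappa>)\<bar> \<le> d * (1 + Y + \<bar>Re \<kappa>\<bar>)" using d by (simp add: abs_mult)
  then have "\<Theta> powr \<bar>d * (1 - Re s - Re \<kappa>)\<bar> \<le> \<Theta> powr (d * (1 + Y + \<bar>Re \<kappa>\<bar>))"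
    using \<Theta>(1) by (intro powr_mono) auto
  then show ?thesis unfolding W_def using kap_pos by (intro mult_right_mono) auto
qed

lemma head_growth:
  assumes X: "\<And>s. s \<in> X \<Longrightarrow> \<bar>Re s\<bar> \<le> Y"
  shows "vertical_growth X D 0 head"
  unfolding head_def[abs_def]
proof (intro vertical_growth_sum vertical_growth_cmult)
  fix j n assume j: "j \<in> J" and "n \<in> I j \<inter> {..M}"
  then have n: "n \<in> I j" and n1: "n \<ge> 1" using I(1)[OF j] by auto
  show "vertical_growth X D 0 (\<lambda>s. e j s * summand s j n)"
    unfolding vertical_growth_def
  proof (intro exI ballI)
    fix s assume s: "s \<in> X"
    have "norm (e j s * summand s j n) \<le> norm (a n / of_nat n powr s) * W s"
      by (rule norm_summand_le[OF j n])
    also have "\<dots> \<le> norm (a n / of_nat n powr of_real (-Y)) *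
        (\<Theta> powr (d * (1 + Y + \<bar>Re \<kappa>\<bar>)) * kap * exp (D * \<bar>Im s\<bar>))"
      using X[OF s] n1 kap_pos by (intro mult_mono norm_dirichlet_le W_le) (auto simp: W_def)
    finally show "norm (e j s * summand s j n) \<le>
        (norm (a n / of_nat n powr of_real (-Y)) * \<Theta> powr (d * (1 + Y + \<bar>Re \<kappa>\<bar>)) * kap) *
        exp (D * \<bar>Im s\<bar>) * (1 + \<bar>Im s\<bar>) ^ 0"
      by (simp only: power_0 mult_1_right mult_ac)
  qed
qed

lemma S_growth: "vertical_growth X D 0 (\<lambda>s. S (1 - (s + of_real c)))"
  unfolding S_def D_def by (rule exponential_sum_growth) (use d w in auto)

lemma DM_growth:
  assumes X: "\<And>s. s \<in> X \<Longrightarrow> - Y \<le> Re s" and "c \<ge> 0"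
  shows "vertical_growth X 0 0 (\<lambda>s. DM (s + of_real c))"
  unfolding DM_def
proof (intro vertical_growth_sum)
  fix n assume "n \<in> {1..M}"
  then have "norm (a n / of_nat n powr (s + of_real c)) \<le> norm (a n / of_nat n powr of_real (-Y))" if "s \<in> X" for s
    using X[OF that] \<open>c \<ge> 0\<close> by (intro norm_dirichlet_le) auto
  then show "vertical_growth X 0 0 (\<lambda>s. a n / of_nat n powr (s + of_real c))"
    unfolding vertical_growth_def by (intro exI[of _ "norm (a n / of_nat n powr of_real (-Y))"]) simp
qed

lemma norm_p_le:
  assumes "\<bar>Re s\<bar> \<le> Y"
  shows "norm (p s) \<le> d * (2 + Y + norm \<kappa>) * (1 + \<bar>Im s\<bar>)"
proof -
  have "norm (1 - s - \<kappa>) \<le> 1 + norm s + norm \<kappa>"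
    using norm_triangle_ineq4[of "1 - s" \<kappa>] norm_triangle_ineq4[of 1 s] by simp
  also have "\<dots> \<le> 1 + (Y + \<bar>Im s\<bar>) + norm \<kappa>" using cmod_le[of s] assms by simp
  also have "\<dots> \<le> (2 + Y + norm \<kappa>) * (1 + \<bar>Im s\<bar>)"
  proof -
    have "0 \<le> (1 + Y + norm \<kappa>) * \<bar>Im s\<bar>" using assms by (intro mult_nonneg_nonneg add_nonneg_nonneg) auto
    moreover have "(2 + Y + norm \<kappa>) * (1 + \<bar>Im s\<bar>) = 2 + Y + norm \<kappa> + \<bar>Im s\<bar> + (1 + Y + norm \<kappa>) * \<bar>Im s\<bar>"
      by (simp add: algebra_simps)
    ultimately show ?thesis by linarith
  qed
  finally have "d * norm (1 - s - \<kappa>) \<le> d * ((2 + Y + norm \<kappa>) * (1 + \<bar>Im s\<bar>))"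
    using d by (intro mult_left_mono) auto
  then show ?thesis using d by (simp add: p_def norm_mult)
qed

lemma middle_growth:
  fixes A :: nat
  assumes X: "\<And>s. s \<in> X \<Longrightarrow> - real A \<le> Re s \<and> Re s \<le> 2 \<and> 1 \<le> \<bar>Im s\<bar>"
  shows "vertical_growth X D (K + m (A + 2 + K)) (middle K)"
  unfolding middle_def[abs_def]
proof (rule vertical_growth_sum)
  fix k assume "k \<in> {..K}"
  then have k: "k \<le> K" by simp
  \<comment> \<open>Here \<open>d \<ge> 1\<close> keeps every shift \<open>k / d\<close> at most
    \<open>K\<close>, inside the strip where the exponent of \<open>H\<close> is
    \<open>m (A + 2 + K)\<close>.\<close>
  have kd: "0 \<le> real k / d" "real k / d \<le> real K"
    using d k by (auto simp: divide_le_eq mult_le_cancel_left1 intro: order_trans[of _ "real K"])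
  have H: "vertical_growth X D (m (A + 2 + K)) (\<lambda>s. H (s + of_real (k / d)))"
    by (rule vertical_growth_shift[OF H_growth]) (use X kd in \<open>force simp: abs_le_iff\<close>)
  have "vertical_growth X (D + 0) (0 + 0) (\<lambda>s. S (1 - (s + of_real (k / d))) * DM (s + of_real (k / d)))"
    by (rule vertical_growth_mult[OF S_growth DM_growth[of X "real A"]]) (use X kd in auto)
  then have SD0: "vertical_growth X D 0 (\<lambda>s. S (1 - (s + of_real (k / d))) * DM (s + of_real (k / d)))"
    by (simp only: add_0_right)
  have SD: "vertical_growth X D (m (A + 2 + K)) (\<lambda>s. (-1) * (S (1 - (s + of_real (k / d))) * DM (s + of_real (k / d))))"
    by (rule vertical_growth_cmult, rule vertical_growth_mono[OF SD0]) simp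
  have gb: "vertical_growth X 0 k (\<lambda>s. p s gchoose k)"
    by (rule vertical_growth_gbinomial[OF norm_p_le[of _ "real A + 2"]]) (use X in force)
  have "vertical_growth X (0 + D) (k + m (A + 2 + K)) (\<lambda>s. (p s gchoose k) * (\<i> ^ k * of_real (\<nu> powr (k / d)) *
     (H (s + of_real (k / d)) + (-1) * (S (1 - (s + of_real (k / d))) * DM (s + of_real (k / d))))))"
    by (intro vertical_growth_mult[OF gb] vertical_growth_cmult vertical_growth_add[OF H SD])
  then have "vertical_growth X D (k + m (A + 2 + K)) (\<lambda>s. (p s gchoose k) * (\<i> ^ k * of_real (\<nu> powr (k / d)) *
     (H (s + of_real (k / d)) - S (1 - (s + of_real (k / d))) * DM (s + of_real (k / d)))))"
    by simp
  then show "vertical_growth X D (K + m (A + 2 + K)) (\<lambda>s. (p s gchoose k) * (\<i> ^ k * of_real (\<nu> powr (k / d)) *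
     (H (s + of_real (k / d)) - S (1 - (s + of_real (k / d))) * DM (s + of_real (k / d)))))"
    by (rule vertical_growth_mono) (use k in auto)
qed

text \<open>In a bounded strip only the factor \<open>(norm (p s) + Suc K) ^ Suc K\<close> of
  \<open>V\<close> grows polynomially with the height; the others are
  \<open>exp (D * \<bar>Im s\<bar>)\<close> and bounded quantities.\<close>

lemma tail_growth:
  assumes X: "\<And>s. s \<in> X \<Longrightarrow> \<bar>Re s\<bar> \<le> Y \<and> Re s + Suc K / d \<ge> 2"
  shows "vertical_growth X D (Suc K) (tail K)"
  unfolding tail_def[abs_def]
proof (intro vertical_growth_sum vertical_growth_cmult)
  fix j assume j: "j \<in> J"
  define Z where "Z = (\<Sum>\<^sub>\<infinity>n\<in>{M<..}. norm (a n / of_nat n powr of_real 2))"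
  have sZ: "(\<lambda>n. norm (a n / of_nat n powr of_real 2)) summable_on {M<..}"
    using summable_2 by (rule summable_on_subset_banach) auto
  have Z: "Z \<ge> 0" unfolding Z_def by (intro infsum_nonneg) auto
  define c1 where "c1 = d * (2 + Y + norm \<kappa>) + real (Suc K)"
  define c2 where "c2 = 2 powr (d * (1 + Y + \<bar>Re \<kappa>\<bar>) + real (Suc K)) * kap"
  show "vertical_growth X D (Suc K) (\<lambda>s. \<Sum>\<^sub>\<infinity>n\<in>{M<..}. rem K s j n)"
    unfolding vertical_growth_def
  proof (intro exI ballI)
    fix s assume "s \<in> X"
    then have s: "\<bar>Re s\<bar> \<le> Y" "Re s + Suc K / d \<ge> 2" using X by auto
    have bd: "norm (rem K s j n) \<le> V K s * norm (a n / of_nat n powr of_real 2)" if "n \<in> {M<..}" for n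
      using that by (intro rem_le_2[OF j _ s(2)]) auto
    have sV: "(\<lambda>n. V K s * norm (a n / of_nat n powr of_real 2)) summable_on {M<..}"
      using sZ by (rule summable_on_cmult_right)
    have sr: "(\<lambda>n. norm (rem K s j n)) summable_on {M<..}"
      by (rule Infinite_Sum.abs_summable_on_comparison_test'[OF sV bd])
    have "norm (\<Sum>\<^sub>\<infinity>n\<in>{M<..}. rem K s j n) \<le> (\<Sum>\<^sub>\<infinity>n\<in>{M<..}. norm (rem K s j n))"
      by (rule norm_infsum_bound[OF sr])
    also have "\<dots> \<le> (\<Sum>\<^sub>\<infinity>n\<in>{M<..}. V K s * norm (a n / of_nat n powr of_real 2))"
      by (rule infsum_mono[OF sr sV bd])
    also have "\<dots> = V K s * Z" unfolding Z_def by (rule infsum_cmult_right')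
    also have "\<dots> \<le> ((c1 * (1 + \<bar>Im s\<bar>)) ^ Suc K * (c2 * exp (D * \<bar>Im s\<bar>)) * \<nu> powr (Suc K / d)) * Z"
    proof -
      have "real (Suc K) * 1 \<le> real (Suc K) * (1 + \<bar>Im s\<bar>)" by (intro mult_left_mono) auto
      then have "real (Suc K) \<le> real (Suc K) * (1 + \<bar>Im s\<bar>)" by (simp only: mult_1_right)
      from add_mono[OF norm_p_le[OF s(1)] this]
      have "norm (p s) + real (Suc K) \<le> c1 * (1 + \<bar>Im s\<bar>)"
        by (simp only: c1_def distrib_right)
      then have f1: "(norm (p s) + real (Suc K)) ^ Suc K \<le> (c1 * (1 + \<bar>Im s\<bar>)) ^ Suc K"
        by (intro power_mono) auto
      have f2: "2 powr \<bar>d * (1 - Re s - Re \<kappa>) - real (Suc K)\<bar> * kap \<le> c2"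
      proof -
        have "\<bar>1 - Re s - Re \<kappa>\<bar> \<le> 1 + Y + \<bar>Re \<kappa>\<bar>" using s by linarith
        then have "\<bar>d * (1 - Re s - Re \<kappa>)\<bar> \<le> d * (1 + Y + \<bar>Re \<kappa>\<bar>)" using d by (simp add: abs_mult)
        then have "\<bar>d * (1 - Re s - Re \<kappa>) - real (Suc K)\<bar> \<le> d * (1 + Y + \<bar>Re \<kappa>\<bar>) + real (Suc K)" by linarith
        then show ?thesis unfolding c2_def using kap_pos by (intro mult_right_mono powr_mono) auto
      qed
      have f0: "0 \<le> (norm (p s) + real (Suc K)) ^ Suc K" by (intro zero_le_power) auto
      show ?thesis unfolding V_def
        by (rule mult_right_mono[OF mult_right_mono[OF mult_mono[OF f1 mult_right_mono[OF f2]]]])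
           (use Z kap_pos order_trans[OF f0 f1] in auto)
    qed
    finally show "norm (\<Sum>\<^sub>\<infinity>n\<in>{M<..}. rem K s j n) \<le>
        (c1 ^ Suc K * c2 * \<nu> powr (Suc K / d) * Z) * exp (D * \<bar>Im s\<bar>) * (1 + \<bar>Im s\<bar>) ^ Suc K"
      by (simp only: power_mult_distrib mult_ac)
  qed
qed

lemma taylor_order: "- real A + Suc (taylor_order d A) / d \<ge> 2"
proof -
  have "d * (real A + 2) \<le> real (Suc (taylor_order d A))" unfolding taylor_order_def by linarith
  then have "real A + 2 \<le> Suc (taylor_order d A) / d" using d by (simp add: pos_le_divide_eq mult.commute)
  then show ?thesis by linarith
qed

lemma entire_continuation:
  "\<exists>G. G holomorphic_on UNIV \<and> (\<forall>s. Re s > 1 \<longrightarrow> G s = series s) \<and>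
    (\<forall>A. vertical_growth {s. - real A \<le> Re s \<and> Re s \<le> 2 \<and> 1 \<le> \<bar>Im s\<bar>} D (growth_exponent d m A) G)"
proof -
  define f where "f = (\<lambda>A s. head s + middle (taylor_order d A) s + tail (taylor_order d A) s)"
  have "\<exists>G. G holomorphic_on UNIV \<and> (\<forall>A s. Re s > - real A \<longrightarrow> G s = f A s)"
  proof (rule entire_from_half_planes[where g = series])
    show "f A holomorphic_on {s. Re s > - real A}" for A
      unfolding f_def by (intro holomorphic_intros hol_head hol_middle hol_tail taylor_order)
    show "f A s = series s" if "Re s > 1" for A s
      unfolding f_def series_decomposition[OF that, of "taylor_order d A"] ..
  qed
  then obtain G where G: "G holomorphic_on UNIV" "\<And>A s. Re s > - real A \<Longrightarrow> G s = f A s" by blast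
  have "G s = series s" if "Re s > 1" for s
    using G(2)[of 0 s] that series_decomposition[OF that, of "taylor_order d 0"] by (simp add: f_def)
  moreover have "vertical_growth {s. - real A \<le> Re s \<and> Re s \<le> 2 \<and> 1 \<le> \<bar>Im s\<bar>} D (growth_exponent d m A) G" for A
  proof -
    define X where "X = {s. - real A \<le> Re s \<and> Re s \<le> 2 \<and> 1 \<le> \<bar>Im s\<bar>}"
    \<comment> \<open>The order for \<open>Suc A\<close>, because the open half-plane for
      \<open>A\<close> misses the line \<open>Re s = - A\<close>.\<close>
    define K where "K = taylor_order d (Suc A)"
    have Xb: "\<bar>Re s\<bar> \<le> real A + 2" if "s \<in> X" for s using that by (auto simp: X_def abs_le_iff)
    have Xt: "Re s + Suc K / d \<ge> 2" if "s \<in> X" for s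
    proof -
      have "- real A \<le> Re s" using that by (simp add: X_def)
      then show ?thesis using taylor_order[of "Suc A"] unfolding K_def of_nat_Suc[of A] by linarith
    qed
    have ge: "growth_exponent d m A = Suc K + m (A + 2 + K)" by (simp add: growth_exponent_def K_def Let_def)
    have "vertical_growth X D (growth_exponent d m A) head"
      by (rule vertical_growth_mono[OF head_growth[OF Xb]]) auto
    moreover have "vertical_growth X D (growth_exponent d m A) (middle K)"
      by (rule vertical_growth_mono[OF middle_growth[of X A]]) (auto simp: X_def ge)
    moreover have "vertical_growth X D (growth_exponent d m A) (tail K)"
      by (rule vertical_growth_mono[OF tail_growth[of X "real A + 2"]]) (use Xb Xt ge in auto)
    ultimately have "vertical_growth X D (growth_exponent d m A) (f (Suc A))"
      unfolding f_def K_def by (intro vertical_growth_add)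
    then show ?thesis unfolding X_def
      by (rule vertical_growth_cong) (use G(2)[of "Suc A"] in auto)
  qed
  ultimately show ?thesis using G(1) by blast
qed

end

subsection \<open>Non-vanishing\<close>

text \<open>Inserting 1 gives the minimum a value for empty \<open>T\<close> and yields
  \<open>g \<le> 1\<close>.\<close>

lemma finite_uniform_gap:
  fixes f :: "'i \<Rightarrow> real"
  assumes "finite T" "\<And>i. i \<in> T \<Longrightarrow> f i > 0"
  shows "\<exists>g>0. g \<le> 1 \<and> (\<forall>i\<in>T. g \<le> f i)"
  using assms
  by (intro exI[of _ "Min (insert 1 (f ` T))"]) (auto intro: Min_le)

text \<open>
  Along the slightly tilted ray \<open>s = 2 + y (1 + i \<tau>)\<close> a single term of the series dominates: among the
  exponents of minimal real part the tilt singles out the one of largest imaginary part.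
\<close>

lemma exponential_series_nonzero:
  fixes c L :: "'i \<Rightarrow> complex"
  assumes inj: "inj_on L X" and B: "\<And>i. i \<in> X \<Longrightarrow> \<bar>Im (L i)\<bar> \<le> B"
    and fin: "\<And>R. finite {i\<in>X. Re (L i) \<le> R}"
    and summ: "(\<lambda>i. norm (c i * exp (- 2 * L i))) summable_on X"
    and nz: "i1 \<in> X" "c i1 \<noteq> 0"
  shows "\<exists>s. Re s > 1 \<and> (\<Sum>\<^sub>\<infinity>i\<in>X. c i * exp (- s * L i)) \<noteq> 0"
proof -
  define X' where "X' = {i\<in>X. c i \<noteq> 0}"
  have fin': "finite {i\<in>X'. Re (L i) \<le> R}" for R
    by (rule finite_subset[OF _ fin[of R]]) (auto simp: X'_def)
  define P where "P = {i\<in>X'. Re (L i) \<le> Re (L i1)}"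
  have P: "finite P" "i1 \<in> P" using fin' nz by (auto simp: P_def X'_def)
  define x0 where "x0 = Min ((\<lambda>i. Re (L i)) ` P)"
  have x0_le: "x0 \<le> Re (L i)" if "i \<in> X'" for i
  proof (cases "i \<in> P")
    case True
    then show ?thesis using P by (auto simp: x0_def)
  next
    case False
    have "x0 \<le> Re (L i1)" using P by (auto simp: x0_def)
    then show ?thesis using False that by (simp add: P_def)
  qed
  define E where "E = {i\<in>X'. Re (L i) = x0}"
  have finE: "finite E" by (rule finite_subset[OF _ fin'[of x0]]) (auto simp: E_def)
  have "x0 \<in> (\<lambda>i. Re (L i)) ` P" unfolding x0_def using P by (intro Min_in) auto
  then have "E \<noteq> {}" by (auto simp: E_def P_def)
  then have "Max ((\<lambda>i. Im (L i)) ` E) \<in> (\<lambda>i. Im (L i)) ` E" using finE by (intro Max_in) auto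
  then obtain i0 where i0: "i0 \<in> E" "Im (L i0) = Max ((\<lambda>i. Im (L i)) ` E)" by auto
  have i0X: "i0 \<in> X" "c i0 \<noteq> 0" "Re (L i0) = x0" using i0 by (auto simp: E_def X'_def)
  have Im_less: "Im (L i) < Im (L i0)" if "i \<in> E" "i \<noteq> i0" for i
  proof -
    have "Im (L i) \<le> Im (L i0)" unfolding i0(2) using finE that by (intro Max_ge) auto
    moreover have "L i \<noteq> L i0" using inj that i0 by (auto simp: E_def X'_def inj_on_def)
    moreover have "Re (L i) = Re (L i0)" using that i0 by (simp add: E_def)
    ultimately show ?thesis by (auto simp: complex_eq_iff)
  qed
  \<comment> \<open>Only finitely many exponents have real part at most \<open>x0 + 1\<close>; for
    all others \<open>g \<le> 1\<close> suffices.\<close>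
  obtain g where g: "g > 0" "g \<le> 1"
    "\<And>i. i \<in> {i\<in>X'. Re (L i) \<le> x0 + 1} - E \<Longrightarrow> g \<le> Re (L i) - x0"
  proof -
    have "\<exists>g>0. g \<le> 1 \<and> (\<forall>i\<in>{i\<in>X'. Re (L i) \<le> x0 + 1} - E. g \<le> Re (L i) - x0)"
    proof (rule finite_uniform_gap)
      show "0 < Re (L i) - x0" if "i \<in> {i\<in>X'. Re (L i) \<le> x0 + 1} - E" for i
        using that x0_le[of i] by (auto simp: E_def)
    qed (use fin' in auto)
    then show ?thesis using that by blast
  qed
  have gap: "g \<le> Re (L i) - x0" if "i \<in> X'" "i \<notin> E" for i
    using g(2) g(3)[of i] that by (cases "Re (L i) \<le> x0 + 1") auto
  obtain h where h: "h > 0" "\<And>i. i \<in> E - {i0} \<Longrightarrow> h \<le> Im (L i0) - Im (L i)"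
  proof -
    have "\<exists>g>0. g \<le> 1 \<and> (\<forall>i\<in>E - {i0}. g \<le> Im (L i0) - Im (L i))"
      by (rule finite_uniform_gap) (use finE Im_less in auto)
    then show ?thesis using that by blast
  qed
  \<comment> \<open>Imaginary parts differ by at most \<open>2 * (\<bar>B\<bar> + 1)\<close>, so
    this tilt uses up at most \<open>g / 2\<close> of the gap \<open>g\<close>, while within
    \<open>E\<close> it still separates by \<open>\<tau> * h\<close>.\<close>
  define \<tau> where "\<tau> = g / (4 * (\<bar>B\<bar> + 1))"
  have \<tau>: "\<tau> > 0" using g by (simp add: \<tau>_def)
  define k where "k = min (g / 2) (\<tau> * h)"
  have k: "k > 0" using g h \<tau> by (simp add: k_def)
  have sep: "k \<le> (Re (L i) - Re (L i0)) - \<tau> * (Im (L i) - Im (L i0))" if i: "i \<in> X'" "i \<noteq> i0" for i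
  proof (cases "i \<in> E")
    case True
    have "k \<le> \<tau> * h" by (simp add: k_def)
    also have "\<dots> \<le> \<tau> * (Im (L i0) - Im (L i))" using \<tau> h(2)[of i] True i by (intro mult_left_mono) auto
    finally show ?thesis using True i0X by (simp add: E_def algebra_simps)
  next
    case False
    have iX: "i \<in> X" using i by (simp add: X'_def)
    have "Im (L i) + - Im (L i0) \<le> \<bar>B\<bar> + \<bar>B\<bar>"
      using abs_le_D1[OF B[OF iX]] abs_le_D2[OF B[OF i0X(1)]] abs_ge_self[of B]
      by (intro add_mono) (rule order_trans, assumption+)+
    then have "Im (L i) - Im (L i0) \<le> 2 * (\<bar>B\<bar> + 1)" by simp
    then have "\<tau> * (Im (L i) - Im (L i0)) \<le> \<tau> * (2 * (\<bar>B\<bar> + 1))" using \<tau> by (intro mult_left_mono) auto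
    also have "\<dots> = g / 2" by (simp add: \<tau>_def field_simps)
    finally show ?thesis using gap[OF i(1) False] i0X by (simp add: k_def)
  qed
  define T where "T = (\<Sum>\<^sub>\<infinity>i\<in>X. norm (c i * exp (- 2 * L i)))"
  define \<delta> where "\<delta> = norm (c i0 * exp (- 2 * L i0))"
  have \<delta>: "\<delta> > 0" using i0X by (simp add: \<delta>_def)
  have T0: "T \<ge> 0" unfolding T_def by (intro infsum_nonneg) auto
  \<comment> \<open>Gives \<open>exp (y * k) \<ge> 1 + T / \<delta>\<close>, so that all other terms
    together stay below \<delta>.\<close>
  define y where "y = T / \<delta> / k"
  have y0: "y \<ge> 0" using T0 \<delta> k by (simp add: y_def)
  have small: "T * exp (- (y * k)) < \<delta>"
  proof -
    have "y * k = T / \<delta>" using k by (simp add: y_def)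
    then have "1 + T / \<delta> \<le> exp (y * k)" using exp_ge_add_one_self[of "y * k"] by simp
    then have "T / \<delta> < exp (y * k)" by linarith
    then show ?thesis using \<delta> by (simp add: exp_minus field_simps)
  qed
  define q where "q = of_real y * (1 + \<i> * of_real \<tau>)"
  define s where "s = 2 + q"
  have Re_s: "Re s > 1" using y0 by (simp add: s_def q_def)
  \<comment> \<open>Rescaled by \<open>exp (q * L i0)\<close>, so that the leading term keeps the
    norm \<delta> along the whole ray.\<close>
  define u where "u = (\<lambda>i. c i * exp (- 2 * L i) * exp (- q * (L i - L i0)))"
  have u_le: "norm (u i) \<le> norm (c i * exp (- 2 * L i)) * exp (- (y * k))" if i: "i \<in> X - {i0}" for i
  proof (cases "c i = 0")
    case True
    then show ?thesis by (simp add: u_def)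
  next
    case False
    have "norm (exp (- q * (L i - L i0))) = exp (- (y * ((Re (L i) - Re (L i0)) - \<tau> * (Im (L i) - Im (L i0)))))"
      by (simp add: q_def algebra_simps)
    also have "\<dots> \<le> exp (- (y * k))"
      using sep[of i] False i y0 by (auto simp: X'_def intro!: mult_left_mono)
    finally show ?thesis unfolding u_def norm_mult by (intro mult_left_mono) auto
  qed
  have s1: "(\<lambda>i. norm (c i * exp (- 2 * L i)) * exp (- (y * k))) summable_on X - {i0}"
    using summable_on_subset_banach[OF summ, of "X - {i0}"] by (intro summable_on_cmult_left) auto
  have s2: "(\<lambda>i. norm (u i)) summable_on X - {i0}"
    by (rule Infinite_Sum.abs_summable_on_comparison_test'[OF s1 u_le])
  have "norm (\<Sum>\<^sub>\<infinity>i\<in>X - {i0}. u i) \<le> (\<Sum>\<^sub>\<infinity>i\<in>X - {i0}. norm (u i))"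
    by (rule norm_infsum_bound[OF s2])
  also have "\<dots> \<le> (\<Sum>\<^sub>\<infinity>i\<in>X - {i0}. norm (c i * exp (- 2 * L i)) * exp (- (y * k)))"
    by (rule infsum_mono[OF s2 s1 u_le])
  also have "\<dots> = (\<Sum>\<^sub>\<infinity>i\<in>X - {i0}. norm (c i * exp (- 2 * L i))) * exp (- (y * k))"
    by (rule infsum_cmult_left')
  also have "\<dots> \<le> T * exp (- (y * k))"
    unfolding T_def by (intro mult_right_mono infsum_mono2 summ summable_on_subset_banach[OF summ]) auto
  also note small
  finally have less: "norm (\<Sum>\<^sub>\<infinity>i\<in>X - {i0}. u i) < \<delta>" .
  have "(\<Sum>\<^sub>\<infinity>i\<in>{i0} \<union> (X - {i0}). u i) = (\<Sum>\<^sub>\<infinity>i\<in>{i0}. u i) + (\<Sum>\<^sub>\<infinity>i\<in>X - {i0}. u i)"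
    by (rule infsum_Un_disjoint) (auto intro: abs_summable_summable[OF s2])
  moreover have "{i0} \<union> (X - {i0}) = X" using i0X by auto
  ultimately have "(\<Sum>\<^sub>\<infinity>i\<in>X. u i) = u i0 + (\<Sum>\<^sub>\<infinity>i\<in>X - {i0}. u i)" by simp
  moreover have "norm (u i0) = \<delta>" by (simp add: u_def \<delta>_def)
  ultimately have nzu: "(\<Sum>\<^sub>\<infinity>i\<in>X. u i) \<noteq> 0"
    using less by (metis add_eq_0_iff norm_minus_cancel less_irrefl)
  have "u i = exp (q * L i0) * (c i * exp (- s * L i))" for i
  proof -
    have "exp (- 2 * L i) * exp (- q * (L i - L i0)) = exp (q * L i0) * exp (- s * L i)"
      unfolding exp_add[symmetric] s_def by (rule arg_cong[where f = exp]) (simp add: algebra_simps)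
    then show ?thesis by (simp add: u_def mult_ac)
  qed
  then have "(\<Sum>\<^sub>\<infinity>i\<in>X. u i) = exp (q * L i0) * (\<Sum>\<^sub>\<infinity>i\<in>X. c i * exp (- s * L i))"
    by (simp only: infsum_cmult_right')
  then have "(\<Sum>\<^sub>\<infinity>i\<in>X. c i * exp (- s * L i)) \<noteq> 0" using nzu by auto
  then show ?thesis using Re_s by blast
qed

section \<open>The frequencies of the shifted series\<close>

context shifted_dirichlet_series
begin

definition freq :: "'j \<times> nat \<Rightarrow> complex" where
  "freq = (\<lambda>(j, n). \<i> * of_real (pi * d * w j) + of_real (ln (real n)) + of_real d * Ln (base j n))"

text \<open>For admissible indices this is the value of \<open>b j * (e j s * summand s j n)\<close>
  at \<open>s = 0\<close>.\<close>

definition coef :: "'j \<times> nat \<Rightarrow> complex" where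
  "coef = (\<lambda>(j, n). b j * (exp (\<i> * of_real (pi * d * w j)) * (a n * exp (of_real d * (1 - \<kappa>) * Ln (base j n)))))"

lemma base_nz': "j \<in> J \<Longrightarrow> n \<in> I j \<Longrightarrow> base j n \<noteq> 0"
  using base_nz by (simp add: base_def x_def)

lemma coef_exp:
  assumes "j \<in> J" "n \<in> I j"
  shows "coef (j, n) * exp (- s * freq (j, n)) = b j * (e j s * summand s j n)"
proof -
  have n: "n \<ge> 1" using I(1) assms by auto
  have "1 / of_nat n powr s = exp (- s * of_real (ln (real n)))"
    using n by (simp add: powr_def exp_minus field_simps)
  then have sm: "summand s j n = a n * exp (- s * of_real (ln (real n))) * exp (p s * Ln (base j n))"
    using base_nz'[OF assms] by (simp add: summand_def powr_def[of "base j n"] divide_inverse)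
  have "exp (\<i> * of_real (pi * d * w j)) * exp (of_real d * (1 - \<kappa>) * Ln (base j n)) * exp (- s * freq (j, n))
      = e j s * exp (- s * of_real (ln (real n))) * exp (p s * Ln (base j n))"
    unfolding e_def exp_add[symmetric] p_def
    by (rule arg_cong[where f = exp]) (simp add: freq_def algebra_simps)
  then show ?thesis unfolding sm by (simp add: coef_def mult_ac)
qed

text \<open>Multiplying the base by \<open>n powr (1/d) * cis (pi * w j)\<close> turns its second
  term into a vector independent of \<open>j\<close> and \<open>n\<close>: the moduli multiply to
  \<open>\<nu> powr (1/d)\<close> and the angles add up to a right angle.\<close>

lemma exp_freq:
  assumes "j \<in> J" "n \<in> I j"
  shows "exp (freq (j, n) / of_real d) =
    of_real (real n powr (1 / d)) * cis (pi * w j) + \<i> * of_real (\<nu> powr (1 / d))"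
proof -
  have n: "n \<ge> 1" using I(1) assms by auto
  have "freq (j, n) / of_real d = \<i> * of_real (pi * w j) + of_real (1 / d * ln (real n)) + Ln (base j n)"
    using d by (simp add: freq_def field_simps)
  then have "exp (freq (j, n) / of_real d) = cis (pi * w j) * of_real (real n powr (1 / d)) * base j n"
    using base_nz'[OF assms] n
    by (simp only: exp_add cis_conv_exp exp_of_real exp_Ln powr_def) simp
  also have "\<dots> = of_real (real n powr (1 / d)) * cis (pi * w j) +
      of_real (real n powr (1 / d) * x n) * (cis (pi * w j) * cis (pi * (1/2 - w j)))"
    by (simp add: base_def algebra_simps)
  also have "cis (pi * w j) * cis (pi * (1/2 - w j)) = \<i>"
    by (simp add: cis_mult right_diff_distrib)
  also have "real n powr (1 / d) * x n = \<nu> powr (1 / d)"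
    using n \<nu> by (simp add: x_def powr_mult[symmetric])
  finally show ?thesis by (simp add: mult.commute)
qed

text \<open>Once the common translation in \<open>exp_freq\<close> is removed, the points are in
  polar form: the modulus determines \<open>n\<close>, and as the sine is injective on
  \<open>[-pi/2, pi/2]\<close>, the angle determines \<open>w j\<close>, hence
  \<open>j\<close>.\<close>

lemma inj_freq:
  assumes "inj_on w J"
  shows "inj_on freq (Sigma J I)"
proof (rule inj_onI, clarify)
  fix j n j' n' assume j: "j \<in> J" "n \<in> I j" and j': "j' \<in> J" "n' \<in> I j'" and eq: "freq (j, n) = freq (j', n')"
  have n: "n \<ge> 1" "n' \<ge> 1" using I(1) j j' by auto
  have E: "of_real (real n powr (1 / d)) * cis (pi * w j) = of_real (real n' powr (1 / d)) * cis (pi * w j')"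
    using exp_freq[OF j] exp_freq[OF j'] eq by simp
  then have "norm (of_real (real n powr (1 / d)) * cis (pi * w j)) = norm (of_real (real n' powr (1 / d)) * cis (pi * w j'))"
    by simp
  then have nn: "real n powr (1 / d) = real n' powr (1 / d)" by (simp add: norm_mult)
  then have "(real n powr (1 / d)) powr d = (real n' powr (1 / d)) powr d" by simp
  then have "n = n'" using d by (simp add: powr_powr)
  have "cis (pi * w j) = cis (pi * w j')" using E nn n by simp
  then have "Im (cis (pi * w j)) = Im (cis (pi * w j'))" by (rule arg_cong)
  then have sin: "sin (pi * w j) = sin (pi * w j')" by simp
  have rng: "- (pi / 2) \<le> pi * w j" "pi * w j \<le> pi / 2" if "j \<in> J" for j
  proof -
    have "- (1/2) \<le> w j" "w j \<le> 1/2" using w[OF that] by auto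
    then have "pi * (- (1/2)) \<le> pi * w j" "pi * w j \<le> pi * (1/2)"
      by (intro mult_left_mono; simp)+
    then show "- (pi / 2) \<le> pi * w j" "pi * w j \<le> pi / 2" by auto
  qed
  have "pi * w j = pi * w j'" using sin_inj_pi[OF rng[OF j(1)] rng[OF j'(1)] sin] .
  then have "j = j'" using assms j j' by (simp add: inj_on_def)
  then show "j = j' \<and> n = n'" using \<open>n = n'\<close> by simp
qed

lemma Im_freq_le:
  assumes "j \<in> J" "n \<in> I j"
  shows "\<bar>Im (freq (j, n))\<bar> \<le> pi / 2 * d"
proof -
  define \<theta> where "\<theta> = Im (Ln (base j n))"
  have wj: "- (1/2) \<le> w j" "w j \<le> 1/2" using w[OF assms(1)] by auto
  have \<phi>: "0 \<le> pi * (1/2 - w j)" "pi * (1/2 - w j) \<le> pi" using wj by (auto simp: mult_le_cancel_left1)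
  have \<theta>: "0 \<le> \<theta>" "\<theta> \<le> pi * (1/2 - w j)"
    using Im_Ln_one_plus_cis[OF \<phi> x_nonneg] base_nz'[OF assms] by (auto simp: \<theta>_def base_alt)
  have "pi * (- (1/2)) \<le> pi * w j" using wj by (intro mult_left_mono) auto
  moreover have "\<theta> + pi * w j \<le> pi / 2" using \<theta> by (simp add: algebra_simps)
  ultimately have "\<bar>pi * w j + \<theta>\<bar> \<le> pi / 2" using \<theta> by linarith
  then have "d * \<bar>pi * w j + \<theta>\<bar> \<le> d * (pi / 2)" using d by (intro mult_left_mono) auto
  moreover have "\<bar>Im (freq (j, n))\<bar> = d * \<bar>pi * w j + \<theta>\<bar>"
  proof -
    have "Im (freq (j, n)) = d * (pi * w j + \<theta>)" by (simp add: freq_def \<theta>_def algebra_simps)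
    then show ?thesis using d by (simp add: abs_mult)
  qed
  ultimately show ?thesis by (simp add: mult.commute)
qed

text \<open>Real parts tend to infinity with \<open>n\<close>; as \<open>J\<close> is finite, only
  finitely many frequencies lie to the left of a given vertical line.\<close>

lemma Re_freq_ge:
  assumes "j \<in> J" "n \<in> I j"
  shows "Re (freq (j, n)) \<ge> ln (real n) - d * ln \<Theta>"
proof -
  have "1 / \<Theta> \<le> norm (base j n)" using \<Theta>(2)[OF assms] .
  then have "ln (1 / \<Theta>) \<le> ln (norm (base j n))" using \<Theta>(1) base_nz'[OF assms] by (intro ln_mono) auto
  then have "- ln \<Theta> \<le> ln (norm (base j n))" using \<Theta>(1) by (simp add: ln_div)
  then have "d * (- ln \<Theta>) \<le> d * ln (norm (base j n))" using d by (intro mult_left_mono) auto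
  then show ?thesis using base_nz'[OF assms] by (simp add: freq_def)
qed

lemma series_nonzero:
  assumes inj: "inj_on w J" and nz: "j0 \<in> J" "n0 \<in> I j0" "b j0 \<noteq> 0" "a n0 \<noteq> 0"
  shows "\<exists>s. Re s > 1 \<and> series s \<noteq> 0"
proof -
  have summ: "(\<lambda>i. norm (coef i * exp (- s * freq i))) summable_on Sigma J I" if s: "Re s > 1" for s
  proof (subst Infinite_Sum.abs_summable_on_Sigma_iff, intro conjI ballI)
    fix j assume j: "j \<in> J"
    have "(\<lambda>n. norm (b j) * norm (e j s * summand s j n)) summable_on I j"
      using abs_summable_e_summand[OF j s] by (rule summable_on_cmult_right)
    then show "(\<lambda>n. norm (coef (j, n) * exp (- s * freq (j, n)))) summable_on I j"
      by (rule summable_on_cong[THEN iffD1, rotated]) (simp only: coef_exp[OF j] norm_mult)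
  qed (use fin_J in simp)
  have "\<exists>s. Re s > 1 \<and> (\<Sum>\<^sub>\<infinity>i\<in>Sigma J I. coef i * exp (- s * freq i)) \<noteq> 0"
  proof (rule exponential_series_nonzero[OF inj_freq[OF inj], of "pi / 2 * d"])
    show "\<bar>Im (freq i)\<bar> \<le> pi / 2 * d" if "i \<in> Sigma J I" for i
      using Im_freq_le that by (cases i) auto
    show "finite {i \<in> Sigma J I. Re (freq i) \<le> R}" for R
    proof (rule finite_subset)
      define N where "N = nat \<lceil>exp (R + d * ln \<Theta>)\<rceil>"
      show "{i \<in> Sigma J I. Re (freq i) \<le> R} \<subseteq> J \<times> {..N}"
      proof
        fix i assume i: "i \<in> {i \<in> Sigma J I. Re (freq i) \<le> R}"
        obtain j n where jn: "i = (j, n)" by (cases i)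
        have j: "j \<in> J" "n \<in> I j" and R: "Re (freq (j, n)) \<le> R" using i jn by auto
        have n: "n \<ge> 1" using I(1) j by auto
        have "ln (real n) \<le> R + d * ln \<Theta>" using Re_freq_ge[OF j] R by linarith
        then have "exp (ln (real n)) \<le> exp (R + d * ln \<Theta>)" by (simp only: exp_le_cancel_iff)
        then have "real n \<le> exp (R + d * ln \<Theta>)" using n by simp
        then have "n \<le> N" unfolding N_def by linarith
        then show "i \<in> J \<times> {..N}" using j jn by simp
      qed
      show "finite (J \<times> {..N})" using fin_J by simp
    qed
    show "(\<lambda>i. norm (coef i * exp (- 2 * freq i))) summable_on Sigma J I" by (rule summ) simp
    show "(j0, n0) \<in> Sigma J I" using nz by simp
    show "coef (j0, n0) \<noteq> 0" using nz by (simp add: coef_def)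
  qed
  then obtain s where s: "Re s > 1" "(\<Sum>\<^sub>\<infinity>i\<in>Sigma J I. coef i * exp (- s * freq i)) \<noteq> 0" by blast
  have "(\<Sum>\<^sub>\<infinity>i\<in>Sigma J I. coef i * exp (- s * freq i)) = (\<Sum>\<^sub>\<infinity>j\<in>J. \<Sum>\<^sub>\<infinity>n\<in>I j. coef (j, n) * exp (- s * freq (j, n)))"
    by (rule infsum_Sigma_banach[symmetric]) (rule abs_summable_summable[OF summ[OF s(1)]])
  also have "\<dots> = (\<Sum>j\<in>J. \<Sum>\<^sub>\<infinity>n\<in>I j. b j * (e j s * summand s j n))"
    using fin_J by (simp only: infsum_finite) (intro sum.cong refl infsum_cong coef_exp)
  also have "\<dots> = series s" unfolding series_eq infsum_cmult_right' ..
  finally show ?thesis using s by auto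
qed

end

subsection \<open>Uniform vertical bounds\<close>

text \<open>For \<open>\<sigma> \<le> 1\<close> the exponent belongs to the least natural
  \<open>A \<ge> - \<sigma>\<close>. A bounded interval involves finitely many such
  \<open>A\<close>, whose constants are added up; an interval \<open>(1, 1 + \<eta>)\<close> is
  bridged by interpolation at the price of \<epsilon>.\<close>

lemma locally_uniform_vertical_boundI:
  assumes hol: "G holomorphic_on UNIV" and "d \<ge> 0"
    and strip: "\<And>A::nat. vertical_growth {s. - real A \<le> Re s \<and> Re s \<le> 2 \<and> 1 \<le> \<bar>Im s\<bar>} (pi / 2 * d) (ex A) G"
    and right: "\<And>\<delta> B. \<delta> > 0 \<Longrightarrow> vertical_growth {s. 1 + \<delta> \<le> Re s \<and> Re s \<le> B} (pi / 2 * d) 0 G"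
  shows "locally_uniform_vertical_bound G d (\<lambda>\<sigma>. if \<sigma> > 1 then 0 else real (ex (nat \<lceil>-\<sigma>\<rceil>)))"
proof -
  define c where "c = (\<lambda>\<sigma>::real. if \<sigma> > 1 then 0 else real (ex (nat \<lceil>-\<sigma>\<rceil>)))"
  define D where "D = pi / 2 * d"
  have D: "D \<ge> 0" using \<open>d \<ge> 0\<close> by (simp add: D_def)
  have "\<forall>A. \<exists>K>0. \<forall>s\<in>{s. - real A \<le> Re s \<and> Re s \<le> 2 \<and> 1 \<le> \<bar>Im s\<bar>}. norm (G s) \<le> K * exp (D * \<bar>Im s\<bar>) * (1 + \<bar>Im s\<bar>) ^ ex A"
    using vertical_growthD[OF strip] unfolding D_def by blast
  then obtain K where K: "\<And>A. K A > 0"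
    "\<And>A s. - real A \<le> Re s \<Longrightarrow> Re s \<le> 2 \<Longrightarrow> 1 \<le> \<bar>Im s\<bar> \<Longrightarrow> norm (G s) \<le> K A * exp (D * \<bar>Im s\<bar>) * (1 + \<bar>Im s\<bar>) ^ ex A"
    by (metis (no_types, lifting) mem_Collect_eq)
  have off: "\<exists>C\<ge>0. \<forall>\<sigma>\<in>{A..B} - {1<..<1 + \<delta>}. \<forall>t. \<bar>t\<bar> \<ge> 1 \<longrightarrow>
      norm (G (Complex \<sigma> t)) \<le> C * exp (D * \<bar>t\<bar>) * \<bar>t\<bar> powr c \<sigma>" if \<delta>: "\<delta> > 0" for A B \<delta>
  proof -
    obtain C1 where C1: "C1 > 0" "\<And>s. 1 + \<delta> \<le> Re s \<Longrightarrow> Re s \<le> B \<Longrightarrow> norm (G s) \<le> C1 * exp (D * \<bar>Im s\<bar>) * (1 + \<bar>Im s\<bar>) ^ 0"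
      using vertical_growthD[OF right[OF \<delta>, of B]] unfolding D_def by blast
    define n0 where "n0 = nat \<lceil>-A\<rceil>"
    \<comment> \<open>The factor \<open>2 ^ ex n\<close> pays for
      \<open>1 + \<bar>t\<bar> \<le> 2 * \<bar>t\<bar>\<close>.\<close>
    define C where "C = (\<Sum>n\<le>n0. K n * 2 ^ ex n) + C1"
    have C_ge: "K n * 2 ^ ex n \<le> C" if "n \<le> n0" for n
    proof -
      have "K n * 2 ^ ex n \<le> (\<Sum>n\<le>n0. K n * 2 ^ ex n)"
        using that K(1) by (intro member_le_sum) (auto intro: less_imp_le)
      then show ?thesis using C1(1) by (simp add: C_def)
    qed
    have "0 \<le> (\<Sum>n\<le>n0. K n * 2 ^ ex n)"
      by (intro sum_nonneg mult_nonneg_nonneg less_imp_le[OF K(1)]) auto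
    then have C0: "C1 \<le> C" by (simp add: C_def)
    have "norm (G (Complex \<sigma> t)) \<le> C * exp (D * \<bar>t\<bar>) * \<bar>t\<bar> powr c \<sigma>"
      if \<sigma>: "\<sigma> \<in> {A..B} - {1<..<1 + \<delta>}" and t: "\<bar>t\<bar> \<ge> 1" for \<sigma> t
    proof (cases "\<sigma> > 1")
      case True
      have "norm (G (Complex \<sigma> t)) \<le> C1 * exp (D * \<bar>t\<bar>)" using C1(2)[of "Complex \<sigma> t"] True \<sigma> by simp
      also have "\<dots> \<le> C * exp (D * \<bar>t\<bar>)" using C0 by (intro mult_right_mono) auto
      finally show ?thesis using True t by (simp add: c_def)
    next
      case False
      define n where "n = nat \<lceil>-\<sigma>\<rceil>"
      have "A \<le> \<sigma>" using \<sigma> by simp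
      then have n: "n \<le> n0" unfolding n_def n0_def by (intro nat_mono ceiling_mono) simp
      have n\<sigma>: "- real n \<le> \<sigma>" unfolding n_def by linarith
      have "norm (G (Complex \<sigma> t)) \<le> K n * exp (D * \<bar>t\<bar>) * (1 + \<bar>t\<bar>) ^ ex n"
        using K(2)[of n "Complex \<sigma> t"] n\<sigma> False t by simp
      also have "\<dots> \<le> K n * exp (D * \<bar>t\<bar>) * (2 * \<bar>t\<bar>) ^ ex n"
        using K(1)[of n] t by (intro mult_left_mono power_mono) auto
      also have "\<dots> = (K n * 2 ^ ex n) * exp (D * \<bar>t\<bar>) * \<bar>t\<bar> ^ ex n" by (simp add: power_mult_distrib)
      also have "\<dots> \<le> C * exp (D * \<bar>t\<bar>) * \<bar>t\<bar> ^ ex n" using C_ge[OF n] by (intro mult_right_mono) auto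
      also have "\<bar>t\<bar> ^ ex n = \<bar>t\<bar> powr c \<sigma>" using False t by (simp add: c_def n_def powr_realpow)
      finally show ?thesis .
    qed
    then show ?thesis using C0 C1(1) by (intro exI[of _ C]) auto
  qed
  have "vertical_bound G d c ({A..B} - {1<..<1 + \<delta>})" if \<delta>: "\<delta> > 0" for A B \<delta>
  proof -
    obtain C where "\<forall>\<sigma>\<in>{A..B} - {1<..<1 + \<delta>}. \<forall>t. \<bar>t\<bar> \<ge> 1 \<longrightarrow>
      norm (G (Complex \<sigma> t)) \<le> C * exp (D * \<bar>t\<bar>) * \<bar>t\<bar> powr c \<sigma>" using off[OF \<delta>] by blast
    then show ?thesis unfolding vertical_bound_def D_def by (intro exI[of _ C] exI[of _ 1])
  qed
  moreover have "vertical_bound G d (\<lambda>\<sigma>. c \<sigma> + \<epsilon>) {A..B}" if \<epsilon>: "\<epsilon> > 0" for A B \<epsilon>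
  proof -
    have "compact (G ` cbox (Complex 0 (-1)) (Complex 2 1))"
      by (intro compact_continuous_image compact_cbox holomorphic_on_imp_continuous_on holomorphic_on_subset[OF hol]) auto
    then have "bounded (G ` cbox (Complex 0 (-1)) (Complex 2 1))" by (rule compact_imp_bounded)
    then obtain K0 where K0: "\<forall>v\<in>G ` cbox (Complex 0 (-1)) (Complex 2 1). norm v \<le> K0" unfolding bounded_iff by blast
    \<comment> \<open>Interpolation needs the whole strip; compactness covers the part with
      \<open>\<bar>Im s\<bar> < 1\<close>.\<close>
    have poly: "norm (G s) \<le> (K 0 + \<bar>K0\<bar>) * exp (D * \<bar>Im s\<bar>) * (1 + \<bar>Im s\<bar>) ^ ex 0" if s: "0 \<le> Re s" "Re s \<le> 2" for s
    proof (cases "1 \<le> \<bar>Im s\<bar>")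
      case True
      have "norm (G s) \<le> K 0 * exp (D * \<bar>Im s\<bar>) * (1 + \<bar>Im s\<bar>) ^ ex 0" using K(2)[of 0 s] s True by simp
      also have "\<dots> \<le> (K 0 + \<bar>K0\<bar>) * exp (D * \<bar>Im s\<bar>) * (1 + \<bar>Im s\<bar>) ^ ex 0" by (intro mult_right_mono) auto
      finally show ?thesis .
    next
      case False
      then have "s \<in> cbox (Complex 0 (-1)) (Complex 2 1)" using s by (auto simp: in_cbox_complex_iff)
      then have "norm (G s) \<le> K0" using K0 by blast
      also have "\<dots> \<le> (K 0 + \<bar>K0\<bar>) * 1 * 1" using K(1)[of 0] by simp
      also have "\<dots> \<le> (K 0 + \<bar>K0\<bar>) * exp (D * \<bar>Im s\<bar>) * (1 + \<bar>Im s\<bar>) ^ ex 0"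
        using K(1)[of 0] D by (intro mult_mono) (auto simp: one_le_power)
      finally show ?thesis .
    qed
    have line: "\<exists>C. \<forall>s. Re s = 1 + \<eta> \<longrightarrow> norm (G s) \<le> C * exp (D * \<bar>Im s\<bar>)" if \<eta>: "\<eta> > 0" for \<eta>
    proof -
      obtain C1 where C1: "\<And>s. 1 + \<eta> \<le> Re s \<Longrightarrow> Re s \<le> 1 + \<eta> \<Longrightarrow> norm (G s) \<le> C1 * exp (D * \<bar>Im s\<bar>) * (1 + \<bar>Im s\<bar>) ^ 0"
        using vertical_growthD[OF right[OF \<eta>, of "1 + \<eta>"]] unfolding D_def by blast
      then show ?thesis by (intro exI[of _ C1]) auto
    qed
    obtain \<eta> C2 where \<eta>: "\<eta> > 0" and C2: "\<And>s. 1 \<le> Re s \<Longrightarrow> Re s \<le> 1 + \<eta> \<Longrightarrow> norm (G s) \<le> C2 * exp (D * \<bar>Im s\<bar>) * (1 + \<bar>Im s\<bar>) powr \<epsilon>"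
      using vertical_growth_interpolation[OF hol D \<epsilon> _ poly line, of 2] by auto
    obtain C where C: "C \<ge> 0" "\<And>\<sigma> t. \<sigma> \<in> {A..B} - {1<..<1 + \<eta>} \<Longrightarrow> \<bar>t\<bar> \<ge> 1 \<Longrightarrow>
      norm (G (Complex \<sigma> t)) \<le> C * exp (D * \<bar>t\<bar>) * \<bar>t\<bar> powr c \<sigma>" using off[OF \<eta>, of A B] by blast
    define C3 where "C3 = C + \<bar>C2\<bar> * 2 powr \<epsilon>"
    have "norm (G (Complex \<sigma> t)) \<le> C3 * exp (D * \<bar>t\<bar>) * \<bar>t\<bar> powr (c \<sigma> + \<epsilon>)" if \<sigma>: "\<sigma> \<in> {A..B}" and t: "\<bar>t\<bar> \<ge> 1" for \<sigma> t
    proof (cases "\<sigma> \<in> {1<..<1 + \<eta>}")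
      case True
      have "norm (G (Complex \<sigma> t)) \<le> C2 * exp (D * \<bar>t\<bar>) * (1 + \<bar>t\<bar>) powr \<epsilon>"
        using C2[of "Complex \<sigma> t"] True by simp
      also have "\<dots> \<le> \<bar>C2\<bar> * exp (D * \<bar>t\<bar>) * (2 * \<bar>t\<bar>) powr \<epsilon>"
        using t \<epsilon> by (intro mult_mono mult_right_mono powr_mono2) auto
      also have "\<dots> = (\<bar>C2\<bar> * 2 powr \<epsilon>) * exp (D * \<bar>t\<bar>) * \<bar>t\<bar> powr \<epsilon>" by (simp add: powr_mult)
      also have "\<dots> \<le> C3 * exp (D * \<bar>t\<bar>) * \<bar>t\<bar> powr \<epsilon>" using C(1) by (intro mult_right_mono) (auto simp: C3_def)
      finally show ?thesis using True by (simp add: c_def)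
    next
      case False
      have "norm (G (Complex \<sigma> t)) \<le> C * exp (D * \<bar>t\<bar>) * \<bar>t\<bar> powr c \<sigma>" using C(2)[of \<sigma> t] False \<sigma> t by simp
      also have "\<dots> \<le> C3 * exp (D * \<bar>t\<bar>) * \<bar>t\<bar> powr (c \<sigma> + \<epsilon>)"
        using C(1) t \<epsilon> by (intro mult_mono mult_right_mono powr_mono) (auto simp: C3_def)
      finally show ?thesis .
    qed
    then show ?thesis unfolding vertical_bound_def D_def by (intro exI[of _ C3] exI[of _ 1]) blast
  qed
  ultimately show ?thesis unfolding locally_uniform_vertical_bound_def c_def by blast
qed

text \<open>The zero at \<open>- mu 1 / lam 1\<close> would force \<open>c = 0\<close>, but high on
  the imaginary axis no sine vanishes because its zeros are real. This provides a nonzero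
  \<open>b j\<close> with \<open>j \<noteq> -N\<close>.\<close>

lemma selberg_S_not_exponential:
  assumes lam: "\<And>j. j \<in> {1..r} \<Longrightarrow> lam j > 0" and "r \<ge> 1"
  shows "\<not> (\<forall>s. selberg_S r lam mu s = c * exp (k * s))"
proof
  assume eq: "\<forall>s. selberg_S r lam mu s = c * exp (k * s)"
  have "selberg_S r lam mu (- mu 1 / of_real (lam 1)) = 0"
    unfolding selberg_S_def using lam[of 1] \<open>r \<ge> 1\<close> by (auto intro!: bexI[of _ 1])
  then have "c = 0" using eq by simp
  define t where "t = (\<Sum>j=1..r. (1 + \<bar>Im (mu j)\<bar>) / lam j)"
  have "sin (of_real pi * (of_real (lam j) * (\<i> * of_real t) + mu j)) \<noteq> 0" if j: "j \<in> {1..r}" for j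
  proof
    assume "sin (of_real pi * (of_real (lam j) * (\<i> * of_real t) + mu j)) = 0"
    then obtain k :: int where "of_real pi * (of_real (lam j) * (\<i> * of_real t) + mu j) = of_real (of_int k * pi)"
      by (auto simp: sin_eq_0)
    then have "Im (of_real pi * (of_real (lam j) * (\<i> * of_real t) + mu j)) = Im (of_real (of_int k * pi))"
      by (rule arg_cong)
    then have "lam j * t + Im (mu j) = 0" by simp
    moreover have "(1 + \<bar>Im (mu j)\<bar>) / lam j \<le> t"
      unfolding t_def using j lam by (intro member_le_sum) (auto intro!: divide_nonneg_pos)
    then have "1 + \<bar>Im (mu j)\<bar> \<le> lam j * t" using lam[OF j] by (simp add: field_simps)
    ultimately show False by linarith
  qed
  then have "selberg_S r lam mu (\<i> * of_real t) \<noteq> 0" by (simp add: selberg_S_def)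
  then show False using eq \<open>c = 0\<close> by simp
qed

lemma selberg_S_expansionD:
  assumes "selberg_S_expansion r lam mu N b w"
  shows "N \<ge> 1" "strict_mono_on {-N..N} w" "w (-N) = -1/2"
    and "\<And>j. j \<in> {-N..N} \<Longrightarrow> \<bar>w j\<bar> \<le> 1 / 2"
    and "\<And>s. selberg_S r lam mu s = (\<Sum>j\<in>{-N..N}. b j * exp (\<i> * of_real (pi * selberg_degree r lam * w j) * s))"
proof -
  show *: "N \<ge> 1" "strict_mono_on {-N..N} w" "w (-N) = -1/2"
    "\<And>s. selberg_S r lam mu s = (\<Sum>j\<in>{-N..N}. b j * exp (\<i> * of_real (pi * selberg_degree r lam * w j) * s))"
    using assms unfolding selberg_S_expansion_def by blast+
  have "w N = 1/2" using assms unfolding selberg_S_expansion_def by blast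
  show "\<bar>w j\<bar> \<le> 1 / 2" if "j \<in> {-N..N}" for j
    using strict_mono_on_leD[OF *(2), of "-N" j] strict_mono_on_leD[OF *(2), of j N] that *(1,3) \<open>w N = 1/2\<close>
    by auto
qed

text \<open>The exponential growth comes from \<open>S\<close>, while \<open>F\<close> is
  polynomially bounded: \<open>\<bar>Im s\<bar> \<ge> 1\<close> makes
  \<open>norm (cnj s - 1) ^ m \<ge> 1\<close>, so \<open>F\<close> inherits the bound of
  \<open>E\<close>.\<close>

lemma selberg_S_conj_F_growth:
  assumes ext: "extended_selberg F a \<omega> Q r lam mu" and deg: "selberg_degree r lam \<ge> 1"
    and exp: "selberg_S_expansion r lam mu N b w"
    and H: "\<And>s. s \<noteq> 1 \<Longrightarrow> H s = selberg_S r lam mu (1 - s) * cnj (F (cnj s))"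
  shows "\<exists>n. vertical_growth {s. \<bar>Re s\<bar> \<le> real A \<and> 1 \<le> \<bar>Im s\<bar>} (pi / 2 * selberg_degree r lam) n H"
proof -
  define X where "X = {s. \<bar>Re s\<bar> \<le> real A \<and> 1 \<le> \<bar>Im s\<bar>}"
  obtain m E where E: "E holomorphic_on UNIV" "finite_order E" "\<And>s. s \<noteq> 1 \<Longrightarrow> E s = (s - 1) ^ m * F s"
    using extended_selbergD(4)[OF ext] by blast
  \<comment> \<open>The strip parameter \<open>real A + 1\<close> is at least 1, as required, even
    for \<open>A = 0\<close>.\<close>
  obtain C n where C: "C > 0" "\<And>s. - (real A + 1) \<le> Re s \<Longrightarrow> Re s \<le> 1 + (real A + 1) \<Longrightarrow> norm (E s) \<le> C * (1 + norm s) ^ n"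
    using poly_bounded_onD[OF extended_selberg_poly_bounded_strip[OF ext E, of "real A + 1"]] by auto
  have F: "vertical_growth X 0 n (\<lambda>s. cnj (F (cnj s)))"
    unfolding vertical_growth_def
  proof (intro exI ballI)
    fix s assume "s \<in> X"
    then have s: "\<bar>Re s\<bar> \<le> real A" "1 \<le> \<bar>Im s\<bar>" by (auto simp: X_def)
    have "1 \<le> norm (cnj s - 1)" using abs_Im_le_cmod[of "cnj s - 1"] s by simp
    then have pw: "1 \<le> norm (cnj s - 1) ^ m" by (rule one_le_power)
    have "cnj s \<noteq> 1" using s(2) by auto
    have "norm (cnj (F (cnj s))) * 1 \<le> norm (F (cnj s)) * norm (cnj s - 1) ^ m"
      using mult_left_mono[OF pw, of "norm (F (cnj s))"] by simp
    also have "\<dots> = norm (E (cnj s))" using E(3)[OF \<open>cnj s \<noteq> 1\<close>] by (simp add: norm_mult norm_power)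
    also have "\<dots> \<le> C * (1 + norm s) ^ n" using C(2)[of "cnj s"] s by (simp add: abs_le_iff)
    also have "\<dots> \<le> C * ((1 + real A) * (1 + \<bar>Im s\<bar>)) ^ n"
    proof (intro mult_left_mono power_mono)
      have "norm s \<le> real A + \<bar>Im s\<bar>" using cmod_le[of s] s by linarith
      moreover have "(1 + real A) * (1 + \<bar>Im s\<bar>) = 1 + real A + \<bar>Im s\<bar> + real A * \<bar>Im s\<bar>" by (simp add: algebra_simps)
      moreover have "0 \<le> real A * \<bar>Im s\<bar>" by simp
      ultimately show "1 + norm s \<le> (1 + real A) * (1 + \<bar>Im s\<bar>)" by linarith
    qed (use C in auto)
    finally show "norm (cnj (F (cnj s))) \<le> (C * (1 + real A) ^ n) * exp (0 * \<bar>Im s\<bar>) * (1 + \<bar>Im s\<bar>) ^ n"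
      by (simp add: power_mult_distrib)
  qed
  have S: "vertical_growth X (pi / 2 * selberg_degree r lam) 0 (\<lambda>s. selberg_S r lam mu (1 - s))"
    using exponential_sum_growth[of "selberg_degree r lam" "{-N..N}" w X b 0] deg selberg_S_expansionD(4,5)[OF exp]
    by simp
  have "vertical_growth X (pi / 2 * selberg_degree r lam + 0) (0 + n) (\<lambda>s. selberg_S r lam mu (1 - s) * cnj (F (cnj s)))"
    by (rule vertical_growth_mult[OF S F])
  then have "vertical_growth X (pi / 2 * selberg_degree r lam) n (\<lambda>s. selberg_S r lam mu (1 - s) * cnj (F (cnj s)))"
    by (simp only: add_0_right add_0_left)
  then have "vertical_growth X (pi / 2 * selberg_degree r lam) n H"
    by (rule vertical_growth_cong) (subst H, auto simp: X_def)
  then show ?thesis unfolding X_def by blast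
qed

lemma n_alpha_pos:
  assumes "extended_selberg F a \<omega> Q r lam mu" "selberg_degree r lam \<ge> 1" "\<alpha> > 0"
  shows "n_alpha Q r lam \<alpha> > 0"
proof -
  have "selberg_conductor Q r lam > 0"
    unfolding selberg_conductor_def using extended_selbergD(6,7)[OF assms(1)]
    by (intro mult_pos_pos prod_pos) (force simp: zero_less_power)+
  then show ?thesis using assms by (simp add: n_alpha_def Let_def)
qed

theorem theorem1:
  fixes F :: "complex \<Rightarrow> complex" and a :: "nat \<Rightarrow> complex" and \<omega> :: complex
    and Q :: real and r :: nat and lam :: "nat \<Rightarrow> real" and mu :: "nat \<Rightarrow> complex"
    and N :: int and b :: "int \<Rightarrow> complex" and w :: "int \<Rightarrow> real"
  assumes "extended_selberg F a \<omega> Q r lam mu"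
    and "selberg_degree r lam \<ge> 1"
    and "selberg_S_expansion r lam mu N b w"
  shows "\<exists>c :: real \<Rightarrow> real. (\<forall>\<sigma>. c \<sigma> \<ge> 0) \<and> (\<forall>\<sigma>>1. c \<sigma> = 0) \<and>
    (\<forall>\<alpha>>0. \<forall>l::nat.
       (\<forall>s. Re s > 1 \<longrightarrow> (\<forall>j\<in>{-N..N}.
          (\<lambda>n. norm (Fbar_term a Q r lam mu w \<alpha> l s j n)) summable_on Fbar_index Q r lam N \<alpha> j)) \<and>
       (\<exists>G. G holomorphic_on UNIV \<and>
          (\<forall>s. Re s > 1 \<longrightarrow> G s = Fbar_series a Q r lam mu N b w \<alpha> l s) \<and>
          (\<exists>s. G s \<noteq> 0) \<and>
          locally_uniform_vertical_bound G (selberg_degree r lam) c))"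
proof -
  note sel = extended_selbergD[OF assms(1)]
  note expn = selberg_S_expansionD[OF assms(3)]
  define d where "d = selberg_degree r lam"
  have d: "d \<ge> 1" using assms(2) by (simp add: d_def)
  obtain H where H: "H holomorphic_on UNIV" "\<And>s. s \<noteq> 1 \<Longrightarrow> H s = selberg_S r lam mu (1 - s) * cnj (F (cnj s))"
    using selberg_S_conj_F_entire[OF assms(1)] by blast
  have "\<forall>A. \<exists>n. vertical_growth {s. \<bar>Re s\<bar> \<le> real A \<and> 1 \<le> \<bar>Im s\<bar>} (pi / 2 * d) n H"
    unfolding d_def using selberg_S_conj_F_growth[OF assms H(2)] by blast
  \<comment> \<open>Fixed before \<alpha> and \<open>l\<close>, which makes \<open>c\<close>
    independent of both.\<close>
  then obtain m where m: "\<And>A. vertical_growth {s. \<bar>Re s\<bar> \<le> real A \<and> 1 \<le> \<bar>Im s\<bar>} (pi / 2 * d) (m A) H"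
    by metis
  define c where "c = (\<lambda>\<sigma>::real. if \<sigma> > 1 then 0 else real (growth_exponent d m (nat \<lceil>-\<sigma>\<rceil>)))"
  have conj_term: "cnj (a n) / of_nat n powr s = cnj (a n / of_nat n powr cnj s)" for n s
    by (simp add: cnj_powr)
  have r: "r \<ge> 1" using d by (cases r) (auto simp: d_def selberg_degree_def)
  \<comment> \<open>A coefficient off \<open>-N\<close> is wanted because for \<open>j = -N\<close>
    the index \<open>n0\<close> found below might be the omitted one.\<close>
  have "\<exists>j\<in>{-N..N}. j \<noteq> -N \<and> b j \<noteq> 0"
  proof (rule ccontr)
    assume "\<not> ?thesis"
    then have b0: "\<And>j. j \<in> {-N..N} - {-N} \<Longrightarrow> b j = 0" by auto
    have "selberg_S r lam mu s = b (-N) * exp (\<i> * of_real (pi * d * w (-N)) * s)" for s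
    proof -
      have "selberg_S r lam mu s = b (-N) * exp (\<i> * of_real (pi * d * w (-N)) * s) +
          (\<Sum>j\<in>{-N..N} - {-N}. b j * exp (\<i> * of_real (pi * d * w j) * s))"
        unfolding expn(5) d_def[symmetric] using expn(1) by (intro sum.remove) auto
      also have "(\<Sum>j\<in>{-N..N} - {-N}. b j * exp (\<i> * of_real (pi * d * w j) * s)) = 0"
        by (rule sum.neutral) (use b0 in auto)
      finally show ?thesis by simp
    qed
    then show False using selberg_S_not_exponential[of r lam mu, OF sel(7) r] by blast
  qed
  then obtain j0 where j0: "j0 \<in> {-N..N}" "j0 \<noteq> -N" "b j0 \<noteq> 0" by blast
  have "\<exists>n\<ge>1. a n \<noteq> 0"
  proof (rule ccontr)
    assume "\<not> ?thesis"
    then have a0: "a n = 0" if "n \<ge> 1" for n using that by auto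
    obtain s where s: "Re s > 1" "F s \<noteq> 0" using sel(3) by blast
    have "F s = (\<Sum>\<^sub>\<infinity>n\<in>{1..}. a n / of_nat n powr s)" using sel(2)[OF s(1)] by (simp add: infsumI)
    also have "\<dots> = 0" by (rule infsum_0) (use a0 in auto)
    finally show False using s by simp
  qed
  then obtain n0 where n0: "n0 \<ge> 1" "a n0 \<noteq> 0" by blast
  have main: "(\<forall>s. Re s > 1 \<longrightarrow> (\<forall>j\<in>{-N..N}.
          (\<lambda>n. norm (Fbar_term a Q r lam mu w \<alpha> l s j n)) summable_on Fbar_index Q r lam N \<alpha> j)) \<and>
       (\<exists>G. G holomorphic_on UNIV \<and>
          (\<forall>s. Re s > 1 \<longrightarrow> G s = Fbar_series a Q r lam mu N b w \<alpha> l s) \<and>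
          (\<exists>s. G s \<noteq> 0) \<and>
          locally_uniform_vertical_bound G (selberg_degree r lam) c)"
    if \<alpha>: "\<alpha> > 0" for \<alpha> and l :: nat
  proof -
    define \<nu> where "\<nu> = n_alpha Q r lam \<alpha>"
    have \<nu>: "\<nu> > 0" unfolding \<nu>_def using n_alpha_pos[OF assms(1,2) \<alpha>] .
    define \<kappa> where "\<kappa> = s_star r lam mu l"
    define I where "I = Fbar_index Q r lam N \<alpha>"
    have I_eq: "I j = {n. n \<ge> 1 \<and> \<not> (j = -N \<and> real n = \<nu>)}" for j by (simp add: I_def Fbar_index_def \<nu>_def)
    interpret shifted_dirichlet_series "\<lambda>n. cnj (a n)" d \<nu> "{-N..N}" w b \<kappa> I
    proof
      show "d \<ge> 1" "\<nu> > 0" "finite {-N..N}" by (use d \<nu> in auto)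
      show "\<bar>w j\<bar> \<le> 1 / 2" if "j \<in> {-N..N}" for j using expn(4)[OF that] .
      show "(\<lambda>n. norm (cnj (a n) / of_nat n powr s)) summable_on {1..}" if "Re s > 1" for s
        unfolding conj_term complex_mod_cnj using that by (intro sel(1)) simp
      show "I j \<subseteq> {1..}" for j by (auto simp: I_eq)
      show "finite ({1..} - I j)" for j
        by (rule finite_subset[of _ "{nat \<lfloor>\<nu>\<rfloor>}"]) (auto simp: I_eq)
      fix j n assume j: "j \<in> {-N..N}" and n: "n \<in> I j"
      \<comment> \<open>At a zero the sine vanishes and the cosine is negative, so the angle is
        \<pi> and \<open>x = 1\<close>; this means \<open>j = -N\<close> and
        \<open>n = \<nu>\<close>, which \<open>I\<close> excludes.\<close>
      show "1 + cis (pi * (1/2 - w j)) * of_real ((\<nu> / real n) powr (1 / d)) \<noteq> 0"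
      proof
        assume z: "1 + cis (pi * (1/2 - w j)) * of_real ((\<nu> / real n) powr (1 / d)) = 0"
        define x where "x = (\<nu> / real n) powr (1 / d)"
        define \<phi> where "\<phi> = pi * (1/2 - w j)"
        have n1: "n \<ge> 1" using n by (auto simp: I_eq)
        have x: "x > 0" using \<nu> n1 by (simp add: x_def)
        have Re: "1 + cos \<phi> * x = 0" and Im: "sin \<phi> * x = 0"
          using z by (simp_all add: x_def \<phi>_def complex_eq_iff)
        have "sin \<phi> = 0" using Im x by simp
        then have "(cos \<phi>)\<^sup>2 = 1" using sin_cos_squared_add[of \<phi>] by simp
        moreover have "cos \<phi> < 0"
        proof (rule ccontr)
          assume "\<not> cos \<phi> < 0"
          then have "0 \<le> cos \<phi> * x" using x by simp
          then show False using Re by linarith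
        qed
        ultimately have cos: "cos \<phi> = -1" by (metis abs_of_neg minus_equation_iff power2_eq_1_iff not_one_less_zero)
        have w2: "- (1/2) \<le> w j" "w j \<le> 1/2" using expn(4)[OF j] by auto
        have \<phi>: "0 \<le> \<phi>" "\<phi> \<le> pi" using w2 by (auto simp: \<phi>_def mult_le_cancel_left1)
        have "\<phi> = pi" using cos_inj_pi[OF \<phi>, of pi] cos by simp
        then have "w j = w (-N)" using expn(3) by (simp add: \<phi>_def)
        then have "j = -N" using strict_mono_on_eqD[OF expn(2), of "-N" j] j expn(1) by simp
        moreover have "x = 1" using Re cos by simp
        then have "((\<nu> / real n) powr (1 / d)) powr d = 1" by (simp add: x_def)
        then have "\<nu> / real n = 1" using d \<nu> n1 by (simp add: powr_powr)
        then have "real n = \<nu>" using n1 by simp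
        ultimately show False using n by (simp add: I_eq)
      qed
    qed
    have summand_eq: "summand s j n = Fbar_term a Q r lam mu w \<alpha> l s j n" for s j n
      unfolding summand_def Fbar_term_def Let_def base_def x_def p_def unfolding d_def \<nu>_def \<kappa>_def ..
    have series_eq': "series s = Fbar_series a Q r lam mu N b w \<alpha> l s" for s
      unfolding series_def Fbar_series_def summand_eq e_def unfolding d_def I_def ..
    have D_eq: "D = pi / 2 * d" by (rule D_def)
    have S_eq: "S s = selberg_S r lam mu s" for s
      unfolding S_def expn(5) unfolding d_def ..
    interpret shifted_dirichlet_continuation "\<lambda>n. cnj (a n)" d \<nu> "{-N..N}" w b \<kappa> I H m
    proof
      show "H holomorphic_on UNIV" by (rule H(1))
      show "vertical_growth {s. \<bar>Re s\<bar> \<le> real A \<and> 1 \<le> \<bar>Im s\<bar>} D (m A) H" for A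
        unfolding D_eq by (rule m)
      show "H s = S (1 - s) * (\<Sum>\<^sub>\<infinity>n\<in>{1..}. cnj (a n) / of_nat n powr s)" if "Re s > 1" for s
      proof -
        have "(\<Sum>\<^sub>\<infinity>n\<in>{1..}. cnj (a n) / of_nat n powr s) = cnj (\<Sum>\<^sub>\<infinity>n\<in>{1..}. a n / of_nat n powr cnj s)"
          unfolding conj_term by (rule infsum_cnj)
        also have "(\<Sum>\<^sub>\<infinity>n\<in>{1..}. a n / of_nat n powr cnj s) = F (cnj s)"
          using sel(2)[of "cnj s"] that by (simp add: infsumI)
        finally have sum: "(\<Sum>\<^sub>\<infinity>n\<in>{1..}. cnj (a n) / of_nat n powr s) = cnj (F (cnj s))" .
        have "s \<noteq> 1" using that by auto
        then show ?thesis unfolding sum S_eq by (rule H(2))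
      qed
    qed
    obtain G where G: "G holomorphic_on UNIV" "\<And>s. Re s > 1 \<Longrightarrow> G s = series s"
      "\<And>A. vertical_growth {s. - real A \<le> Re s \<and> Re s \<le> 2 \<and> 1 \<le> \<bar>Im s\<bar>} D (growth_exponent d m A) G"
      using entire_continuation by blast
    have right: "vertical_growth {s. 1 + \<delta> \<le> Re s \<and> Re s \<le> B} D 0 G" if "\<delta> > 0" for \<delta> B
      by (rule vertical_growth_cong[OF series_growth[OF that]]) (use that G(2) in auto)
    have "locally_uniform_vertical_bound G d c"
      unfolding c_def
      by (rule locally_uniform_vertical_boundI) (use d G(1,3) right in \<open>auto simp: D_eq\<close>)
    then have "locally_uniform_vertical_bound G (selberg_degree r lam) c" by (simp only: d_def)
    moreover have "\<exists>s. Re s > 1 \<and> series s \<noteq> 0"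
    proof (rule series_nonzero)
      show "inj_on w {-N..N}" using expn(2) by (rule strict_mono_on_imp_inj_on)
      show "n0 \<in> I j0" using n0 j0 by (simp add: I_eq)
    qed (use j0 n0 in auto)
    then have "\<exists>s. G s \<noteq> 0" using G(2) by metis
    moreover have "(\<lambda>n. norm (Fbar_term a Q r lam mu w \<alpha> l s j n)) summable_on Fbar_index Q r lam N \<alpha> j"
      if "Re s > 1" "j \<in> {-N..N}" for s j
      using abs_summable_summand[OF that(2,1)] unfolding summand_eq I_def .
    moreover have "\<forall>s. Re s > 1 \<longrightarrow> G s = Fbar_series a Q r lam mu N b w \<alpha> l s"
      using G(2) series_eq' by simp
    ultimately show ?thesis using G(1) by blast
  qed
  show ?thesis
    by (rule exI[of _ c]) (use main in \<open>auto simp: c_def\<close>)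
qed

end
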